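(* Let $G$ be a finitely generated group that has the $b_2-b_1$ property with respect to the prime $2$. Suppose that $$\sup \{ b_1(G_i;\mathbb{F}_2) : G_i \text{ is a finite index subgroup of } G \} = \infty.$$ Then $G$ has a nested (decreasing) sequence of finite index normal subgroups $\{G_i\}$ such that $$b_1(G_i;\mathbb{F}_2) = \Omega\left( \frac{[G:G_i]}{\sqrt{\log [G:G_i]}\,\log\log [G:G_i]} \right).$$
   Context: For a prime $p$, $\mathbb{F}_p$ is the field of order $p$, and for $r=1,2$, $b_r(G;\mathbb{F}_p)$ denotes the dimension over $\mathbb{F}_p$ of the group homology $H_r(G;\mathbb{F}_p)$. A group $G$ has the $b_2-b_1$ property with respect to the prime $p$ if there is a uniform upper bound on $b_2(G_i;\mathbb{F}_p)-b_1(G_i;\mathbb{F}_p)$ as $G_i$ ranges over all finite index subgroups of $G$. For sequences $f_i$ and $g_i$, $f_i=\Omega(g_i)$ means that $f_i/g_i\to\infty$ as $i\to\infty$. *)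

theory Defs
  imports
    "Jordan_Normal_Form.VS_Connect"
    "HOL-Algebra.AbelCoset"
    "HOL-Algebra.Generated_Groups"
    "HOL-Library.Poly_Mapping"
    "HOL-Library.Extended_Real"
    "HOL-Library.Z2"
begin

section \<open>Group homology with trivial coefficients in a field\<close>

text \<open>
  \<open>H\<^sub>n(G; k)\<close> is the homology of the bar complex, i.e. of the standard (inhomogeneous) bar
  resolution of \<open>\<int>\<close> over \<open>\<int>G\<close>, tensored over \<open>\<int>G\<close> with the trivial module \<open>k\<close>. In degree \<open>n\<close> it
  is the \<open>k\<close>-vector space with basis the symbols \<open>[g\<^sub>1|\<dots>|g\<^sub>n]\<close>, which are represented by lists
  of length \<open>n\<close>, and its boundary map is
  \<open>\<partial>[g\<^sub>1|\<dots>|g\<^sub>n] = [g\<^sub>2|\<dots>|g\<^sub>n] + (\<Sum>0<i<n. (-1)^i [g\<^sub>1|\<dots>|g\<^sub>i g\<^sub>i\<^sub>+\<^sub>1|\<dots>|g\<^sub>n]) + (-1)^n [g\<^sub>1|\<dots>|g\<^sub>n\<^sub>-\<^sub>1]\<close>.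
  Vector spaces over a type \<open>'k\<close> of class \<open>field\<close> are modules over the record \<open>class_ring\<close>.
  The \<open>mult\<close> and \<open>one\<close> fields of a module record play no role.
\<close>

definition bar_chains ::
    "('a, 'b) monoid_scheme \<Rightarrow> nat \<Rightarrow> ('k::field, 'a list \<Rightarrow>\<^sub>0 'k) module" where
  "bar_chains G n =
     \<lparr>carrier = {c. \<forall>x \<in> Poly_Mapping.keys c. length x = n \<and> set x \<subseteq> carrier G},
      mult = (\<lambda>_ _. 0), one = 0, zero = 0, add = (+),
      smult = (\<lambda>a. Poly_Mapping.map ((*) a))\<rparr>"

definition bar_face :: "('a, 'b) monoid_scheme \<Rightarrow> nat \<Rightarrow> 'a list \<Rightarrow> 'a list" where
  "bar_face G i x =
     (if i = 0 then tl x
      else if i = length x then butlast x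
      else take (i - 1) x @ [x ! (i - 1) \<otimes>\<^bsub>G\<^esub> x ! i] @ drop (i + 1) x)"

definition bar_boundary ::
    "('a, 'b) monoid_scheme \<Rightarrow> nat \<Rightarrow> ('a list \<Rightarrow>\<^sub>0 'k::field) \<Rightarrow> ('a list \<Rightarrow>\<^sub>0 'k)" where
  "bar_boundary G n c =
     (if n = 0 then 0
      else \<Sum>x \<in> Poly_Mapping.keys c. \<Sum>i\<le>n.
             Poly_Mapping.single (bar_face G i x) ((-1) ^ i * Poly_Mapping.lookup c x))"

definition bar_cycles :: "('a, 'b) monoid_scheme \<Rightarrow> nat \<Rightarrow> ('a list \<Rightarrow>\<^sub>0 'k::field) set" where
  "bar_cycles G n = {c \<in> carrier (bar_chains G n). bar_boundary G n c = 0}"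

definition bar_boundaries :: "('a, 'b) monoid_scheme \<Rightarrow> nat \<Rightarrow> ('a list \<Rightarrow>\<^sub>0 'k::field) set" where
  "bar_boundaries G n = bar_boundary G (Suc n) ` carrier (bar_chains G (Suc n))"

text \<open>The quotient \<open>M / N\<close> by a submodule, on the cosets of \<open>N\<close> (cf. \<open>FactRing\<close>).\<close>

definition quotient_module ::
    "('k, 'v, 'c) module_scheme \<Rightarrow> 'v set \<Rightarrow> ('k, 'v set) module" where
  "quotient_module M N =
     \<lparr>carrier = a_rcosets\<^bsub>M\<^esub> N,
      mult = (\<lambda>_ _. N), one = N, zero = N, add = set_add M,
      smult = (\<lambda>a X. \<Union>x\<in>X. N +>\<^bsub>M\<^esub> (a \<odot>\<^bsub>M\<^esub> x))\<rparr>"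

definition group_homology ::
    "('a, 'b) monoid_scheme \<Rightarrow> nat \<Rightarrow> ('k::field, ('a list \<Rightarrow>\<^sub>0 'k) set) module" where
  "group_homology G n =
     quotient_module ((bar_chains G n)\<lparr>carrier := bar_cycles G n\<rparr>) (bar_boundaries G n)"

text \<open>
  \<open>b\<^sub>r(G; k)\<close>. For a group that is only finitely generated, \<open>H\<^sub>2\<close> may be infinite-dimensional, and
  \<open>vectorspace.dim\<close> carries no information then; hence the values in \<^typ>\<open>enat\<close>.
\<close>

definition betti :: "'k::field itself \<Rightarrow> nat \<Rightarrow> ('a, 'b) monoid_scheme \<Rightarrow> enat" where
  "betti _ r G =
     (let H = (group_homology G r :: ('k, ('a list \<Rightarrow>\<^sub>0 'k) set) module)
      in if vectorspace.fin_dim class_ring H then enat (vectorspace.dim class_ring H) else \<infinity>)"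


section \<open>Finitely generated groups and finite index subgroups\<close>

definition finitely_generated_group :: "('a, 'b) monoid_scheme \<Rightarrow> bool" where
  "finitely_generated_group G \<longleftrightarrow>
     group G \<and> (\<exists>S. finite S \<and> S \<subseteq> carrier G \<and> generate G S = carrier G)"

definition finite_index_subgroup :: "'a set \<Rightarrow> ('a, 'b) monoid_scheme \<Rightarrow> bool" where
  "finite_index_subgroup H G \<longleftrightarrow> subgroup H G \<and> finite (rcosets\<^bsub>G\<^esub> H)"

definition group_index :: "('a, 'b) monoid_scheme \<Rightarrow> 'a set \<Rightarrow> nat" where
  "group_index G H = card (rcosets\<^bsub>G\<^esub> H)"

text \<open>
  The prime \<open>p\<close> enters through the type \<open>'k\<close> of coefficients, the field of order \<open>p\<close>; for
  \<open>p = 2\<close> it is \<^typ>\<open>bit\<close>. Since \<open>\<infinity> - x = \<infinity>\<close> for every \<open>x\<close> in \<^typ>\<open>ereal\<close> (including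
  \<open>x = \<infinity>\<close>), the property entails that every \<open>b\<^sub>2\<close> is finite.
\<close>

definition b2_b1_property :: "'k::field itself \<Rightarrow> ('a, 'b) monoid_scheme \<Rightarrow> bool" where
  "b2_b1_property k G \<longleftrightarrow>
     (\<exists>C::real. \<forall>H. finite_index_subgroup H G \<longrightarrow>
        ereal_of_enat (betti k 2 (G\<lparr>carrier := H\<rparr>))
          - ereal_of_enat (betti k 1 (G\<lparr>carrier := H\<rparr>)) \<le> ereal C)"

text \<open>
  \<open>f = \<Omega>(g)\<close> in the sense \<open>f i / g i \<rightarrow> \<infinity>\<close>. This differs from \<open>f \<in> \<omega>(g)\<close> of
  \<open>Landau_Symbols\<close> where \<open>g\<close> vanishes or is negative: such indices cannot help the quotient,
  which is \<open>0\<close> when \<open>g i = 0\<close>, to tend to \<open>\<infinity>\<close>.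
\<close>

definition grows_faster :: "(nat \<Rightarrow> real) \<Rightarrow> (nat \<Rightarrow> real) \<Rightarrow> bool" where
  "grows_faster f g \<longleftrightarrow> filterlim (\<lambda>i. f i / g i) at_top sequentially"

end

theory Submission
  imports Defs
begin

text \<open>
  Let \<open>b\<^sub>1\<close> and \<open>b\<^sub>2\<close> be the mod 2 Betti numbers, and let \<open>\<Phi>(H)\<close> be the mod 2 Frattini subgroup of \<open>H\<close>,
  the joint kernel of all homomorphisms from \<open>H\<close> to the field \<open>F\<^sub>2\<close>. If \<open>b\<^sub>1(H) = n\<close>, then \<open>A = H / \<Phi>(H)\<close>
  is elementary abelian of order \<open>2^n\<close>. The engine of the proof is the inequality
  \<open>b\<^sub>1(\<Phi>(H)) \<ge> n (n choose l) - (C + 1) 2^n\<close>, valid for every \<open>l\<close> as soon as \<open>b\<^sub>2(H) \<le> n + C\<close>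
  (\<open>frattini_betti_lower_bound\<close>).

  To see it, consider 1-cocycles of \<open>H\<close> with values in the module of polynomial functions on \<open>A\<close> of
  degree at most \<open>l\<close>. Evaluating a cocycle at the origin gives a function on \<open>H\<close> which is a
  homomorphism on \<open>\<Phi>(H)\<close>, and the cocycle is determined by this homomorphism together with the \<open>2^n\<close>
  values of the function on coset representatives. So \<open>b\<^sub>1(\<Phi>(H)) + 2^n\<close> is at least the dimension of the
  space of cocycles. A cocycle is built one coefficient at a time, from the top degree down. A new
  coefficient has to solve an equation whose obstruction lies in \<open>H\<^sup>2(H; F\<^sub>2)\<close>, which costs at most \<open>b\<^sub>2\<close>
  dimensions, and its solutions form a coset of \<open>Hom(H, F\<^sub>2)\<close>, which gains \<open>n\<close> dimensions
  (\<open>card_cocycle_space_lower_bound\<close>). The coefficients of top degree meet no obstruction. With the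
  bound on \<open>b\<^sub>2\<close>, the gains in lower degrees are offset up to \<open>C\<close> for each of at most \<open>2^n\<close> monomials,
  and \<open>n (n choose l)\<close> remains from the top degree. For \<open>l = n / 2\<close> the binomial coefficient is of order
  \<open>2^n / \<surd>n\<close>, hence \<open>b\<^sub>1(\<Phi>(H)) \<ge> 2^n \<surd>n / 4\<close> when \<open>n\<close> is large (\<open>frattini_step\<close>).

  Now iterate: if \<open>N\<^sub>0\<close> is normal of finite index with \<open>b\<^sub>1(N\<^sub>0)\<close> large and \<open>N\<^sub>i\<^sub>+\<^sub>1 = \<Phi>(N\<^sub>i)\<close>, then every \<open>N\<^sub>i\<close> is
  normal, the index is multiplied by \<open>2^b\<^sub>1(N\<^sub>i)\<close> at each step, and the growth of \<open>b\<^sub>1\<close> just found gives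
  the claim (\<open>homology_growth_of_tower\<close>). A normal starting point has to be produced from a subgroup
  \<open>H\<close> with large \<open>b\<^sub>1\<close> that need not be normal. Its iterated Frattini subgroups \<open>L\<close> have \<open>b\<^sub>1(L)\<close> at least
  exponential in \<open>b\<^sub>1\<close> of the preceding one, while the logarithm of the index of the normal core of \<open>L\<close>
  is bounded by a constant multiple of \<open>log [G:L]\<close> (\<open>normal_core_index\<close>), and passing to a subgroup
  lowers \<open>b\<^sub>1\<close> by at most the binary logarithm of the index (\<open>card_bit_homs_le_restriction\<close>). So the
  core of a late \<open>L\<close> still has large \<open>b\<^sub>1\<close> (\<open>large_b1_normal_subgroup\<close>).

  The bar complex enters through two facts only: \<open>2^b\<^sub>1\<close> is the number of homomorphisms to \<open>F\<^sub>2\<close>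
  (\<open>betti_1_eq_log_card_bit_homs\<close>), and 2-cocycles fall into at most \<open>2^b\<^sub>2\<close> classes modulo coboundaries
  (\<open>two_cocycle_classes\<close>). All dimensions are counted as binary logarithms of cardinalities.
\<close>

section \<open>Linear algebra over the field with two elements\<close>

text \<open>
  These simplification rules replace addition and multiplication of bits by Boolean operations, out of
  reach of the rules for commutative rings.
\<close>

declare add_bit_eq_xor [simp del] mult_bit_eq_and [simp del]

lemma bit_double [simp]: "(x :: bit) + x = 0" "(x :: bit) + (x + y) = y"
  by (cases x; cases y; simp)+

lemma bit_add_eq_0_iff: "(x :: bit) + y = 0 \<longleftrightarrow> x = y"
  by (cases x; cases y; simp)

lemma finite_UNIV_bit [simp]: "finite (UNIV :: bit set)"
  and card_UNIV_bit [simp]: "card (UNIV :: bit set) = 2"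
proof -
  have "(UNIV :: bit set) = {0, 1}"
    by (metis (full_types) UNIV_eq_I bit_not_one_iff insertCI)
  then show "finite (UNIV :: bit set)" and "card (UNIV :: bit set) = 2"
    by (metis finite.simps, metis card_2_iff zero_neq_one)
qed

lemma chain_double [simp]:
  "(c :: 'l \<Rightarrow>\<^sub>0 bit) + c = 0" "(c :: 'l \<Rightarrow>\<^sub>0 bit) + (c + d) = d"
proof -
  show *: "(c :: 'l \<Rightarrow>\<^sub>0 bit) + c = 0" for c :: "'l \<Rightarrow>\<^sub>0 bit"
    by (rule poly_mapping_eqI) (simp add: lookup_add)
  show "c + (c + d) = d" by (simp add: add.assoc[symmetric] *)
qed

abbreviation chain_scale :: "bit \<Rightarrow> ('l \<Rightarrow>\<^sub>0 bit) \<Rightarrow> ('l \<Rightarrow>\<^sub>0 bit)" where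
  "chain_scale a \<equiv> Poly_Mapping.map ((*) a)"

lemma chain_scale_simps [simp]: "chain_scale 0 c = 0" "chain_scale 1 c = c"
  by (rule poly_mapping_eqI; simp add: map.rep_eq when_def)+

interpretation chain_space: vector_space "chain_scale :: bit \<Rightarrow> ('l \<Rightarrow>\<^sub>0 bit) \<Rightarrow> _"
proof
  fix a b :: bit and c d :: "'l \<Rightarrow>\<^sub>0 bit"
  show "chain_scale a (c + d) = chain_scale a c + chain_scale a d"
    "chain_scale (a + b) c = chain_scale a c + chain_scale b c"
    "chain_scale a (chain_scale b c) = chain_scale (a * b) c"
    "chain_scale 1 c = c"
    by (cases a; cases b; simp)+
qed

interpretation bit_space: vector_space "(*) :: bit \<Rightarrow> bit \<Rightarrow> bit"
  by unfold_locales (simp_all add: algebra_simps)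

interpretation chain_functional: vector_space_pair
  "chain_scale :: bit \<Rightarrow> ('l \<Rightarrow>\<^sub>0 bit) \<Rightarrow> _" "(*) :: bit \<Rightarrow> bit \<Rightarrow> bit" ..

lemma chain_subspaceI:
  assumes "0 \<in> W" "\<And>x y. x \<in> W \<Longrightarrow> y \<in> W \<Longrightarrow> x + y \<in> W"
  shows "chain_space.subspace W"
proof (rule chain_space.subspaceI)
  fix c x assume "x \<in> W" then show "chain_scale c x \<in> W" using assms(1) by (cases c) auto
qed (use assms in auto)

lemma chain_linear_add:
  "Vector_Spaces.linear chain_scale ((*) :: bit \<Rightarrow> bit \<Rightarrow> bit) L \<Longrightarrow> L (x + y) = L x + L y"
  by (rule chain_functional.linear_add)

lemma chain_linear_0:
  "Vector_Spaces.linear chain_scale ((*) :: bit \<Rightarrow> bit \<Rightarrow> bit) L \<Longrightarrow> L 0 = 0"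
  by (rule chain_functional.linear_0)

text \<open>
  Extend a basis of \<open>B\<close> by \<open>z\<close> and prescribe the values on the extended basis.
\<close>

lemma functional_separation:
  fixes B :: "('l \<Rightarrow>\<^sub>0 bit) set"
  assumes "0 \<in> B" "\<And>x y. x \<in> B \<Longrightarrow> y \<in> B \<Longrightarrow> x + y \<in> B" "z \<notin> B"
  obtains L :: "('l \<Rightarrow>\<^sub>0 bit) \<Rightarrow> bit"
  where "\<forall>x y. L (x + y) = L x + L y" "\<forall>x\<in>B. L x = 0" "L z = 1"
proof -
  have sub: "chain_space.subspace B" by (rule chain_subspaceI) (use assms in auto)
  obtain A where A: "A \<subseteq> B" "chain_space.independent A" "B \<subseteq> chain_space.span A"
    using chain_space.maximal_independent_subset by metis
  have "chain_space.span A \<subseteq> B" using A(1) sub by (rule chain_space.span_minimal)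
  then have "z \<notin> chain_space.span A" using assms(3) by auto
  then have ind: "chain_space.independent (insert z A)"
    using A(2) chain_space.independent_insertI by blast
  obtain L where L: "Vector_Spaces.linear chain_scale (*) L"
    "\<forall>x\<in>insert z A. L x = (if x = z then 1 else 0 :: bit)"
    using chain_functional.linear_independent_extend[OF ind, of "\<lambda>x. if x = z then 1 else 0"] by blast
  have "chain_space.subspace {x. L x = 0}"
    by (rule chain_subspaceI) (simp_all add: chain_linear_add[OF L(1)] chain_linear_0[OF L(1)])
  moreover have "A \<subseteq> {x. L x = 0}" using L(2) A(1) assms(3) by auto
  ultimately have "chain_space.span A \<subseteq> {x. L x = 0}" by (rule chain_space.span_minimal[rotated])
  then show ?thesis
    by (intro that[of L]) (use L(2) A(3) chain_linear_add[OF L(1)] in auto)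
qed

text \<open>
  Choose preimages of a basis of the image of \<open>V\<close>, prescribe the values of \<open>g\<close> on the basis by those
  of \<open>L\<close> on the preimages, and extend linearly.
\<close>

lemma functional_factorization:
  fixes d :: "('l \<Rightarrow>\<^sub>0 bit) \<Rightarrow> ('m \<Rightarrow>\<^sub>0 bit)" and L :: "('l \<Rightarrow>\<^sub>0 bit) \<Rightarrow> bit"
  assumes V: "0 \<in> V" "\<And>x y. x \<in> V \<Longrightarrow> y \<in> V \<Longrightarrow> x + y \<in> V"
    and d: "\<And>x y. d (x + y) = d x + d y" and L: "\<And>x y. L (x + y) = L x + L y"
    and ker: "\<And>x. x \<in> V \<Longrightarrow> d x = 0 \<Longrightarrow> L x = 0"
  obtains g :: "('m \<Rightarrow>\<^sub>0 bit) \<Rightarrow> bit"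
  where "\<forall>x y. g (x + y) = g x + g y" "\<forall>x\<in>V. g (d x) = L x"
proof -
  have d0: "d 0 = 0" and L0: "L 0 = 0" using d[of 0 0] L[of 0 0] by simp_all
  obtain A where A: "A \<subseteq> d ` V" "chain_space.independent A" "d ` V \<subseteq> chain_space.span A"
    using chain_space.maximal_independent_subset by metis
  define p where "p w = (SOME v. v \<in> V \<and> d v = w)" for w
  have p: "p w \<in> V \<and> d (p w) = w" if "w \<in> d ` V" for w
    unfolding p_def by (rule someI_ex) (use that in auto)
  obtain g where g: "Vector_Spaces.linear chain_scale (*) g" "\<forall>w\<in>A. g w = L (p w)"
    using chain_functional.linear_independent_extend[OF A(2), of "\<lambda>w. L (p w)"] by blast
  let ?W = "{w. \<exists>v\<in>V. d v = w \<and> g w = L v}"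
  have "chain_space.subspace ?W"
  proof (rule chain_subspaceI)
    show "0 \<in> ?W" using V(1) d0 L0 chain_linear_0[OF g(1)] by auto
    fix x y assume "x \<in> ?W" "y \<in> ?W"
    then obtain u v where "u \<in> V" "d u = x" "g x = L u" "v \<in> V" "d v = y" "g y = L v" by auto
    then show "x + y \<in> ?W"
      by (auto intro!: bexI[of _ "u + v"] simp: d L V chain_linear_add[OF g(1)])
  qed
  moreover have "A \<subseteq> ?W" using A(1) p g(2) by blast
  ultimately have "chain_space.span A \<subseteq> ?W" by (rule chain_space.span_minimal[rotated])
  then have W: "d ` V \<subseteq> ?W" using A(3) by auto
  have "g (d x) = L x" if x: "x \<in> V" for x
  proof -
    obtain v where v: "v \<in> V" "d v = d x" "g (d x) = L v" using W x by blast
    have "L (x + v) = 0" by (rule ker) (use V(2) x v d in auto)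
    then show ?thesis unfolding v(3) L bit_add_eq_0_iff by simp
  qed
  then show ?thesis using that chain_linear_add[OF g(1)] by blast
qed

section \<open>Quotients of spaces of chains\<close>

text \<open>
  The setting shared by \<open>H\<^sub>1\<close> and \<open>H\<^sub>2\<close>: cycles \<open>Z\<close>, boundaries \<open>B\<close> and the quotient \<open>H\<close>. The parameters
  \<open>mul\<close> and \<open>unit\<close> are the ring operations that a module record carries along.
\<close>

locale chain_quotient =
  fixes Z B :: "('l \<Rightarrow>\<^sub>0 bit) set" and H :: "(bit, ('l \<Rightarrow>\<^sub>0 bit) set) module"
    and mul :: "('l \<Rightarrow>\<^sub>0 bit) \<Rightarrow> ('l \<Rightarrow>\<^sub>0 bit) \<Rightarrow> ('l \<Rightarrow>\<^sub>0 bit)" and unit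
  assumes zero_B: "0 \<in> B" and add_B: "\<And>x y. x \<in> B \<Longrightarrow> y \<in> B \<Longrightarrow> x + y \<in> B"
    and add_Z: "\<And>x y. x \<in> Z \<Longrightarrow> y \<in> Z \<Longrightarrow> x + y \<in> Z"
    and B_Z: "B \<subseteq> Z"
    and H_eq: "H = quotient_module
      \<lparr>carrier = Z, mult = mul, one = unit, zero = 0, add = (+), smult = chain_scale\<rparr> B"
begin

definition cls :: "('l \<Rightarrow>\<^sub>0 bit) \<Rightarrow> ('l \<Rightarrow>\<^sub>0 bit) set" where
  "cls x = (\<lambda>b. b + x) ` B"

lemma cls_eq: "cls x = {y. y + x \<in> B}"
proof (intro equalityI subsetI)
  fix y assume "y \<in> {y. y + x \<in> B}"
  then show "y \<in> cls x" unfolding cls_def by (intro image_eqI[of _ _ "y + x"]) (simp_all add: add.assoc)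
qed (auto simp: cls_def add.assoc)

lemma cls_iff: "cls x = cls y \<longleftrightarrow> x + y \<in> B"
proof
  assume "cls x = cls y"
  moreover have "x \<in> cls x" unfolding cls_eq using zero_B by simp
  ultimately show "x + y \<in> B" unfolding cls_eq by auto
next
  assume xy: "x + y \<in> B"
  have "z + y \<in> B" if "z + x \<in> B" for z
    using add_B[OF that xy] by (simp add: add.assoc)
  moreover have "z + x \<in> B" if "z + y \<in> B" for z
    using add_B[OF that xy] by (simp add: add_ac)
  ultimately show "cls x = cls y" unfolding cls_eq by auto
qed

lemma cls_0: "cls 0 = B"
  unfolding cls_def by simp

lemma zero_Z: "0 \<in> Z" using zero_B B_Z by auto

lemma carrier_H: "carrier H = cls ` Z"
  unfolding H_eq quotient_module_def A_RCOSETS_def RCOSETS_def r_coset_def cls_def by auto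

lemma add_H: "cls x \<oplus>\<^bsub>H\<^esub> cls y = cls (x + y)"
proof -
  have "cls x \<oplus>\<^bsub>H\<^esub> cls y = {u + v | u v. u \<in> cls x \<and> v \<in> cls y}"
    unfolding H_eq quotient_module_def set_add_def set_mult_def by auto
  also have "\<dots> = cls (x + y)"
  proof (intro equalityI subsetI)
    fix w assume "w \<in> {u + v | u v. u \<in> cls x \<and> v \<in> cls y}"
    then obtain b c where "b \<in> B" "c \<in> B" "w = (b + x) + (c + y)" unfolding cls_def by auto
    then have "w = (b + c) + (x + y)" "b + c \<in> B" by (simp_all add: add_B add_ac)
    then show "w \<in> cls (x + y)" unfolding cls_def by blast
  next
    fix w assume "w \<in> cls (x + y)"
    then obtain b where b: "b \<in> B" "w = b + (x + y)" unfolding cls_def by auto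
    have "b + x \<in> cls x" "y \<in> cls y" using b zero_B unfolding cls_eq by (simp_all add: add.assoc)
    moreover have "w = (b + x) + y" using b(2) by (simp add: add_ac)
    ultimately show "w \<in> {u + v | u v. u \<in> cls x \<and> v \<in> cls y}" by blast
  qed
  finally show ?thesis .
qed

lemma zero_H: "\<zero>\<^bsub>H\<^esub> = cls 0"
  unfolding cls_0 by (simp add: H_eq quotient_module_def)

lemma smult_H: "a \<odot>\<^bsub>H\<^esub> cls x = cls (chain_scale a x)"
proof -
  have "a \<odot>\<^bsub>H\<^esub> cls x = (\<Union>y\<in>cls x. cls (chain_scale a y))"
    unfolding H_eq quotient_module_def a_r_coset_def r_coset_def cls_def by auto
  also have "\<dots> = cls (chain_scale a x)"
  proof (cases a)
    case zero
    have "x \<in> cls x" using zero_B by (simp add: cls_eq)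
    then show ?thesis using zero by auto
  next
    case one
    have "cls (chain_scale a y) = cls x" if "y \<in> cls x" for y
      using that unfolding one chain_scale_simps cls_iff by (simp add: cls_eq)
    then have "(\<Union>y\<in>cls x. cls (chain_scale a y)) = (\<Union>y\<in>cls x. cls x)" by (rule SUP_cong[OF refl])
    moreover have "x \<in> cls x" using zero_B by (simp add: cls_eq)
    ultimately show ?thesis unfolding one chain_scale_simps by blast
  qed
  finally show ?thesis .
qed

lemma vectorspace_H: "vectorspace class_ring H"
proof -
  have f: "field (class_ring :: bit ring)" by (rule class_field.field_axioms)
  then have cring: "cring (class_ring :: bit ring)" unfolding field_def domain_def by blast
  have sc: "chain_scale a x \<in> Z" if "x \<in> Z" for a x using that zero_Z by (cases a) auto
  have neg: "\<exists>y\<in>Z. cls (x + y) = cls 0" if "x \<in> Z" for x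
    using that by (intro bexI[of _ x]) simp_all
  have "Module.module class_ring H"
    by (rule module_criteria)
      (auto simp: cring carrier_H add_H zero_H smult_H zero_Z add_Z sc neg
          chain_space.scale_right_distrib chain_space.scale_left_distrib add_ac
        intro!: imageI add_Z)
  then show ?thesis using f by (simp add: vectorspace_def)
qed

sublocale V: vectorspace "class_ring :: bit ring" H by (rule vectorspace_H)

text \<open>
  The classes on which a functional vanishes form a submodule. This replaces computations with linear
  combinations.
\<close>

lemma vanishes_of_gen_set:
  assumes A: "A \<subseteq> carrier H" "V.span A = carrier H"
    and L: "\<And>x y. x \<in> Z \<Longrightarrow> y \<in> Z \<Longrightarrow> L (x + y) = L x + (L y :: bit)" "\<And>x. x \<in> B \<Longrightarrow> L x = 0"
    and LA: "\<And>x. x \<in> Z \<Longrightarrow> cls x \<in> A \<Longrightarrow> L x = 0" and x: "x \<in> Z"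
  shows "L x = 0"
proof -
  let ?N = "cls ` {x \<in> Z. L x = 0}"
  have sc: "chain_scale a y \<in> Z \<and> L (chain_scale a y) = 0" if "y \<in> Z" "L y = 0" for a y
    using that zero_Z L(2) zero_B by (cases a) auto
  have "submodule class_ring ?N H"
  proof (rule submodule.intro)
    show "?N \<subseteq> carrier H" by (auto simp: carrier_H)
    show "v \<oplus>\<^bsub>H\<^esub> w \<in> ?N" if vw: "v \<in> ?N" "w \<in> ?N" for v w
    proof -
      obtain x y where "x \<in> Z" "L x = 0" "v = cls x" "y \<in> Z" "L y = 0" "w = cls y" using vw by auto
      then show ?thesis by (auto simp: add_H add_Z L intro!: image_eqI[of _ _ "x + y"])
    qed
    show "\<zero>\<^bsub>H\<^esub> \<in> ?N" using zero_Z L(2) zero_B by (auto simp: zero_H)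
    show "c \<odot>\<^bsub>H\<^esub> v \<in> ?N" if "v \<in> ?N" for c v
      using that sc by (auto simp: smult_H)
  qed (rule V.module_axioms)
  moreover have "A \<subseteq> ?N"
  proof
    fix X assume "X \<in> A"
    then obtain x where "x \<in> Z" "X = cls x" using A(1) by (auto simp: carrier_H)
    then show "X \<in> ?N" using LA \<open>X \<in> A\<close> by auto
  qed
  ultimately have "V.span A \<subseteq> ?N" by (intro V.span_is_subset)
  moreover have "cls x \<in> carrier H" using x unfolding carrier_H by (rule imageI)
  ultimately have "cls x \<in> ?N" using A(2) by blast
  then obtain y where y: "y \<in> Z" "L y = 0" "cls x = cls y" by blast
  have "L (x + y) = 0" by (rule L(2)) (use y(3) cls_iff in blast)
  then show ?thesis unfolding L(1)[OF x y(1)] y(2) by (metis add_0_right)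
qed

text \<open>
  A functional that vanishes on \<open>B\<close> induces one on the quotient; its signature is the set of members
  of \<open>A\<close> on which the induced functional takes the value 1. On a generating set \<open>A\<close> the signature
  determines the functional, which bounds the number of functionals by \<open>2 ^ card A\<close>.
\<close>

definition signature :: "('l \<Rightarrow>\<^sub>0 bit) set set \<Rightarrow> (('l \<Rightarrow>\<^sub>0 bit) \<Rightarrow> bit) \<Rightarrow> ('l \<Rightarrow>\<^sub>0 bit) set set" where
  "signature A L = {X \<in> A. \<exists>x\<in>Z. cls x = X \<and> L x = 1}"

lemma functional_determined:
  assumes A: "A \<subseteq> carrier H" "V.span A = carrier H"
    and L: "\<And>x y. L (x + y) = L x + (L y :: bit)" "\<And>x. x \<in> B \<Longrightarrow> L x = 0"
    and M: "\<And>x y. M (x + y) = M x + (M y :: bit)" "\<And>x. x \<in> B \<Longrightarrow> M x = 0"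
    and signature: "signature A L = signature A M" and x: "x \<in> Z"
  shows "L x = M x"
proof -
  have val: "N y = 1 \<longleftrightarrow> cls y \<in> signature A N"
    if "y \<in> Z" "cls y \<in> A" and N: "\<And>x y. N (x + y) = N x + (N y :: bit)" "\<And>x. x \<in> B \<Longrightarrow> N x = 0"
    for N y
  proof
    assume "cls y \<in> signature A N"
    then obtain z where z: "z \<in> Z" "cls z = cls y" "N z = 1" unfolding signature_def by blast
    have "N (z + y) = 0" by (rule N(2)) (use z(2) cls_iff in blast)
    then show "N y = 1" unfolding N(1) bit_add_eq_0_iff using z(3) by simp
  qed (use that in \<open>auto simp: signature_def\<close>)
  have "L x + M x = 0"
  proof (rule vanishes_of_gen_set[OF A _ _ _ x])
    show "L (y + z) + M (y + z) = (L y + M y) + (L z + M z)" for y z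
      unfolding L(1) M(1) by (simp only: add_ac)
    show "L y + M y = 0" if "y \<in> B" for y using that L(2) M(2) by simp
    show "L y + M y = 0" if "y \<in> Z" "cls y \<in> A" for y
      using val[OF that L] val[OF that M] signature by (metis bit_add_eq_0_iff bit_not_one_iff)
  qed
  then show ?thesis by (simp add: bit_add_eq_0_iff)
qed

text \<open>
  A criterion for classes of \<open>S\<close> to generate the quotient in terms of chains: \<open>S\<close> and \<open>B\<close> generate \<open>Z\<close>
  as an additive group.
\<close>

lemma gen_setI:
  assumes S: "S \<subseteq> Z"
    and Z: "\<And>W x. B \<subseteq> W \<Longrightarrow> S \<subseteq> W \<Longrightarrow> (\<And>x y. x \<in> W \<Longrightarrow> y \<in> W \<Longrightarrow> x + y \<in> W) \<Longrightarrow>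
      x \<in> Z \<Longrightarrow> x \<in> W"
  shows "V.span (cls ` S) = carrier H"
proof
  have SC: "cls ` S \<subseteq> carrier H" using S by (auto simp: carrier_H)
  then show "V.span (cls ` S) \<subseteq> carrier H" by (rule V.span_is_subset2)
  have sub: "submodule class_ring (V.span (cls ` S)) H" using SC by (rule V.span_is_submodule)
  show "carrier H \<subseteq> V.span (cls ` S)"
  proof
    fix X assume "X \<in> carrier H"
    then obtain x where x: "x \<in> Z" "X = cls x" by (auto simp: carrier_H)
    have "x \<in> {x. cls x \<in> V.span (cls ` S)}"
    proof (rule Z[OF _ _ _ x(1)])
      show "B \<subseteq> {x. cls x \<in> V.span (cls ` S)}"
      proof
        fix b assume "b \<in> B"
        then have "cls b = \<zero>\<^bsub>H\<^esub>" by (simp add: zero_H cls_iff)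
        then show "b \<in> {x. cls x \<in> V.span (cls ` S)}" using submodule.zero_closed[OF sub] by simp
      qed
      show "S \<subseteq> {x. cls x \<in> V.span (cls ` S)}" using V.in_own_span[OF SC] by auto
      show "x + y \<in> {x. cls x \<in> V.span (cls ` S)}"
        if "x \<in> {x. cls x \<in> V.span (cls ` S)}" "y \<in> {x. cls x \<in> V.span (cls ` S)}" for x y
        using submodule.m_closed[OF sub, of "cls x" "cls y"] that by (simp add: add_H)
    qed
    then show "X \<in> V.span (cls ` S)" using x by simp
  qed
qed

end

section \<open>Homomorphisms to the field with two elements\<close>

text \<open>
  The value 0 outside the carrier makes a homomorphism unique as a function, so that
  \<open>card (bit_homs G)\<close> is the order of \<open>Hom(G, F\<^sub>2)\<close>.
\<close>

definition bit_homs :: "('a, 'b) monoid_scheme \<Rightarrow> ('a \<Rightarrow> bit) set" where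
  "bit_homs G = {\<chi>. (\<forall>x\<in>carrier G. \<forall>y\<in>carrier G. \<chi> (x \<otimes>\<^bsub>G\<^esub> y) = \<chi> x + \<chi> y) \<and>
     (\<forall>x. x \<notin> carrier G \<longrightarrow> \<chi> x = 0)}"

definition joint_kernel :: "('a, 'b) monoid_scheme \<Rightarrow> ('a \<Rightarrow> bit) set \<Rightarrow> 'a set" where
  "joint_kernel G V = {x \<in> carrier G. \<forall>\<chi>\<in>V. \<chi> x = 0}"

lemma bit_homsD:
  "\<chi> \<in> bit_homs G \<Longrightarrow> x \<in> carrier G \<Longrightarrow> y \<in> carrier G \<Longrightarrow> \<chi> (x \<otimes>\<^bsub>G\<^esub> y) = \<chi> x + \<chi> y"
  "\<chi> \<in> bit_homs G \<Longrightarrow> x \<notin> carrier G \<Longrightarrow> \<chi> x = 0"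
  unfolding bit_homs_def by blast+

lemma bit_homs_zero: "(\<lambda>_. 0) \<in> bit_homs G"
  unfolding bit_homs_def by simp

lemma bit_homs_add:
  "\<chi> \<in> bit_homs G \<Longrightarrow> \<psi> \<in> bit_homs G \<Longrightarrow> (\<lambda>x. \<chi> x + \<psi> x) \<in> bit_homs G"
  unfolding bit_homs_def by (simp add: add_ac)

context group
begin

lemma bit_hom_one: "\<chi> \<in> bit_homs G \<Longrightarrow> \<chi> \<one> = 0"
  using bit_homsD(1)[of \<chi> G \<one> \<one>] by simp

lemma bit_hom_inv: "\<chi> \<in> bit_homs G \<Longrightarrow> x \<in> carrier G \<Longrightarrow> \<chi> (inv x) = \<chi> x"
  using bit_homsD(1)[of \<chi> G x "inv x"] bit_hom_one[of \<chi>] by (simp add: bit_add_eq_0_iff)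

lemma joint_kernel_subgroup:
  assumes "V \<subseteq> bit_homs G" shows "subgroup (joint_kernel G V) G"
proof (rule subgroupI)
  have "\<one> \<in> joint_kernel G V" using assms bit_hom_one by (auto simp: joint_kernel_def)
  then show "joint_kernel G V \<noteq> {}" by blast
  show "inv x \<in> joint_kernel G V" if "x \<in> joint_kernel G V" for x
  proof -
    have "\<chi> (inv x) = 0" if "\<chi> \<in> V" for \<chi>
      using bit_hom_inv[of \<chi> x] \<open>x \<in> joint_kernel G V\<close> assms that by (auto simp: joint_kernel_def)
    then show ?thesis using that by (simp add: joint_kernel_def)
  qed
  show "x \<otimes> y \<in> joint_kernel G V" if "x \<in> joint_kernel G V" "y \<in> joint_kernel G V" for x y
  proof -
    have "\<chi> (x \<otimes> y) = 0" if "\<chi> \<in> V" for \<chi>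
      using bit_homsD(1)[OF subsetD[OF assms that], of x y] that
        \<open>x \<in> joint_kernel G V\<close> \<open>y \<in> joint_kernel G V\<close> by (auto simp: joint_kernel_def)
    then show ?thesis using that by (simp add: joint_kernel_def)
  qed
qed (auto simp: joint_kernel_def)

lemma coset_eq_iff:
  assumes "subgroup H G" "x \<in> carrier G" "y \<in> carrier G"
  shows "H #> x = H #> y \<longleftrightarrow> x \<otimes> inv y \<in> H"
proof -
  have "H #> x = H #> y \<longleftrightarrow> x \<in> H #> y"
    using repr_independence[OF _ assms(3,1)] rcos_self[OF assms(2,1)] by metis
  also have "\<dots> \<longleftrightarrow> x \<otimes> inv y \<in> H" by (rule subgroup.rcos_module[OF assms(1) is_group assms(3,2)])
  finally show ?thesis .
qed

lemma joint_kernel_coset_iff: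
  assumes V: "V \<subseteq> bit_homs G" and xy: "x \<in> carrier G" "y \<in> carrier G"
  shows "joint_kernel G V #> x = joint_kernel G V #> y \<longleftrightarrow> (\<forall>\<chi>\<in>V. \<chi> x = \<chi> y)"
proof -
  have "\<chi> (x \<otimes> inv y) = 0 \<longleftrightarrow> \<chi> x = \<chi> y" if "\<chi> \<in> V" for \<chi>
    using bit_homsD(1)[of \<chi> G x "inv y"] bit_hom_inv[of \<chi> y] that V xy bit_add_eq_0_iff by auto
  then have "x \<otimes> inv y \<in> joint_kernel G V \<longleftrightarrow> (\<forall>\<chi>\<in>V. \<chi> x = \<chi> y)"
    using xy by (simp add: joint_kernel_def)
  then show ?thesis unfolding coset_eq_iff[OF joint_kernel_subgroup[OF V] xy] .
qed

text \<open>
  The witness is the product of the \<open>g i\<close> with \<open>w i = 1\<close>. It is found in any set \<open>W\<close> closed under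
  products; besides the carrier, this is used for the set of elements whose class in \<open>H\<^sub>1\<close> lies in a given
  subspace.
\<close>

lemma prescribed_values:
  fixes n :: nat
  assumes W: "W \<subseteq> carrier G" "\<one> \<in> W" "\<And>x y. x \<in> W \<Longrightarrow> y \<in> W \<Longrightarrow> x \<otimes> y \<in> W"
    and g: "\<And>i. i < n \<Longrightarrow> g i \<in> W"
  shows "\<exists>y\<in>W. \<forall>\<chi>\<in>bit_homs G. \<chi> y = (\<Sum>i<n. w i * \<chi> (g i))"
  using g
proof (induct n)
  case 0
  show ?case using W(2) bit_hom_one by (intro bexI[of _ \<one>]) auto
next
  case (Suc n)
  then obtain y where y: "y \<in> W" "\<And>\<chi>. \<chi> \<in> bit_homs G \<Longrightarrow> \<chi> y = (\<Sum>i<n. w i * \<chi> (g i))" by auto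
  have gn: "g n \<in> W" using Suc by simp
  show ?case
  proof (cases "w n")
    case zero
    then show ?thesis using y by auto
  next
    case one
    have "y \<otimes> g n \<in> W" using W y(1) gn by blast
    moreover have "\<chi> (y \<otimes> g n) = (\<Sum>i<Suc n. w i * \<chi> (g i))" if "\<chi> \<in> bit_homs G" for \<chi>
    proof -
      have "\<chi> (y \<otimes> g n) = \<chi> y + \<chi> (g n)" using that y(1) gn W(1) by (intro bit_homsD(1)) auto
      then show ?thesis using y(2)[OF that] one by simp
    qed
    ultimately show ?thesis by blast
  qed
qed

end

text \<open>
  Homomorphisms \<open>a i\<close> together with elements \<open>g i\<close> dual to them. A maximal dual system plays the role of
  a basis of \<open>V\<close> and, at the same time, of a basis of the quotient by the joint kernel of \<open>V\<close>.
\<close>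

definition dual_system ::
    "('a, 'b) monoid_scheme \<Rightarrow> ('a \<Rightarrow> bit) set \<Rightarrow> nat \<Rightarrow> (nat \<Rightarrow> 'a \<Rightarrow> bit) \<Rightarrow> (nat \<Rightarrow> 'a) \<Rightarrow> bool" where
  "dual_system G V n a g \<longleftrightarrow>
     (\<forall>i<n. a i \<in> V \<and> g i \<in> carrier G) \<and> (\<forall>i<n. \<forall>j<n. a i (g j) = (if i = j then 1 else 0))"

lemma dual_system_combination:
  assumes V: "finite V" "(\<lambda>_. 0) \<in> V" "\<And>\<chi> \<psi>. \<chi> \<in> V \<Longrightarrow> \<psi> \<in> V \<Longrightarrow> (\<lambda>x. \<chi> x + \<psi> x) \<in> V"
    and d: "dual_system G V n a g"
  shows "2 ^ n \<le> card V"
    "\<And>w. (\<lambda>x. \<Sum>i<n. w i * a i x) \<in> V"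
    "\<And>w j. j < n \<Longrightarrow> (\<Sum>i<n. w i * a i (g j)) = w j"
proof -
  have comb: "(\<lambda>x. \<Sum>i<k. w i * a i x) \<in> V" if "k \<le> n" for w k
    using that
  proof (induction k)
    case (Suc k)
    have "(\<lambda>x. w k * a k x) \<in> V"
      using d Suc.prems V(2) by (cases "w k") (auto simp: dual_system_def)
    then show ?case using V(3)[OF Suc.IH] Suc.prems by simp
  qed (use V in simp)
  then show "\<And>w. (\<lambda>x. \<Sum>i<n. w i * a i x) \<in> V" by simp
  show eval: "(\<Sum>i<n. w i * a i (g j)) = w j" if "j < n" for w j
  proof -
    have "(\<Sum>i<n. w i * a i (g j)) = (\<Sum>i<n. if i = j then w i else 0)"
      using d that by (intro sum.cong) (auto simp: dual_system_def)
    then show ?thesis using that by simp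
  qed
  let ?F = "{..<n} \<rightarrow>\<^sub>E (UNIV :: bit set)"
  have "inj_on (\<lambda>w x. \<Sum>i<n. w i * a i x) ?F"
  proof (rule inj_onI)
    fix w v assume wv: "w \<in> ?F" "v \<in> ?F" "(\<lambda>x. \<Sum>i<n. w i * a i x) = (\<lambda>x. \<Sum>i<n. v i * a i x)"
    have "w j = v j" if "j < n" for j using eval[OF that] fun_cong[OF wv(3)] by metis
    then show "w = v" using wv(1,2) by (intro PiE_ext[of w]) auto
  qed
  then have "card ?F \<le> card V" using comb V(1) by (intro card_inj_on_le) auto
  then show "2 ^ n \<le> card V" by (simp add: card_PiE)
qed

context group
begin

text \<open>
  Take a dual system of maximal length, which exists since \<open>2 ^ n \<le> card V\<close>. If a member of \<open>V\<close> did not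
  vanish on the joint kernel of the \<open>a i\<close>, then subtracting from it its combination of the \<open>a i\<close> would
  yield one more dual pair.
\<close>

lemma dual_basis:
  assumes V: "V \<subseteq> bit_homs G" "finite V" "(\<lambda>_. 0) \<in> V"
      "\<And>\<chi> \<psi>. \<chi> \<in> V \<Longrightarrow> \<psi> \<in> V \<Longrightarrow> (\<lambda>x. \<chi> x + \<psi> x) \<in> V"
  obtains n a g where "dual_system G V n a g" "card V = 2 ^ n"
    "\<forall>\<chi>\<in>V. \<forall>x\<in>carrier G. \<chi> x = (\<Sum>i<n. a i x * \<chi> (g i))"
proof -
  let ?P = "\<lambda>n. \<exists>a g. dual_system G V n a g"
  have "?P 0" by (simp add: dual_system_def)
  moreover have "n \<le> card V" if "?P n" for n
    using that dual_system_combination(1)[OF V(2-4)] less_exp[of n] by (meson le_trans less_imp_le)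
  ultimately obtain n where n: "?P n" "\<And>m. ?P m \<Longrightarrow> m \<le> n"
    using Nat.ex_has_greatest_nat[of ?P 0 "card V"] by blast
  then obtain a g where d: "dual_system G V n a g" by blast
  have g: "g i \<in> carrier G" "a i \<in> V" if "i < n" for i using d that by (auto simp: dual_system_def)
  have ker: "\<chi> x = 0" if \<chi>: "\<chi> \<in> V" and x: "x \<in> carrier G" "\<And>i. i < n \<Longrightarrow> a i x = 0" for \<chi> x
  proof (rule ccontr)
    assume "\<chi> x \<noteq> 0"
    then have \<chi>x: "\<chi> x = 1" by simp
    define \<psi> where "\<psi> = (\<lambda>z. \<chi> z + (\<Sum>i<n. \<chi> (g i) * a i z))"
    have "\<psi> \<in> V"
      unfolding \<psi>_def by (rule V(4)[OF \<chi> dual_system_combination(2)[OF V(2-4) d]])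
    moreover have "\<psi> (g j) = 0" if "j < n" for j
    proof -
      have "(\<Sum>i<n. \<chi> (g i) * a i (g j)) = \<chi> (g j)"
        by (rule dual_system_combination(3)[OF V(2-4) d that])
      then show ?thesis unfolding \<psi>_def by simp
    qed
    moreover have "\<psi> x = 1" unfolding \<psi>_def using \<chi>x x(2) by simp
    ultimately have "dual_system G V (Suc n) (a(n := \<psi>)) (g(n := x))"
      using d x by (auto simp: dual_system_def less_Suc_eq)
    then show False using n(2)[of "Suc n"] by auto
  qed
  have formula: "\<chi> x = (\<Sum>i<n. a i x * \<chi> (g i))" if \<chi>: "\<chi> \<in> V" and x: "x \<in> carrier G" for \<chi> x
  proof -
    obtain y where y: "y \<in> carrier G" "\<And>\<chi>. \<chi> \<in> bit_homs G \<Longrightarrow> \<chi> y = (\<Sum>i<n. a i x * \<chi> (g i))"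
      using prescribed_values[of "carrier G" n g "\<lambda>i. a i x"] g by blast
    have split: "\<psi> (x \<otimes> inv y) = \<psi> x + \<psi> y" if "\<psi> \<in> V" for \<psi>
      using bit_homsD(1)[OF subsetD[OF V(1) that] x, of "inv y"] bit_hom_inv[OF subsetD[OF V(1) that]] y(1)
      by simp
    have "a j (x \<otimes> inv y) = 0" if "j < n" for j
    proof -
      have "a j y = (\<Sum>i<n. a i x * a j (g i))" using y(2) g(2)[OF that] V(1) by blast
      also have "\<dots> = (\<Sum>i<n. if i = j then a i x else 0)"
        using d that by (intro sum.cong) (auto simp: dual_system_def)
      also have "\<dots> = a j x" using that by simp
      finally show ?thesis using split[OF g(2)[OF that]] by simp
    qed
    then have "\<chi> (x \<otimes> inv y) = 0" by (intro ker[OF \<chi>]) (use x y(1) in auto)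
    then have "\<chi> x = \<chi> y" unfolding split[OF \<chi>] bit_add_eq_0_iff .
    then show ?thesis using y(2)[OF subsetD[OF V(1) \<chi>]] by simp
  qed
  have "card V \<le> card ({..<n} \<rightarrow>\<^sub>E (UNIV :: bit set))"
  proof (rule card_inj_on_le[of "\<lambda>\<chi>. restrict (\<chi> \<circ> g) {..<n}"])
    show "inj_on (\<lambda>\<chi>. restrict (\<chi> \<circ> g) {..<n}) V"
    proof (rule inj_onI)
      fix \<chi> \<psi> assume cp: "\<chi> \<in> V" "\<psi> \<in> V" "restrict (\<chi> \<circ> g) {..<n} = restrict (\<psi> \<circ> g) {..<n}"
      have "\<chi> (g i) = \<psi> (g i)" if "i < n" for i using fun_cong[OF cp(3), of i] that by simp
      then have "\<chi> x = \<psi> x" if "x \<in> carrier G" for x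
        unfolding formula[OF cp(1) that] formula[OF cp(2) that] by (intro sum.cong) auto
      moreover have "\<chi> x = \<psi> x" if "x \<notin> carrier G" for x
        using bit_homsD(2)[OF subsetD[OF V(1) cp(1)] that] bit_homsD(2)[OF subsetD[OF V(1) cp(2)] that]
        by simp
      ultimately show "\<chi> = \<psi>" by blast
    qed
    show "(\<lambda>\<chi>. restrict (\<chi> \<circ> g) {..<n}) ` V \<subseteq> {..<n} \<rightarrow>\<^sub>E UNIV" by (intro image_subsetI) simp
    show "finite ({..<n} \<rightarrow>\<^sub>E (UNIV :: bit set))" by (intro finite_PiE) simp_all
  qed
  then have "card V = 2 ^ n"
    using dual_system_combination(1)[OF V(2,3) _ d] V(4) by (intro antisym) (simp_all add: card_PiE)
  moreover have "\<forall>\<chi>\<in>V. \<forall>x\<in>carrier G. \<chi> x = (\<Sum>i<n. a i x * \<chi> (g i))"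
    by (intro ballI formula)
  ultimately show thesis by (rule that[OF d])
qed

text \<open>
  By duality, the quotient by the joint kernel is isomorphic to \<open>F\<^sub>2^n\<close> through the coordinates \<open>a i\<close>,
  and \<open>card V = 2 ^ n\<close>.
\<close>

lemma card_rcosets_joint_kernel:
  assumes V: "V \<subseteq> bit_homs G" "finite V" "(\<lambda>_. 0) \<in> V"
      "\<And>\<chi> \<psi>. \<chi> \<in> V \<Longrightarrow> \<psi> \<in> V \<Longrightarrow> (\<lambda>x. \<chi> x + \<psi> x) \<in> V"
  shows "finite (rcosets (joint_kernel G V))" "card (rcosets (joint_kernel G V)) = card V"
proof -
  obtain n a g where d: "dual_system G V n a g" and n: "card V = 2 ^ n"
    and f: "\<forall>\<chi>\<in>V. \<forall>x\<in>carrier G. \<chi> x = (\<Sum>i<n. a i x * \<chi> (g i))"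
    by (rule dual_basis[OF V])
  have g: "g i \<in> carrier G" "a i \<in> V" if "i < n" for i using d that by (auto simp: dual_system_def)
  have "\<exists>y\<in>carrier G. \<forall>\<chi>\<in>bit_homs G. \<chi> y = (\<Sum>i<n. w i * \<chi> (g i))" for w
    using prescribed_values[of "carrier G" n g w] g by blast
  then have "\<exists>y. \<forall>w. y w \<in> carrier G \<and> (\<forall>\<chi>\<in>bit_homs G. \<chi> (y w) = (\<Sum>i<n. w i * \<chi> (g i)))"
    by (intro choice) blast
  then obtain y where y: "\<And>w. y w \<in> carrier G"
    "\<And>w \<chi>. \<chi> \<in> bit_homs G \<Longrightarrow> \<chi> (y w) = (\<Sum>i<n. w i * \<chi> (g i))" by blast
  have ay: "a j (y w) = w j" if "j < n" for j w
  proof -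
    have "a j (y w) = (\<Sum>i<n. w i * a j (g i))" using y(2) g(2)[OF that] V(1) by blast
    also have "\<dots> = (\<Sum>i<n. if i = j then w i else 0)"
      using d that by (intro sum.cong) (auto simp: dual_system_def)
    finally show ?thesis using that by simp
  qed
  let ?F = "{..<n} \<rightarrow>\<^sub>E (UNIV :: bit set)" and ?K = "joint_kernel G V"
  have inj: "inj_on (\<lambda>w. ?K #> y w) ?F"
  proof (rule inj_onI)
    fix w v assume wv: "w \<in> ?F" "v \<in> ?F" "?K #> y w = ?K #> y v"
    then have eq: "\<forall>\<chi>\<in>V. \<chi> (y w) = \<chi> (y v)"
      using joint_kernel_coset_iff[OF V(1) y(1)[of w] y(1)[of v]] by simp
    have "w j = v j" if "j < n" for j
      using ay[OF that, of w] ay[OF that, of v] bspec[OF eq g(2)[OF that]] by simp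
    then show "w = v" using wv(1,2) by (intro PiE_ext[of w]) auto
  qed
  have "\<exists>w\<in>?F. ?K #> x = ?K #> y w" if x: "x \<in> carrier G" for x
  proof
    let ?w = "restrict (\<lambda>i. a i x) {..<n}"
    show "?w \<in> ?F" by simp
    have "\<forall>\<chi>\<in>V. \<chi> x = \<chi> (y ?w)"
    proof
      fix \<chi> assume \<chi>: "\<chi> \<in> V"
      have "\<chi> x = (\<Sum>i<n. a i x * \<chi> (g i))" by (rule f[rule_format, OF \<chi> x])
      also have "\<dots> = (\<Sum>i<n. ?w i * \<chi> (g i))" by (rule sum.cong) simp_all
      also have "\<dots> = \<chi> (y ?w)" using y(2)[of \<chi> ?w] subsetD[OF V(1) \<chi>] by simp
      finally show "\<chi> x = \<chi> (y ?w)" .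
    qed
    then show "?K #> x = ?K #> y ?w" using joint_kernel_coset_iff[OF V(1) x y(1)[of ?w]] by simp
  qed
  then have "rcosets ?K \<subseteq> (\<lambda>w. ?K #> y w) ` ?F" unfolding RCOSETS_def by blast
  moreover have "(\<lambda>w. ?K #> y w) ` ?F \<subseteq> rcosets ?K" using y(1) unfolding RCOSETS_def by blast
  ultimately have img: "rcosets ?K = (\<lambda>w. ?K #> y w) ` ?F" by (rule equalityI)
  have fin: "finite ?F" by (intro finite_PiE) simp_all
  show "finite (rcosets ?K)" unfolding img using fin by (rule finite_imageI)
  have "card (rcosets ?K) = card ?F" unfolding img by (rule card_image[OF inj])
  then show "card (rcosets ?K) = card V" by (simp add: n card_PiE)
qed

end

section \<open>Low-degree mod 2 homology\<close>

text \<open>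
  Induction over the cells of a chain, phrased for an additively closed set.
\<close>

lemma chain_mem_of_singles:
  fixes c :: "'l \<Rightarrow>\<^sub>0 bit"
  assumes W: "0 \<in> W" "\<And>x y. x \<in> W \<Longrightarrow> y \<in> W \<Longrightarrow> x + y \<in> W"
    and c: "\<And>x. x \<in> Poly_Mapping.keys c \<Longrightarrow> Poly_Mapping.single x 1 \<in> W"
  shows "c \<in> W"
proof -
  have "finite S \<Longrightarrow> S \<subseteq> Poly_Mapping.keys c \<Longrightarrow> (\<Sum>x\<in>S. Poly_Mapping.single x 1) \<in> W" for S
    by (induction S rule: finite_induct) (use W c in auto)
  moreover have "c = (\<Sum>x\<in>Poly_Mapping.keys c. Poly_Mapping.single x 1)"
  proof (rule poly_mapping_eqI)
    fix k
    have "poly_mapping.lookup c k = (if k \<in> Poly_Mapping.keys c then 1 else 0)"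
      by (cases "poly_mapping.lookup c k") (simp_all add: in_keys_iff)
    then show "poly_mapping.lookup c k = poly_mapping.lookup (\<Sum>x\<in>Poly_Mapping.keys c. Poly_Mapping.single x 1) k"
      by (simp add: lookup_sum lookup_single when_def)
  qed
  ultimately show ?thesis by (metis finite_keys order_refl)
qed

definition chain_eval :: "('l \<Rightarrow> bit) \<Rightarrow> ('l \<Rightarrow>\<^sub>0 bit) \<Rightarrow> bit" where
  "chain_eval f c = (\<Sum>x\<in>Poly_Mapping.keys c. f x * poly_mapping.lookup c x)"

lemma chain_eval_add: "chain_eval f (c + d) = chain_eval f c + chain_eval f d"
  unfolding chain_eval_def
  by (rule setsum_keys_plus_distrib[of "\<lambda>x v. f x * v"]) (simp_all add: distrib_left)

lemma chain_eval_single [simp]: "chain_eval f (Poly_Mapping.single x 1) = f x"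
  unfolding chain_eval_def by simp

lemma chain_eval_zero [simp]: "chain_eval f 0 = 0"
  unfolding chain_eval_def by simp

lemma bar_boundary_add:
  "bar_boundary G n (c + d) = bar_boundary G n c + bar_boundary G n (d :: 'a list \<Rightarrow>\<^sub>0 bit)"
proof (cases "n = 0")
  case False
  show ?thesis
    unfolding bar_boundary_def if_not_P[OF False]
    by (rule setsum_keys_plus_distrib[of
          "\<lambda>x v. \<Sum>i\<le>n. Poly_Mapping.single (bar_face G i x) ((-1) ^ i * v)"])
      (simp_all add: distrib_left single_add sum.distrib)
qed (simp add: bar_boundary_def)

lemma bar_boundary_zero [simp]: "bar_boundary G n 0 = (0 :: 'a list \<Rightarrow>\<^sub>0 bit)"
  unfolding bar_boundary_def by simp

lemma bit_minus_one_power: "(- 1 :: bit) ^ i = 1"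
proof -
  have "(- 1 :: bit) = 1" by (rule minus_unique) simp
  then show ?thesis by (simp only: power_one)
qed

lemma bar_boundary_single:
  "n \<noteq> 0 \<Longrightarrow> bar_boundary G n (Poly_Mapping.single x (1 :: bit)) =
     (\<Sum>i\<le>n. Poly_Mapping.single (bar_face G i x) 1)"
  unfolding bar_boundary_def bit_minus_one_power by simp

abbreviation bcell :: "'a list \<Rightarrow> 'a list \<Rightarrow>\<^sub>0 bit" where
  "bcell x \<equiv> Poly_Mapping.single x 1"

lemma bar_boundary_cell:
  "bar_boundary G 1 (bcell [g]) = 0"
  "bar_boundary G 2 (bcell [g, h]) = bcell [h] + (bcell [g \<otimes>\<^bsub>G\<^esub> h] + bcell [g])"
  "bar_boundary G 3 (bcell [g, h, k]) =
     bcell [h, k] + (bcell [g \<otimes>\<^bsub>G\<^esub> h, k] + (bcell [g, h \<otimes>\<^bsub>G\<^esub> k] + bcell [g, h]))"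
  by (simp_all add: bar_boundary_single bar_face_def numeral_eq_Suc atMost_Suc add_ac)

lemma bar_chains_carrier:
  "carrier (bar_chains G n :: (bit, 'a list \<Rightarrow>\<^sub>0 bit) module) =
     {c. \<forall>x\<in>Poly_Mapping.keys c. length x = n \<and> set x \<subseteq> carrier G}"
  unfolding bar_chains_def by simp

lemma bar_chains_closed:
  "0 \<in> carrier (bar_chains G n :: (bit, 'a list \<Rightarrow>\<^sub>0 bit) module)"
  "c \<in> carrier (bar_chains G n :: (bit, 'a list \<Rightarrow>\<^sub>0 bit) module) \<Longrightarrow>
   d \<in> carrier (bar_chains G n :: (bit, 'a list \<Rightarrow>\<^sub>0 bit) module) \<Longrightarrow>
   c + d \<in> carrier (bar_chains G n :: (bit, 'a list \<Rightarrow>\<^sub>0 bit) module)"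
  "length x = n \<Longrightarrow> set x \<subseteq> carrier G \<Longrightarrow>
   bcell x \<in> carrier (bar_chains G n :: (bit, 'a list \<Rightarrow>\<^sub>0 bit) module)"
  unfolding bar_chains_carrier using keys_add[of c d] by auto

lemma bar_cycles_closed:
  "0 \<in> (bar_cycles G n :: ('a list \<Rightarrow>\<^sub>0 bit) set)"
  "c \<in> (bar_cycles G n :: ('a list \<Rightarrow>\<^sub>0 bit) set) \<Longrightarrow> d \<in> bar_cycles G n \<Longrightarrow> c + d \<in> bar_cycles G n"
  unfolding bar_cycles_def using bar_chains_closed(1,2) by (auto simp: bar_boundary_add)

lemma bar_boundaries_closed:
  "0 \<in> (bar_boundaries G n :: ('a list \<Rightarrow>\<^sub>0 bit) set)"
  "c \<in> (bar_boundaries G n :: ('a list \<Rightarrow>\<^sub>0 bit) set) \<Longrightarrow> d \<in> bar_boundaries G n \<Longrightarrow>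
   c + d \<in> bar_boundaries G n"
proof -
  show "0 \<in> (bar_boundaries G n :: ('a list \<Rightarrow>\<^sub>0 bit) set)"
    unfolding bar_boundaries_def using bar_chains_closed(1) by (intro image_eqI[of _ _ 0]) auto
  assume "c \<in> (bar_boundaries G n :: ('a list \<Rightarrow>\<^sub>0 bit) set)" "d \<in> bar_boundaries G n"
  then obtain u v where uv: "u \<in> carrier (bar_chains G (Suc n) :: (bit, 'a list \<Rightarrow>\<^sub>0 bit) module)"
      "c = bar_boundary G (Suc n) u"
      "v \<in> carrier (bar_chains G (Suc n) :: (bit, 'a list \<Rightarrow>\<^sub>0 bit) module)"
      "d = bar_boundary G (Suc n) v"
    unfolding bar_boundaries_def by blast
  show "c + d \<in> bar_boundaries G n" unfolding bar_boundaries_def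
    by (rule image_eqI[of _ _ "u + v"]) (use uv bar_chains_closed(2) in \<open>auto simp: bar_boundary_add\<close>)
qed

lemma bar_boundariesI:
  "length x = Suc n \<Longrightarrow> set x \<subseteq> carrier G \<Longrightarrow>
   bar_boundary G (Suc n) (bcell x) \<in> (bar_boundaries G n :: ('a list \<Rightarrow>\<^sub>0 bit) set)"
  unfolding bar_boundaries_def using bar_chains_closed(3) by blast

lemma bar_boundaries_subset:
  fixes W :: "('a list \<Rightarrow>\<^sub>0 bit) set"
  assumes W: "0 \<in> W" "\<And>x y. x \<in> W \<Longrightarrow> y \<in> W \<Longrightarrow> x + y \<in> W"
    and c: "\<And>x. length x = Suc n \<Longrightarrow> set x \<subseteq> carrier G \<Longrightarrow> bar_boundary G (Suc n) (bcell x) \<in> W"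
  shows "bar_boundaries G n \<subseteq> W"
proof
  fix b :: "'a list \<Rightarrow>\<^sub>0 bit" assume "b \<in> bar_boundaries G n"
  then obtain u where u: "u \<in> carrier (bar_chains G (Suc n) :: (bit, 'a list \<Rightarrow>\<^sub>0 bit) module)"
    "b = bar_boundary G (Suc n) u" unfolding bar_boundaries_def by blast
  have "u \<in> {u. bar_boundary G (Suc n) u \<in> W}"
  proof (rule chain_mem_of_singles)
    show "0 \<in> {u. bar_boundary G (Suc n) u \<in> W}" using W(1) by simp
    show "x + y \<in> {u. bar_boundary G (Suc n) u \<in> W}"
      if "x \<in> {u. bar_boundary G (Suc n) u \<in> W}" "y \<in> {u. bar_boundary G (Suc n) u \<in> W}" for x y
      using that W(2) by (simp add: bar_boundary_add)
    show "bcell x \<in> {u. bar_boundary G (Suc n) u \<in> W}" if "x \<in> Poly_Mapping.keys u" for x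
      using that u(1) c by (simp add: bar_chains_carrier)
  qed
  then show "b \<in> W" using u(2) by simp
qed

lemma length_two: "length x = 2 \<Longrightarrow> \<exists>g h. x = [g, h]"
  and length_three: "length x = 3 \<Longrightarrow> \<exists>g h k. x = [g, h, k]"
  by (auto simp: numeral_eq_Suc length_Suc_conv)

context group
begin

lemma bar_boundaries_1_subset:
  fixes W :: "('a list \<Rightarrow>\<^sub>0 bit) set"
  assumes W: "0 \<in> W" "\<And>x y. x \<in> W \<Longrightarrow> y \<in> W \<Longrightarrow> x + y \<in> W"
    and c: "\<And>g h. g \<in> carrier G \<Longrightarrow> h \<in> carrier G \<Longrightarrow> bcell [h] + (bcell [g \<otimes> h] + bcell [g]) \<in> W"
  shows "bar_boundaries G 1 \<subseteq> W"
proof (rule bar_boundaries_subset[OF W])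
  fix x assume x: "length x = Suc 1" "set x \<subseteq> carrier G"
  then obtain g h where "x = [g, h]" using length_two[of x] by auto
  then show "bar_boundary G (Suc 1) (bcell x) \<in> W"
    using c[of g h] x(2) bar_boundary_cell(2)[of G g h] by (simp add: numeral_2_eq_2)
qed

lemma bar_boundaries_2_subset:
  fixes W :: "('a list \<Rightarrow>\<^sub>0 bit) set"
  assumes W: "0 \<in> W" "\<And>x y. x \<in> W \<Longrightarrow> y \<in> W \<Longrightarrow> x + y \<in> W"
    and c: "\<And>g h k. g \<in> carrier G \<Longrightarrow> h \<in> carrier G \<Longrightarrow> k \<in> carrier G \<Longrightarrow>
      bcell [h, k] + (bcell [g \<otimes> h, k] + (bcell [g, h \<otimes> k] + bcell [g, h])) \<in> W"
  shows "bar_boundaries G 2 \<subseteq> W"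
proof (rule bar_boundaries_subset[OF W])
  fix x assume x: "length x = Suc 2" "set x \<subseteq> carrier G"
  then obtain g h k where "x = [g, h, k]" using length_three[of x] by auto
  then show "bar_boundary G (Suc 2) (bcell x) \<in> W"
    using c[of g h k] x(2) bar_boundary_cell(3)[of G g h k] by (simp add: numeral_3_eq_3)
qed

text \<open>
  With trivial coefficients the boundary of a 1-cell \<open>[g]\<close> is \<open>[] - [] = 0\<close>.
\<close>

lemma bar_cycles_1: "bar_cycles G 1 = carrier (bar_chains G 1 :: (bit, 'a list \<Rightarrow>\<^sub>0 bit) module)"
proof -
  have "bar_boundary G 1 c = 0" if c: "c \<in> carrier (bar_chains G 1)" for c :: "'a list \<Rightarrow>\<^sub>0 bit"
  proof -
    have "c \<in> {c. bar_boundary G 1 c = 0}"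
    proof (rule chain_mem_of_singles)
      fix x assume "x \<in> Poly_Mapping.keys c"
      then have "length x = 1" using c by (simp add: bar_chains_carrier)
      then obtain g where "x = [g]" by (auto simp: length_Suc_conv)
      then show "bcell x \<in> {c. bar_boundary G 1 c = 0}" using bar_boundary_cell(1) by simp
    qed (simp_all add: bar_boundary_add)
    then show ?thesis by simp
  qed
  then show ?thesis unfolding bar_cycles_def by blast
qed

lemma bar_boundaries_1_cycles: "bar_boundaries G 1 \<subseteq> (bar_cycles G 1 :: ('a list \<Rightarrow>\<^sub>0 bit) set)"
  by (rule bar_boundaries_1_subset)
    (auto simp: bar_cycles_1 simp del: One_nat_def intro!: bar_chains_closed)

lemma bar_boundaries_2_cycles: "bar_boundaries G 2 \<subseteq> (bar_cycles G 2 :: ('a list \<Rightarrow>\<^sub>0 bit) set)"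
proof (rule bar_boundaries_2_subset)
  fix g h k assume "g \<in> carrier G" "h \<in> carrier G" "k \<in> carrier G"
  then show "bcell [h, k] + (bcell [g \<otimes> h, k] + (bcell [g, h \<otimes> k] + bcell [g, h])) \<in> bar_cycles G 2"
    by (simp add: bar_cycles_def bar_chains_closed bar_boundary_add bar_boundary_cell(2) m_assoc add_ac)
qed (simp_all add: bar_cycles_closed)

lemma chain_quotient_homology:
  assumes "n = 1 \<or> n = 2"
  shows "chain_quotient (bar_cycles G n) (bar_boundaries G n) (group_homology G n) (\<lambda>_ _. 0) 0"
proof
  show "group_homology G n = quotient_module \<lparr>carrier = bar_cycles G n, mult = \<lambda>_ _. 0, one = 0,
      zero = 0, add = (+), smult = chain_scale\<rparr> (bar_boundaries G n)"
    by (simp add: group_homology_def bar_chains_def)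
  show "bar_boundaries G n \<subseteq> (bar_cycles G n :: ('a list \<Rightarrow>\<^sub>0 bit) set)"
    using assms bar_boundaries_1_cycles bar_boundaries_2_cycles by blast
qed (fact bar_boundaries_closed bar_cycles_closed)+

lemma bit_hom_chain_eval_boundary:
  assumes "\<chi> \<in> bit_homs G" "c \<in> bar_boundaries G 1"
  shows "chain_eval (\<lambda>x. \<chi> (hd x)) c = 0"
proof -
  have "bar_boundaries G 1 \<subseteq> {c. chain_eval (\<lambda>x. \<chi> (hd x)) c = 0}"
    by (rule bar_boundaries_1_subset)
      (simp_all add: chain_eval_add bit_homsD(1)[OF assms(1)] add_ac)
  then show ?thesis using assms(2) by blast
qed

text \<open>
  Modulo boundaries \<open>[x y] = [x] + [y]\<close>.
\<close>

lemma bit_hom_of_functional: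
  assumes L: "\<And>x y. L (x + y) = L x + (L y :: bit)" and L0: "\<And>x. x \<in> bar_boundaries G 1 \<Longrightarrow> L x = 0"
  shows "(\<lambda>x. if x \<in> carrier G then L (bcell [x]) else 0) \<in> bit_homs G"
proof -
  have "L (bcell [x \<otimes> y]) = L (bcell [x]) + L (bcell [y])" if "x \<in> carrier G" "y \<in> carrier G" for x y
  proof -
    have "bcell [y] + (bcell [x \<otimes> y] + bcell [x]) \<in> bar_boundaries G 1"
      using bar_boundariesI[of "[x, y]" 1 G] that bar_boundary_cell(2)[of G x y]
      by (simp add: numeral_2_eq_2)
    from L0[OF this] have "L (bcell [y]) + (L (bcell [x \<otimes> y]) + L (bcell [x])) = 0" unfolding L .
    then show ?thesis
      by (cases "L (bcell [y])"; cases "L (bcell [x \<otimes> y])"; cases "L (bcell [x])") simp_all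
  qed
  then show ?thesis unfolding bit_homs_def by simp
qed

text \<open>
  Let \<open>a\<close>, \<open>g\<close> be a dual basis of the homomorphisms. The classes \<open>[g i]\<close> generate \<open>H\<^sub>1\<close>: an element on
  which every homomorphism vanishes has class 0, because a functional separating its class from 0
  would be a homomorphism, and every element is such an element times a product of some \<open>g i\<close>.
  Conversely a homomorphism is determined by its signature on a generating set, so no generating set
  has fewer than \<open>n\<close> members.
\<close>

theorem betti_1_eq_log_card_bit_homs:
  assumes fin: "finite (bit_homs G)"
  obtains n where "betti TYPE(bit) 1 G = enat n" "card (bit_homs G) = 2 ^ n"
proof -
  note One_nat_def [simp del]
  let ?Z = "bar_cycles G 1 :: ('a list \<Rightarrow>\<^sub>0 bit) set" and ?B = "bar_boundaries G 1 :: ('a list \<Rightarrow>\<^sub>0 bit) set"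
  let ?H = "group_homology G 1 :: (bit, ('a list \<Rightarrow>\<^sub>0 bit) set) module"
  interpret Q: chain_quotient ?Z ?B ?H "\<lambda>_ _. 0" 0
    by (rule chain_quotient_homology) simp
  obtain n a g where d: "dual_system G (bit_homs G) n a g" and n: "card (bit_homs G) = 2 ^ n"
    and f: "\<forall>\<chi>\<in>bit_homs G. \<forall>x\<in>carrier G. \<chi> x = (\<Sum>i<n. a i x * \<chi> (g i))"
    by (rule dual_basis[OF order_refl fin bit_homs_zero bit_homs_add])
  have g: "g i \<in> carrier G" "a i \<in> bit_homs G" if "i < n" for i
    using d that by (auto simp: dual_system_def)
  have cell_Z: "bcell [x] \<in> ?Z" if "x \<in> carrier G" for x
    unfolding bar_cycles_1 by (rule bar_chains_closed(3)) (use that in auto)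
  have cell_B: "bcell [y] + (bcell [x \<otimes> y] + bcell [x]) \<in> ?B" if "x \<in> carrier G" "y \<in> carrier G" for x y
    using bar_boundariesI[of "[x, y]" 1 G] that bar_boundary_cell(2)[of G x y]
    by (simp add: numeral_2_eq_2)
  let ?S = "(\<lambda>i. bcell [g i]) ` {..<n}"
  have gen: "Q.V.span (Q.cls ` ?S) = carrier ?H"
  proof (rule Q.gen_setI)
    show "?S \<subseteq> ?Z" using g cell_Z by auto
    fix W and c :: "'a list \<Rightarrow>\<^sub>0 bit"
    assume BW: "?B \<subseteq> W" and SW: "?S \<subseteq> W" and add: "\<And>x y. x \<in> W \<Longrightarrow> y \<in> W \<Longrightarrow> x + y \<in> W"
      and c: "c \<in> ?Z"
    let ?W = "{x \<in> carrier G. bcell [x] \<in> W}"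
    have mult: "x \<otimes> y \<in> ?W" if "x \<in> ?W" "y \<in> ?W" for x y
    proof -
      have "(bcell [y] + (bcell [x \<otimes> y] + bcell [x])) + (bcell [y] + bcell [x]) \<in> W"
        using that subsetD[OF BW cell_B[of x y]] by (intro add[of "bcell [y] + (_ + _)"] add[of "bcell [y]" "bcell [x]"]) auto
      moreover have "(bcell [y] + (bcell [x \<otimes> y] + bcell [x])) + (bcell [y] + bcell [x]) = bcell [x \<otimes> y]"
        by (simp add: add_ac)
      ultimately show ?thesis using that by simp
    qed
    have one: "\<one> \<in> ?W"
      using cell_B[of \<one> \<one>] BW by auto
    have K: "k \<in> ?W" if k: "k \<in> carrier G" and 0: "\<And>\<chi>. \<chi> \<in> bit_homs G \<Longrightarrow> \<chi> k = 0" for k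
    proof (rule ccontr)
      assume "k \<notin> ?W"
      then have "bcell [k] \<notin> ?B" using BW k by auto
      obtain L :: "('a list \<Rightarrow>\<^sub>0 bit) \<Rightarrow> bit" where L: "\<forall>x y. L (x + y) = L x + L y"
        "\<forall>x\<in>?B. L x = 0" "L (bcell [k]) = 1"
        by (rule functional_separation[OF bar_boundaries_closed \<open>bcell [k] \<notin> ?B\<close>])
      show False using 0[OF bit_hom_of_functional[OF L(1,2)[rule_format]]] L(3) k by simp
    qed
    have all: "x \<in> ?W" if x: "x \<in> carrier G" for x
    proof -
      have "g i \<in> ?W" if "i < n" for i using g[OF that] SW that by auto
      then obtain y where y: "y \<in> ?W" "\<And>\<chi>. \<chi> \<in> bit_homs G \<Longrightarrow> \<chi> y = (\<Sum>i<n. a i x * \<chi> (g i))"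
        using prescribed_values[of ?W n g "\<lambda>i. a i x"] one mult by auto
      have "x \<otimes> inv y \<in> ?W"
      proof (rule K)
        show "x \<otimes> inv y \<in> carrier G" using x y by simp
        fix \<chi> assume \<chi>: "\<chi> \<in> bit_homs G"
        have "\<chi> (x \<otimes> inv y) = \<chi> x + \<chi> y"
          using bit_homsD(1)[OF \<chi> x, of "inv y"] bit_hom_inv[OF \<chi>, of y] y(1) by simp
        then show "\<chi> (x \<otimes> inv y) = 0" unfolding f[rule_format, OF \<chi> x] y(2)[OF \<chi>] by simp
      qed
      from mult[OF this y(1)] show ?thesis using x y(1) by (simp add: m_assoc)
    qed
    show "c \<in> W"
    proof (rule chain_mem_of_singles[OF _ add])
      show "0 \<in> W" using BW bar_boundaries_closed(1) by blast
      fix x assume "x \<in> Poly_Mapping.keys c"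
      then have "length x = 1" "set x \<subseteq> carrier G"
        using c unfolding bar_cycles_1 bar_chains_carrier by auto
      then obtain z where "x = [z]" "z \<in> carrier G"
        by (auto simp: length_Suc_conv One_nat_def)
      then show "bcell x \<in> W" using all by blast
    qed
  qed
  have S: "finite (Q.cls ` ?S)" "Q.cls ` ?S \<subseteq> carrier ?H" "card (Q.cls ` ?S) \<le> n"
    using g cell_Z card_image_le[of "{..<n}" "\<lambda>i. Q.cls (bcell [g i])"]
    by (auto simp: Q.carrier_H image_image)
  have lower: "n \<le> card A" if A: "finite A" "A \<subseteq> carrier ?H" "Q.V.span A = carrier ?H" for A
  proof -
    let ?L = "\<lambda>\<chi>. chain_eval (\<lambda>x. \<chi> (hd x :: 'a))"
    have "inj_on (\<lambda>\<chi>. Q.signature A (?L \<chi>)) (bit_homs G)"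
    proof (rule inj_onI, rule ext)
      fix \<chi> \<psi> x
      assume \<chi>: "\<chi> \<in> bit_homs G" and \<psi>: "\<psi> \<in> bit_homs G" and eq: "Q.signature A (?L \<chi>) = Q.signature A (?L \<psi>)"
      show "\<chi> x = \<psi> x"
      proof (cases "x \<in> carrier G")
        case True
        have "?L \<chi> (bcell [x]) = ?L \<psi> (bcell [x])"
          by (rule Q.functional_determined[OF A(2,3) chain_eval_add bit_hom_chain_eval_boundary[OF \<chi>]
                chain_eval_add bit_hom_chain_eval_boundary[OF \<psi>] eq cell_Z[OF True]])
        then show ?thesis by simp
      qed (simp add: bit_homsD(2)[OF \<chi>] bit_homsD(2)[OF \<psi>])
    qed
    then have "card (bit_homs G) \<le> card (Pow A)"
      by (rule card_inj_on_le) (use A(1) in \<open>auto simp: Q.signature_def\<close>)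
    then show ?thesis unfolding n card_Pow[OF A(1)] by simp
  qed
  have "Q.V.fin_dim" unfolding Q.V.fin_dim_def using S gen by blast
  moreover have "Q.V.dim = n" unfolding Q.V.dim_def
  proof (rule Least_equality)
    show "\<exists>A. finite A \<and> card A = n \<and> A \<subseteq> carrier ?H \<and> Q.V.span A = carrier ?H"
      using S gen lower[OF S(1,2) gen] by (intro exI[of _ "Q.cls ` ?S"]) simp
  qed (use lower in blast)
  ultimately have "betti TYPE(bit) 1 G = enat n" unfolding betti_def Let_def by simp
  then show thesis using n that by blast
qed

definition two_cocycle :: "('a \<Rightarrow> 'a \<Rightarrow> bit) \<Rightarrow> bool" where
  "two_cocycle c \<longleftrightarrow> (\<forall>g\<in>carrier G. \<forall>h\<in>carrier G. \<forall>k\<in>carrier G.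
     c h k + (c (g \<otimes> h) k + (c g (h \<otimes> k) + c g h)) = 0)"

text \<open>
  The class of a cocycle is its signature on a generating set of \<open>H\<^sub>2\<close> with \<open>m\<close> members. If two cocycles
  have the same signature, their sum vanishes on all 2-cycles, that is on the kernel of the boundary
  map; it therefore factors through the boundary map, and the factor is a cochain whose coboundary is the
  sum of the two cocycles.
\<close>

theorem two_cocycle_classes:
  assumes "betti TYPE(bit) 2 G = enat m"
  obtains cl :: "('a \<Rightarrow> 'a \<Rightarrow> bit) \<Rightarrow> ('a list \<Rightarrow>\<^sub>0 bit) set set" where
    "finite (range cl)" "card (range cl) \<le> 2 ^ m"
    "\<And>c d. two_cocycle c \<Longrightarrow> two_cocycle d \<Longrightarrow> cl c = cl d \<Longrightarrow>
       \<exists>v. (\<forall>x. x \<notin> carrier G \<longrightarrow> v x = 0) \<and>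
         (\<forall>g\<in>carrier G. \<forall>h\<in>carrier G. c g h + d g h = v g + v h + v (g \<otimes> h))"
proof -
  let ?Z = "bar_cycles G 2 :: ('a list \<Rightarrow>\<^sub>0 bit) set" and ?B = "bar_boundaries G 2 :: ('a list \<Rightarrow>\<^sub>0 bit) set"
  let ?H = "group_homology G 2 :: (bit, ('a list \<Rightarrow>\<^sub>0 bit) set) module"
  interpret Q: chain_quotient ?Z ?B ?H "\<lambda>_ _. 0" 0
    by (rule chain_quotient_homology) simp
  have fd: "Q.V.fin_dim" and dim: "Q.V.dim = m"
    using assms unfolding betti_def Let_def by (auto split: if_splits)
  have "\<exists>A. finite A \<and> card A = m \<and> A \<subseteq> carrier ?H \<and> Q.V.span A = carrier ?H"
    unfolding dim[symmetric] unfolding Q.V.dim_def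
    by (rule LeastI_ex) (use fd in \<open>auto simp: Q.V.fin_dim_def\<close>)
  then obtain A where A: "finite A" "card A = m" "A \<subseteq> carrier ?H" "Q.V.span A = carrier ?H" by blast
  let ?L = "\<lambda>c. chain_eval (\<lambda>x. c (x ! 0) (x ! 1 :: 'a))"
  have L0: "?L c x = 0" if "two_cocycle c" "x \<in> ?B" for c x
  proof -
    have "?B \<subseteq> {x. ?L c x = 0}"
      by (rule bar_boundaries_2_subset)
        (use that(1) in \<open>simp_all add: chain_eval_add two_cocycle_def\<close>)
    then show ?thesis using that(2) by blast
  qed
  let ?cl = "\<lambda>c. Q.signature A (?L c)"
  show thesis
  proof (rule that[of ?cl])
    have sub: "range ?cl \<subseteq> Pow A" by (auto simp: Q.signature_def)
    show "finite (range ?cl)" using finite_subset[OF sub] A(1) by simp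
    show "card (range ?cl) \<le> 2 ^ m" using card_mono[OF _ sub] A(1,2) by (simp add: card_Pow)
    fix c d assume c: "two_cocycle c" and d: "two_cocycle d" and eq: "?cl c = ?cl d"
    let ?D = "\<lambda>x. ?L c x + ?L d x"
    have D_add: "?D (x + y) = ?D x + ?D y" for x y
      unfolding chain_eval_add by (simp only: add_ac)
    have D0: "?D x = 0" if "x \<in> carrier (bar_chains G 2)" "bar_boundary G 2 x = 0" for x
    proof -
      have "x \<in> ?Z" using that unfolding bar_cycles_def by simp
      from Q.functional_determined[OF A(3,4) chain_eval_add L0[OF c] chain_eval_add L0[OF d] eq this]
      show ?thesis by simp
    qed
    obtain v :: "('a list \<Rightarrow>\<^sub>0 bit) \<Rightarrow> bit" where v: "\<forall>x y. v (x + y) = v x + v y"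
      "\<forall>x\<in>carrier (bar_chains G 2). v (bar_boundary G 2 x) = ?D x"
      by (rule functional_factorization[OF bar_chains_closed(1,2) bar_boundary_add D_add D0])
    let ?v = "\<lambda>x. if x \<in> carrier G then v (bcell [x]) else 0"
    have "c g h + d g h = ?v g + ?v h + ?v (g \<otimes> h)" if gh: "g \<in> carrier G" "h \<in> carrier G" for g h
    proof -
      have "bcell [g, h] \<in> carrier (bar_chains G 2 :: (bit, 'a list \<Rightarrow>\<^sub>0 bit) module)"
        by (rule bar_chains_closed(3)) (use gh in auto)
      from v(2)[rule_format, OF this] show ?thesis
        using gh unfolding bar_boundary_cell(2) v(1)[rule_format] by (simp add: add_ac)
    qed
    then show "\<exists>v. (\<forall>x. x \<notin> carrier G \<longrightarrow> v x = 0) \<and>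
         (\<forall>g\<in>carrier G. \<forall>h\<in>carrier G. c g h + d g h = v g + v h + v (g \<otimes> h))"
      by (intro exI[of _ ?v] conjI ballI allI impI) simp_all
  qed
qed

end

section \<open>Counting cocycles with unipotent coefficients\<close>

text \<open>
  Pigeonhole principle: move each member of \<open>Z\<close> by a fixed member of its class. It is applied to
  obstruction classes and to restrictions of homomorphisms, with \<open>f\<close> the pointwise sum.
\<close>

lemma card_le_classes_times_differences:
  fixes f :: "'z \<Rightarrow> 'z \<Rightarrow> 'z"
  assumes "finite K" "finite C" "cl ` Z \<subseteq> C"
    and cancel: "\<And>x y z. f x z = f y z \<Longrightarrow> x = y"
    and diff: "\<And>x y. x \<in> Z \<Longrightarrow> y \<in> Z \<Longrightarrow> cl x = cl y \<Longrightarrow> f x y \<in> K"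
  shows "card Z \<le> card C * card K"
proof -
  define r where "r y = (SOME x. x \<in> Z \<and> cl x = y)" for y
  have r: "r (cl x) \<in> Z \<and> cl (r (cl x)) = cl x" if "x \<in> Z" for x
    unfolding r_def by (rule someI_ex) (use that in blast)
  let ?F = "\<lambda>x. (cl x, f x (r (cl x)))"
  have "inj_on ?F Z"
  proof (rule inj_onI)
    fix x y assume "?F x = ?F y"
    then have cl: "cl x = cl y" and eq: "f x (r (cl x)) = f y (r (cl y))" by blast+
    show "x = y" by (rule cancel[OF eq[folded cl]])
  qed
  moreover have "?F ` Z \<subseteq> C \<times> K"
  proof (rule image_subsetI)
    fix x assume x: "x \<in> Z"
    have "f x (r (cl x)) \<in> K" by (rule diff) (use x r[OF x] in simp_all)
    then show "?F x \<in> C \<times> K" using assms(3) x by blast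
  qed
  ultimately have "card Z \<le> card (C \<times> K)" using assms(1,2) by (intro card_inj_on_le) auto
  then show ?thesis by (simp add: card_cartesian_product)
qed

context group
begin

text \<open>
  The matrix entries of a representation by unipotent triangular matrices, whose rows and columns are
  indexed by \<open>F\<close> and ordered by \<open>rk\<close>.
\<close>

definition unitriangular_rep :: "'i set \<Rightarrow> ('i \<Rightarrow> nat) \<Rightarrow> ('i \<Rightarrow> 'i \<Rightarrow> 'a \<Rightarrow> bit) \<Rightarrow> bool" where
  "unitriangular_rep F rk \<rho> \<longleftrightarrow>
     (\<forall>J\<in>F. \<forall>g\<in>carrier G. \<rho> J J g = 1) \<and>
     (\<forall>J\<in>F. \<forall>I\<in>F. \<forall>g\<in>carrier G. \<rho> J I g \<noteq> 0 \<longrightarrow> I = J \<or> rk J < rk I) \<and>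
     (\<forall>J\<in>F. \<forall>I\<in>F. \<forall>g\<in>carrier G. \<forall>h\<in>carrier G.
        \<rho> J I (g \<otimes> h) = (\<Sum>T\<in>F. \<rho> J T g * \<rho> T I h))"

text \<open>
  The 1-cocycles with values in the representation, written by coordinates: \<open>\<phi> (g h) = \<phi> g + \<rho> g (\<phi> h)\<close>.
\<close>

definition cocycle_space :: "'i set \<Rightarrow> ('i \<Rightarrow> 'i \<Rightarrow> 'a \<Rightarrow> bit) \<Rightarrow> ('i \<Rightarrow> 'a \<Rightarrow> bit) set" where
  "cocycle_space F \<rho> = {\<phi>. (\<forall>J x. J \<notin> F \<or> x \<notin> carrier G \<longrightarrow> \<phi> J x = 0) \<and>
     (\<forall>J\<in>F. \<forall>g\<in>carrier G. \<forall>h\<in>carrier G. \<phi> J (g \<otimes> h) = \<phi> J g + (\<Sum>I\<in>F. \<rho> J I g * \<phi> I h))}"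

lemma cocycle_spaceD:
  assumes "\<phi> \<in> cocycle_space F \<rho>"
  shows "J \<notin> F \<or> x \<notin> carrier G \<Longrightarrow> \<phi> J x = 0"
    "J \<in> F \<Longrightarrow> g \<in> carrier G \<Longrightarrow> h \<in> carrier G \<Longrightarrow>
      \<phi> J (g \<otimes> h) = \<phi> J g + (\<Sum>I\<in>F. \<rho> J I g * \<phi> I h)"
  using assms unfolding cocycle_space_def by blast+

lemma cocycle_space_add:
  assumes "\<phi> \<in> cocycle_space F \<rho>" "\<psi> \<in> cocycle_space F \<rho>"
  shows "(\<lambda>J x. \<phi> J x + \<psi> J x) \<in> cocycle_space F \<rho>"
  unfolding cocycle_space_def
proof (intro CollectI conjI ballI allI impI)
  show "\<phi> J x + \<psi> J x = 0" if "J \<notin> F \<or> x \<notin> carrier G" for J x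
    using cocycle_spaceD(1)[OF assms(1) that] cocycle_spaceD(1)[OF assms(2) that] by simp
  show "\<phi> J (g \<otimes> h) + \<psi> J (g \<otimes> h) = \<phi> J g + \<psi> J g + (\<Sum>I\<in>F. \<rho> J I g * (\<phi> I h + \<psi> I h))"
    if "J \<in> F" "g \<in> carrier G" "h \<in> carrier G" for J g h
    unfolding cocycle_spaceD(2)[OF assms(1) that] cocycle_spaceD(2)[OF assms(2) that]
      distrib_left sum.distrib by (simp only: add_ac)
qed

lemma cocycle_space_empty: "cocycle_space {} \<rho> = {\<lambda>_ _. 0}"
  unfolding cocycle_space_def by auto

text \<open>
  For a cocycle \<open>\<phi>\<close> with coordinates in \<open>F\<close>, a coordinate function \<open>v\<close> for the additional index \<open>J\<close>
  extends \<open>\<phi>\<close> precisely if its coboundary is this 2-cochain.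
\<close>

definition obstruction :: "'i set \<Rightarrow> ('i \<Rightarrow> 'i \<Rightarrow> 'a \<Rightarrow> bit) \<Rightarrow> 'i \<Rightarrow> ('i \<Rightarrow> 'a \<Rightarrow> bit) \<Rightarrow> 'a \<Rightarrow> 'a \<Rightarrow> bit" where
  "obstruction F \<rho> J \<phi> g h = (\<Sum>I\<in>F. \<rho> J I g * \<phi> I h)"

definition trivializes :: "('a \<Rightarrow> 'a \<Rightarrow> bit) \<Rightarrow> ('a \<Rightarrow> bit) \<Rightarrow> bool" where
  "trivializes c v \<longleftrightarrow> (\<forall>x. x \<notin> carrier G \<longrightarrow> v x = 0) \<and>
     (\<forall>g\<in>carrier G. \<forall>h\<in>carrier G. c g h = v g + v h + v (g \<otimes> h))"

lemma trivializes_diff: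
  assumes "trivializes c v" "trivializes c w"
  shows "(\<lambda>x. v x + w x) \<in> bit_homs G"
  unfolding bit_homs_def
proof (intro CollectI conjI ballI allI impI)
  fix g h assume gh: "g \<in> carrier G" "h \<in> carrier G"
  have "v g + v h + v (g \<otimes> h) = w g + w h + w (g \<otimes> h)"
    using assms gh unfolding trivializes_def by metis
  then show "v (g \<otimes> h) + w (g \<otimes> h) = v g + w g + (v h + w h)"
    by (cases "v g"; cases "v h"; cases "v (g \<otimes> h)"; cases "w g"; cases "w h"; cases "w (g \<otimes> h)") simp_all
qed (use assms in \<open>simp add: trivializes_def\<close>)

lemma trivializes_add_hom:
  assumes "trivializes c v" "\<chi> \<in> bit_homs G"
  shows "trivializes c (\<lambda>x. v x + \<chi> x)"
  unfolding trivializes_def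
proof (intro conjI ballI allI impI)
  fix g h assume gh: "g \<in> carrier G" "h \<in> carrier G"
  have "c g h = v g + v h + v (g \<otimes> h)" using assms(1) gh unfolding trivializes_def by blast
  then show "c g h = v g + \<chi> g + (v h + \<chi> h) + (v (g \<otimes> h) + \<chi> (g \<otimes> h))"
    unfolding bit_homsD(1)[OF assms(2) gh]
    by (cases "v g"; cases "v h"; cases "v (g \<otimes> h)"; cases "\<chi> g"; cases "\<chi> h") simp_all
qed (use assms in \<open>simp add: trivializes_def bit_homsD(2)\<close>)

text \<open>
  The inductive step adds an index \<open>J\<close> of lowest rank. The coordinates in \<open>F\<close> then form a quotient of the
  representation on \<open>insert J F\<close>, whose kernel is one-dimensional and trivial.
\<close>

context
  fixes F :: "'i set" and rk \<rho> J
  assumes F: "finite F" and J: "J \<notin> F" and rep: "unitriangular_rep (insert J F) rk \<rho>"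
    and lowest: "\<And>T. T \<in> F \<Longrightarrow> rk J \<le> rk T"
begin

lemma column_zero:
  assumes "T \<in> F" "g \<in> carrier G" shows "\<rho> T J g = 0"
proof (rule ccontr)
  assume "\<rho> T J g \<noteq> 0"
  then have "J = T \<or> rk T < rk J" using rep assms unfolding unitriangular_rep_def by blast
  then show False using J assms(1) lowest[OF assms(1)] by auto
qed

lemma diag_one: "g \<in> carrier G \<Longrightarrow> \<rho> J J g = 1"
  using rep unfolding unitriangular_rep_def by blast

lemma unitriangular_rep_remove: "unitriangular_rep F rk \<rho>"
proof -
  have "\<rho> K I (g \<otimes> h) = (\<Sum>T\<in>F. \<rho> K T g * \<rho> T I h)"
    if "K \<in> F" "I \<in> F" "g \<in> carrier G" "h \<in> carrier G" for K I g h
  proof -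
    have "\<rho> K I (g \<otimes> h) = (\<Sum>T\<in>insert J F. \<rho> K T g * \<rho> T I h)"
      using rep that unfolding unitriangular_rep_def by blast
    then show ?thesis using column_zero that F J by simp
  qed
  then show ?thesis using rep unfolding unitriangular_rep_def by simp
qed

text \<open>
  This is the statement that the connecting map of the extension by the trivial line lands in cocycles.
  The representation property in row \<open>J\<close> turns \<open>c (g h) k\<close> into \<open>c h k\<close> plus a sum to which the cocycle
  equation of \<open>\<phi>\<close> applies.
\<close>

lemma obstruction_cocycle:
  assumes \<phi>: "\<phi> \<in> cocycle_space F \<rho>"
  shows "two_cocycle (obstruction F \<rho> J \<phi>)"
  unfolding two_cocycle_def
proof (intro ballI)
  fix g h k assume g: "g \<in> carrier G" and h: "h \<in> carrier G" and k: "k \<in> carrier G"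
  let ?c = "obstruction F \<rho> J \<phi>"
  have row: "\<rho> J I (g \<otimes> h) = \<rho> J I h + (\<Sum>T\<in>F. \<rho> J T g * \<rho> T I h)" if "I \<in> F" for I
  proof -
    have "\<rho> J I (g \<otimes> h) = (\<Sum>T\<in>insert J F. \<rho> J T g * \<rho> T I h)"
      using rep that g h unfolding unitriangular_rep_def by blast
    then show ?thesis using diag_one[OF g] F J by simp
  qed
  have "?c (g \<otimes> h) k = (\<Sum>I\<in>F. (\<rho> J I h + (\<Sum>T\<in>F. \<rho> J T g * \<rho> T I h)) * \<phi> I k)"
    unfolding obstruction_def by (rule sum.cong) (simp_all add: row)
  also have "\<dots> = ?c h k + (\<Sum>I\<in>F. \<Sum>T\<in>F. \<rho> J T g * (\<rho> T I h * \<phi> I k))"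
    unfolding obstruction_def distrib_right sum.distrib sum_distrib_right mult.assoc by (rule refl)
  also have "(\<Sum>I\<in>F. \<Sum>T\<in>F. \<rho> J T g * (\<rho> T I h * \<phi> I k)) =
      (\<Sum>T\<in>F. \<rho> J T g * (\<Sum>I\<in>F. \<rho> T I h * \<phi> I k))"
    unfolding sum_distrib_left by (rule sum.swap)
  also have "\<dots> = (\<Sum>T\<in>F. \<rho> J T g * (\<phi> T (h \<otimes> k) + \<phi> T h))"
  proof (rule sum.cong)
    fix T assume "T \<in> F"
    from cocycle_spaceD(2)[OF \<phi> this h k]
    have "(\<Sum>I\<in>F. \<rho> T I h * \<phi> I k) = \<phi> T (h \<otimes> k) + \<phi> T h" by (simp add: add.commute)
    then show "\<rho> J T g * (\<Sum>I\<in>F. \<rho> T I h * \<phi> I k) = \<rho> J T g * (\<phi> T (h \<otimes> k) + \<phi> T h)" by simp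
  qed simp
  also have "\<dots> = ?c g (h \<otimes> k) + ?c g h"
    unfolding obstruction_def by (simp add: distrib_left sum.distrib)
  finally show "?c h k + (?c (g \<otimes> h) k + (?c g (h \<otimes> k) + ?c g h)) = 0" by simp
qed

definition liftable :: "('i \<Rightarrow> 'a \<Rightarrow> bit) set" where
  "liftable = {\<phi> \<in> cocycle_space F \<rho>. \<exists>v. trivializes (obstruction F \<rho> J \<phi>) v}"

lemma extend_cocycle:
  assumes \<phi>: "\<phi> \<in> cocycle_space F \<rho>" and v: "trivializes (obstruction F \<rho> J \<phi>) v"
  shows "\<phi>(J := v) \<in> cocycle_space (insert J F) \<rho>"
  unfolding cocycle_space_def
proof (intro CollectI conjI ballI allI impI)
  show "(\<phi>(J := v)) K x = 0" if "K \<notin> insert J F \<or> x \<notin> carrier G" for K x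
    using that v cocycle_spaceD(1)[OF \<phi>] by (auto simp: trivializes_def)
  fix K g h assume K: "K \<in> insert J F" and g: "g \<in> carrier G" and h: "h \<in> carrier G"
  have F_sum: "(\<Sum>I\<in>F. \<rho> K I g * (\<phi>(J := v)) I h) = (\<Sum>I\<in>F. \<rho> K I g * \<phi> I h)"
    by (rule sum.cong) (use J in auto)
  have sum: "(\<Sum>I\<in>insert J F. \<rho> K I g * (\<phi>(J := v)) I h) = \<rho> K J g * v h + (\<Sum>I\<in>F. \<rho> K I g * \<phi> I h)"
    using F J F_sum by simp
  show "(\<phi>(J := v)) K (g \<otimes> h) = (\<phi>(J := v)) K g + (\<Sum>I\<in>insert J F. \<rho> K I g * (\<phi>(J := v)) I h)"
    unfolding sum
  proof (cases "K = J")
    case True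
    have "(\<Sum>I\<in>F. \<rho> J I g * \<phi> I h) = v g + v h + v (g \<otimes> h)"
      using v g h unfolding trivializes_def obstruction_def by blast
    then show "(\<phi>(J := v)) K (g \<otimes> h) = (\<phi>(J := v)) K g + (\<rho> K J g * v h + (\<Sum>I\<in>F. \<rho> K I g * \<phi> I h))"
      using True diag_one[OF g] by (simp add: add_ac)
  next
    case False
    then have "K \<in> F" using K by simp
    then show "(\<phi>(J := v)) K (g \<otimes> h) = (\<phi>(J := v)) K g + (\<rho> K J g * v h + (\<Sum>I\<in>F. \<rho> K I g * \<phi> I h))"
      using False column_zero[OF _ g] cocycle_spaceD(2)[OF \<phi> _ g h] by simp
  qed
qed

lemma restrict_cocycle:
  assumes \<psi>: "\<psi> \<in> cocycle_space (insert J F) \<rho>"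
  shows "\<psi>(J := \<lambda>_. 0) \<in> cocycle_space F \<rho>"
    and "trivializes (obstruction F \<rho> J (\<psi>(J := \<lambda>_. 0))) (\<psi> J)"
proof -
  have F_sum: "(\<Sum>I\<in>F. \<rho> K I g * (\<psi>(J := \<lambda>_. 0)) I h) = (\<Sum>I\<in>F. \<rho> K I g * \<psi> I h)" for K g h
    by (rule sum.cong) (use J in auto)
  have ins: "(\<Sum>I\<in>insert J F. \<rho> K I g * \<psi> I h) = \<rho> K J g * \<psi> J h + (\<Sum>I\<in>F. \<rho> K I g * \<psi> I h)" for K g h
    using F J by simp
  show "\<psi>(J := \<lambda>_. 0) \<in> cocycle_space F \<rho>"
    unfolding cocycle_space_def
  proof (intro CollectI conjI ballI allI impI)
    show "(\<psi>(J := \<lambda>_. 0)) K x = 0" if "K \<notin> F \<or> x \<notin> carrier G" for K x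
      using that cocycle_spaceD(1)[OF \<psi>, of K x] by auto
    fix K g h assume K: "K \<in> F" and g: "g \<in> carrier G" and h: "h \<in> carrier G"
    show "(\<psi>(J := \<lambda>_. 0)) K (g \<otimes> h) =
        (\<psi>(J := \<lambda>_. 0)) K g + (\<Sum>I\<in>F. \<rho> K I g * (\<psi>(J := \<lambda>_. 0)) I h)"
      unfolding F_sum using K J cocycle_spaceD(2)[OF \<psi> _ g h, of K] column_zero[OF K g] ins[of K g h]
      by auto
  qed
  show "trivializes (obstruction F \<rho> J (\<psi>(J := \<lambda>_. 0))) (\<psi> J)"
    unfolding trivializes_def obstruction_def F_sum
  proof (intro conjI ballI allI impI)
    fix g h assume g: "g \<in> carrier G" and h: "h \<in> carrier G"
    have "\<psi> J (g \<otimes> h) = \<psi> J g + (\<psi> J h + (\<Sum>I\<in>F. \<rho> J I g * \<psi> I h))"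
      using cocycle_spaceD(2)[OF \<psi> insertI1 g h] ins[of J g h] diag_one[OF g] by simp
    then show "(\<Sum>I\<in>F. \<rho> J I g * \<psi> I h) = \<psi> J g + \<psi> J h + \<psi> J (g \<otimes> h)" by (simp add: add_ac)
  qed (use cocycle_spaceD(1)[OF \<psi>] in auto)
qed

text \<open>
  The lifts of a liftable cocycle form a coset of \<open>Hom(G, F\<^sub>2)\<close>.
\<close>

lemma card_cocycle_space_insert:
  assumes fin: "finite (bit_homs G)" "finite (cocycle_space F \<rho>)"
  shows "finite (cocycle_space (insert J F) \<rho>)"
    "card (cocycle_space (insert J F) \<rho>) = card liftable * card (bit_homs G)"
proof -
  define V where "V \<phi> = (SOME v. trivializes (obstruction F \<rho> J \<phi>) v)" for \<phi>
  have V: "trivializes (obstruction F \<rho> J \<phi>) (V \<phi>)" if "\<phi> \<in> liftable" for \<phi>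
  proof -
    have "\<exists>v. trivializes (obstruction F \<rho> J \<phi>) v" using that unfolding liftable_def by simp
    then show ?thesis unfolding V_def by (rule someI_ex)
  qed
  \<comment> \<open>\<open>V \<phi>\<close> is a chosen lift, \<open>\<chi>\<close> its variation.\<close>
  let ?f = "\<lambda>(\<phi>, \<chi>). \<phi>(J := \<lambda>x. V \<phi> x + \<chi> x)"
  have J0: "\<phi> J = (\<lambda>_. 0)" if "\<phi> \<in> liftable" for \<phi>
    using that cocycle_spaceD(1)[of \<phi> F \<rho> J] J unfolding liftable_def by auto
  have "inj_on ?f (liftable \<times> bit_homs G)"
  proof (rule inj_onI, clarsimp)
    fix \<phi> \<chi> \<psi> \<theta>
    assume 1: "\<phi> \<in> liftable" "\<psi> \<in> liftable"
      and eq: "\<phi>(J := \<lambda>x. V \<phi> x + \<chi> x) = \<psi>(J := \<lambda>x. V \<psi> x + \<theta> x)"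
    have "\<phi> I = \<psi> I" for I
      using fun_cong[OF eq, of I] J0[OF 1(1)] J0[OF 1(2)] by (cases "I = J") auto
    then have "\<phi> = \<psi>" by blast
    moreover have "V \<phi> x + \<chi> x = V \<psi> x + \<theta> x" for x
      using fun_cong[OF fun_cong[OF eq, of J], of x] by simp
    ultimately have "V \<phi> x + \<chi> x = V \<phi> x + \<theta> x" for x by simp
    then have "\<chi> = \<theta>" by (intro ext) (simp only: add_left_cancel)
    then show "\<phi> = \<psi> \<and> \<chi> = \<theta>" using \<open>\<phi> = \<psi>\<close> by blast
  qed
  moreover have "?f ` (liftable \<times> bit_homs G) = cocycle_space (insert J F) \<rho>"
  proof (intro equalityI subsetI)
    fix \<psi> assume "\<psi> \<in> ?f ` (liftable \<times> bit_homs G)"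
    then obtain \<phi> \<chi> where \<phi>: "\<phi> \<in> liftable" "\<chi> \<in> bit_homs G" "\<psi> = \<phi>(J := \<lambda>x. V \<phi> x + \<chi> x)" by auto
    have "\<phi> \<in> cocycle_space F \<rho>" using \<phi>(1) unfolding liftable_def by simp
    from extend_cocycle[OF this trivializes_add_hom[OF V[OF \<phi>(1)] \<phi>(2)]]
    show "\<psi> \<in> cocycle_space (insert J F) \<rho>" unfolding \<phi>(3) .
  next
    fix \<psi> assume \<psi>: "\<psi> \<in> cocycle_space (insert J F) \<rho>"
    let ?\<phi> = "\<psi>(J := \<lambda>_. 0)"
    have \<phi>: "?\<phi> \<in> liftable" using restrict_cocycle[OF \<psi>] unfolding liftable_def by blast
    have "(\<lambda>x. V ?\<phi> x + \<psi> J x) \<in> bit_homs G"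
      by (rule trivializes_diff[OF V[OF \<phi>] restrict_cocycle(2)[OF \<psi>]])
    moreover have "\<psi> = ?f (?\<phi>, \<lambda>x. V ?\<phi> x + \<psi> J x)" by (simp add: fun_eq_iff)
    ultimately show "\<psi> \<in> ?f ` (liftable \<times> bit_homs G)" using \<phi> by blast
  qed
  moreover have "finite (liftable \<times> bit_homs G)"
    using fin finite_subset[of liftable "cocycle_space F \<rho>"] unfolding liftable_def by auto
  ultimately show "finite (cocycle_space (insert J F) \<rho>)"
    "card (cocycle_space (insert J F) \<rho>) = card liftable * card (bit_homs G)"
    using card_image[of ?f "liftable \<times> bit_homs G"] finite_imageI[of "liftable \<times> bit_homs G" ?f]
    by (simp_all add: card_cartesian_product)
qed

lemma card_cocycle_space_le_liftable:
  assumes fin: "finite (cocycle_space F \<rho>)" and m: "betti TYPE(bit) 2 G = enat m"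
  shows "card (cocycle_space F \<rho>) \<le> 2 ^ m * card liftable"
proof -
  obtain cl :: "('a \<Rightarrow> 'a \<Rightarrow> bit) \<Rightarrow> ('a list \<Rightarrow>\<^sub>0 bit) set set" where
    cl: "finite (range cl)" "card (range cl) \<le> 2 ^ m"
    "\<And>c d. two_cocycle c \<Longrightarrow> two_cocycle d \<Longrightarrow> cl c = cl d \<Longrightarrow>
       \<exists>v. (\<forall>x. x \<notin> carrier G \<longrightarrow> v x = 0) \<and>
         (\<forall>g\<in>carrier G. \<forall>h\<in>carrier G. c g h + d g h = v g + v h + v (g \<otimes> h))"
    using two_cocycle_classes[OF m] by blast
  have "card (cocycle_space F \<rho>) \<le> card (range cl) * card liftable"
  proof (rule card_le_classes_times_differences[where
          cl = "\<lambda>\<phi>. cl (obstruction F \<rho> J \<phi>)" and f = "\<lambda>\<phi> \<psi> i x. \<phi> i x + \<psi> i x"])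
    show "\<phi> = \<psi>" if "(\<lambda>i x. \<phi> i x + \<theta> i x) = (\<lambda>i x. \<psi> i x + \<theta> i x)"
      for \<phi> \<psi> \<theta> :: "'i \<Rightarrow> 'a \<Rightarrow> bit"
    proof (intro ext)
      show "\<phi> i x = \<psi> i x" for i x
        using fun_cong[OF fun_cong[OF that, of i], of x] by (simp only: add_right_cancel)
    qed
    show "finite liftable" using fin finite_subset[of liftable] unfolding liftable_def by auto
    fix \<phi> \<psi> assume \<phi>: "\<phi> \<in> cocycle_space F \<rho>" and \<psi>: "\<psi> \<in> cocycle_space F \<rho>"
      and eq: "cl (obstruction F \<rho> J \<phi>) = cl (obstruction F \<rho> J \<psi>)"
    have ob: "obstruction F \<rho> J (\<lambda>i x. \<phi> i x + \<psi> i x) g h = obstruction F \<rho> J \<phi> g h + obstruction F \<rho> J \<psi> g h"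
      for g h unfolding obstruction_def by (simp add: distrib_left sum.distrib)
    have "\<exists>v. trivializes (obstruction F \<rho> J (\<lambda>i x. \<phi> i x + \<psi> i x)) v"
      unfolding trivializes_def ob
      by (rule cl(3)[OF obstruction_cocycle[OF \<phi>] obstruction_cocycle[OF \<psi>] eq])
    then show "(\<lambda>i x. \<phi> i x + \<psi> i x) \<in> liftable"
      unfolding liftable_def using cocycle_space_add[OF \<phi> \<psi>] by blast
  qed (use cl(1) in auto)
  then show ?thesis using cl(2) by (meson le_trans mult_le_mono1)
qed

lemma liftable_unobstructed:
  assumes "\<And>I g. I \<in> F \<Longrightarrow> g \<in> carrier G \<Longrightarrow> \<rho> J I g = 0"
  shows "liftable = cocycle_space F \<rho>"
proof -
  have "trivializes (obstruction F \<rho> J \<phi>) (\<lambda>_. 0)" for \<phi>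
    unfolding trivializes_def obstruction_def using assms by simp
  then show ?thesis unfolding liftable_def by blast
qed

end

text \<open>
  Indices are removed in order of increasing rank. Each one contributes a factor \<open>2 ^ n\<close>, at the price of
  a factor \<open>2 ^ m\<close> if it can be obstructed. The set \<open>S\<close> contains the indices whose row has entries off
  the diagonal.
\<close>

theorem card_cocycle_space_lower_bound:
  fixes F :: "'i set"
  assumes "finite F" and rep: "unitriangular_rep F rk \<rho>"
    and n: "finite (bit_homs G)" "card (bit_homs G) = 2 ^ n" and m: "betti TYPE(bit) 2 G = enat m"
    and "\<And>J I g. J \<in> F \<Longrightarrow> J \<notin> S \<Longrightarrow> I \<in> F \<Longrightarrow> I \<noteq> J \<Longrightarrow> g \<in> carrier G \<Longrightarrow> \<rho> J I g = 0"
  shows "finite (cocycle_space F \<rho>) \<and>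
    2 ^ (n * card F) \<le> card (cocycle_space F \<rho>) * 2 ^ (m * card (F \<inter> S))"
  using assms(1,2,6)
proof (induction "card F" arbitrary: F)
  case 0
  then show ?case by (simp add: cocycle_space_empty)
next
  case (Suc k)
  have "F \<noteq> {}" using Suc.hyps(2) by auto
  then obtain J where J: "J \<in> F" "\<And>T. T \<in> F \<Longrightarrow> rk J \<le> rk T"
    using ex_min_if_finite[of "rk ` F"] Suc.prems(1)
    by (metis (mono_tags, lifting) arg_min_if_finite(1) arg_min_least)
  let ?F = "F - {J}"
  have F: "F = insert J ?F" using J(1) by blast
  have fin: "finite ?F" and notin: "J \<notin> ?F" using Suc.prems(1) by auto
  have low: "rk J \<le> rk T" if "T \<in> ?F" for T using J(2) that by blast
  have rep: "unitriangular_rep (insert J ?F) rk \<rho>" using Suc.prems(2) F by simp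
  have card_F: "card F = Suc (card ?F)" using card.remove[OF Suc.prems(1) J(1)] .
  note step = fin notin rep low
  have IH: "finite (cocycle_space ?F \<rho>)"
    "2 ^ (n * card ?F) \<le> card (cocycle_space ?F \<rho>) * 2 ^ (m * card (?F \<inter> S))"
    using Suc.hyps(1)[of ?F] Suc.hyps(2) card_F fin unitriangular_rep_remove[OF step] Suc.prems(3) by auto
  have ins: "finite (cocycle_space F \<rho>)"
      "card (cocycle_space F \<rho>) = card (liftable ?F \<rho> J) * 2 ^ n"
    using card_cocycle_space_insert[OF step n(1) IH(1)] n(2) F by auto
  have "card (cocycle_space ?F \<rho>) * 2 ^ (m * card (?F \<inter> S)) \<le> card (liftable ?F \<rho> J) * 2 ^ (m * card (F \<inter> S))"
  proof (cases "J \<in> S")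
    case True
    have "F \<inter> S = insert J (?F \<inter> S)" using F True by blast
    then have "card (F \<inter> S) = Suc (card (?F \<inter> S))" using fin by simp
    then show ?thesis
      using mult_le_mono1[OF card_cocycle_space_le_liftable[OF step IH(1) m], of "2 ^ (m * card (?F \<inter> S))"]
      by (simp add: power_add algebra_simps)
  next
    case False
    have "F \<inter> S = ?F \<inter> S" using False by blast
    moreover have "liftable ?F \<rho> J = cocycle_space ?F \<rho>"
      using Suc.prems(3) J(1) False by (intro liftable_unobstructed[OF step]) auto
    ultimately show ?thesis by simp
  qed
  then have "2 ^ (n * card ?F) \<le> card (liftable ?F \<rho> J) * 2 ^ (m * card (F \<inter> S))" using IH(2) by linarith
  then have "2 ^ n * 2 ^ (n * card ?F) \<le> 2 ^ n * (card (liftable ?F \<rho> J) * 2 ^ (m * card (F \<inter> S)))"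
    by (rule mult_le_mono2)
  moreover have "2 ^ (n * card F) = 2 ^ n * (2::nat) ^ (n * card ?F)"
    unfolding card_F by (simp add: power_add)
  ultimately have "2 ^ (n * card F) \<le> card (cocycle_space F \<rho>) * 2 ^ (m * card (F \<inter> S))"
    unfolding ins(2) by (simp add: mult_ac)
  then show ?case using ins(1) by blast
qed

end

section \<open>The mod 2 Frattini subgroup and polynomial cocycles\<close>

lemma prod_bit_indicator:
  fixes f :: "'i \<Rightarrow> bit"
  assumes "finite S"
  shows "(\<Prod>i\<in>S. f i) = (if \<forall>i\<in>S. f i = 1 then 1 else 0)"
  using assms by (induction S) auto

definition mod2_frattini :: "('a, 'b) monoid_scheme \<Rightarrow> 'a set" where
  "mod2_frattini G = joint_kernel G (bit_homs G)"

text \<open>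
  The index \<open>I\<close> stands for the monomial \<open>\<Prod>i\<in>I. x\<^sub>i\<close>, a function on the elementary abelian quotient;
  \<open>monomial_rep a J I g\<close> is the coefficient of the monomial \<open>J\<close> in the translate of the monomial
  \<open>I\<close> by \<open>g\<close>.
\<close>

definition monomial_rep :: "(nat \<Rightarrow> 'a \<Rightarrow> bit) \<Rightarrow> nat set \<Rightarrow> nat set \<Rightarrow> 'a \<Rightarrow> bit" where
  "monomial_rep a J I g = (if J \<subseteq> I then \<Prod>i\<in>I - J. a i g else 0)"

definition monomials :: "nat \<Rightarrow> nat \<Rightarrow> nat set set" where
  "monomials n l = {I. I \<subseteq> {..<n} \<and> card I \<le> l}"

lemma finite_monomials [simp]: "finite (monomials n l)"
  unfolding monomials_def by (rule finite_subset[of _ "Pow {..<n}"]) auto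

lemma monomials_finite: "I \<in> monomials n l \<Longrightarrow> finite I"
  unfolding monomials_def using finite_subset by blast

lemma monomials_subset: "I \<in> monomials n l \<Longrightarrow> J \<subseteq> I \<Longrightarrow> J \<in> monomials n l"
  unfolding monomials_def by (simp, meson card_mono finite_lessThan finite_subset order_trans)

context group
begin

text \<open>
  Translating a monomial expands \<open>\<Prod>i\<in>I. (x\<^sub>i + a\<^sub>i(g))\<close>. Translation by \<open>g h\<close> is the composition of two
  translations; in coordinates this is the expansion of \<open>\<Prod>i\<in>I - J. (a\<^sub>i(g) + a\<^sub>i(h))\<close> over subsets.
\<close>

lemma unitriangular_rep_monomial:
  assumes a: "\<And>i. i < n \<Longrightarrow> a i \<in> bit_homs G"
  shows "unitriangular_rep (monomials n l) card (monomial_rep a)"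
  unfolding unitriangular_rep_def
proof (intro conjI ballI impI)
  show "monomial_rep a J J g = 1" for J g unfolding monomial_rep_def by simp
  show "I = J \<or> card J < card I" if "I \<in> monomials n l" "monomial_rep a J I g \<noteq> 0" for J I g
    using that monomials_finite[OF that(1)] unfolding monomial_rep_def
    by (metis psubsetI psubset_card_mono)
  fix J I g h assume J: "J \<in> monomials n l" and I: "I \<in> monomials n l"
    and g: "g \<in> carrier G" and h: "h \<in> carrier G"
  show "monomial_rep a J I (g \<otimes> h) =
      (\<Sum>T\<in>monomials n l. monomial_rep a J T g * monomial_rep a T I h)"
  proof (cases "J \<subseteq> I")
    case False
    have "monomial_rep a J T g * monomial_rep a T I h = 0" for T
      using False unfolding monomial_rep_def by auto
    then show ?thesis using False by (simp add: monomial_rep_def)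
  next
    case True
    have fin: "finite I" using I by (rule monomials_finite)
    have "monomial_rep a J I (g \<otimes> h) = (\<Prod>i\<in>I - J. a i g + a i h)"
      unfolding monomial_rep_def if_P[OF True]
    proof (rule prod.cong)
      fix i assume "i \<in> I - J"
      then have "i < n" using I unfolding monomials_def by auto
      then show "a i (g \<otimes> h) = a i g + a i h" by (rule bit_homsD(1)[OF a g h])
    qed simp
    also have "\<dots> = (\<Sum>S\<in>Pow (I - J). (\<Prod>i\<in>S. a i g) * (\<Prod>i\<in>I - J - S. a i h))"
      using fin by (intro prod_add) simp
    also have "\<dots> = (\<Sum>T\<in>{T. J \<subseteq> T \<and> T \<subseteq> I}. monomial_rep a J T g * monomial_rep a T I h)"
    proof (rule sum.reindex_cong[of "\<lambda>T. T - J"])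
      show "inj_on (\<lambda>T. T - J) {T. J \<subseteq> T \<and> T \<subseteq> I}" by (auto simp: inj_on_def)
      show "Pow (I - J) = (\<lambda>T. T - J) ` {T. J \<subseteq> T \<and> T \<subseteq> I}"
      proof (intro equalityI subsetI)
        fix S assume "S \<in> Pow (I - J)"
        then show "S \<in> (\<lambda>T. T - J) ` {T. J \<subseteq> T \<and> T \<subseteq> I}"
          using True by (intro image_eqI[of _ _ "S \<union> J"]) auto
      qed auto
      fix T assume T: "T \<in> {T. J \<subseteq> T \<and> T \<subseteq> I}"
      then have "I - J - (T - J) = I - T" by blast
      then show "(\<Prod>i\<in>T - J. a i g) * (\<Prod>i\<in>I - J - (T - J). a i h) =
          monomial_rep a J T g * monomial_rep a T I h"
        using T by (simp add: monomial_rep_def)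
    qed
    also have "\<dots> = (\<Sum>T\<in>monomials n l. monomial_rep a J T g * monomial_rep a T I h)"
      by (rule sum.mono_neutral_left)
        (use monomials_subset[OF I] in \<open>auto simp: monomial_rep_def\<close>)
    finally show ?thesis .
  qed
qed

text \<open>
  The constant coefficient of a cocycle determines the cocycle. If it vanishes, the cocycle equation says
  that the polynomial function with the coefficients \<open>\<phi> I x\<close> vanishes at all points of \<open>F\<^sub>2^n\<close>.
  Evaluating it at the indicator vector of \<open>I\<close> isolates the coefficient of \<open>I\<close>, once the coefficients
  of the proper subsets of \<open>I\<close> are known to be 0.
\<close>

lemma monomial_cocycle_eq_0:
  assumes d: "dual_system G (bit_homs G) n a g"
    and \<phi>: "\<phi> \<in> cocycle_space (monomials n l) (monomial_rep a)" and 0: "\<And>x. \<phi> {} x = 0"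
  shows "\<phi> I x = 0"
proof (cases "I \<in> monomials n l \<and> x \<in> carrier G")
  case False
  then show ?thesis using cocycle_spaceD(1)[OF \<phi>] by blast
next
  case True
  then have "I \<in> monomials n l" and x: "x \<in> carrier G" by auto
  have ag: "g i \<in> carrier G" "a i \<in> bit_homs G" if "i < n" for i
    using d that unfolding dual_system_def by auto
  show ?thesis using \<open>I \<in> monomials n l\<close>
  proof (induction "card I" arbitrary: I rule: less_induct)
    case less
    note I = less.prems
    have empty: "{} \<in> monomials n l" by (rule monomials_subset[OF I]) simp
    \<comment> \<open>An element whose image in \<open>F\<^sub>2^n\<close> is the indicator vector of \<open>I\<close>.\<close>
    obtain y where y: "y \<in> carrier G"
      "\<forall>\<chi>\<in>bit_homs G. \<chi> y = (\<Sum>i<n. (if i \<in> I then 1 else 0) * \<chi> (g i))"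
      using prescribed_values[of "carrier G" n g "\<lambda>i. if i \<in> I then 1 else 0"] ag by blast
    have ay: "a j y = (if j \<in> I then 1 else 0)" if j: "j < n" for j
    proof -
      have "a j y = (\<Sum>i<n. (if i \<in> I then 1 else 0) * a j (g i))" using y(2) ag(2)[OF j] by blast
      also have "\<dots> = (\<Sum>i<n. if i = j then (if i \<in> I then 1 else 0) else 0)"
        using d j by (intro sum.cong) (auto simp: dual_system_def)
      finally show ?thesis using j by simp
    qed
    have "(\<Sum>T\<in>monomials n l. monomial_rep a {} T y * \<phi> T x) = \<phi> I x"
    proof (rule trans)
      show "(\<Sum>T\<in>monomials n l. monomial_rep a {} T y * \<phi> T x) =
          (\<Sum>T\<in>monomials n l. if T = I then \<phi> T x else 0)"
      proof (rule sum.cong)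
        fix T assume T: "T \<in> monomials n l"
        have Tn: "T \<subseteq> {..<n}" using T unfolding monomials_def by blast
        have "monomial_rep a {} T y = (if \<forall>i\<in>T. a i y = 1 then 1 else 0)"
          unfolding monomial_rep_def using prod_bit_indicator[OF monomials_finite[OF T]] by simp
        also have "(\<forall>i\<in>T. a i y = 1) \<longleftrightarrow> (\<forall>i\<in>T. i \<in> I)"
        proof (rule ball_cong)
          fix i assume "i \<in> T"
          then have "i < n" using Tn by auto
          from ay[OF this] show "a i y = 1 \<longleftrightarrow> i \<in> I" by simp
        qed simp
        finally have rep: "monomial_rep a {} T y = (if T \<subseteq> I then 1 else 0)"
          unfolding subset_eq .
        show "monomial_rep a {} T y * \<phi> T x = (if T = I then \<phi> T x else 0)"
        proof (cases "T \<subset> I")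
          case True
          then have "card T < card I" using monomials_finite[OF I] by (rule psubset_card_mono[rotated])
          then show ?thesis using less.hyps[OF _ T] True by auto
        qed (auto simp: rep)
      qed simp
      show "(\<Sum>T\<in>monomials n l. if T = I then \<phi> T x else 0) = \<phi> I x" using I by simp
    qed
    then show ?case using cocycle_spaceD(2)[OF \<phi> empty y(1) x] 0 by simp
  qed
qed

text \<open>
  On the Frattini subgroup \<open>K\<close> all \<open>a i\<close> vanish, so that the constant coefficient \<open>u\<close> of a cocycle
  satisfies \<open>u (k x) = u k + u x\<close> for \<open>k \<in> K\<close>. Hence \<open>u\<close>, and with it the cocycle, is determined by a
  homomorphism on \<open>K\<close> and by its values on representatives of the \<open>2 ^ n\<close> cosets.
\<close>

lemma card_monomial_cocycles_le:
  assumes d: "dual_system G (bit_homs G) n a g"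
    and n: "finite (bit_homs G)" "card (bit_homs G) = 2 ^ n"
    and fin: "finite (bit_homs (G\<lparr>carrier := mod2_frattini G\<rparr>))"
  shows "card (cocycle_space (monomials n l) (monomial_rep a)) \<le>
    card (bit_homs (G\<lparr>carrier := mod2_frattini G\<rparr>)) * 2 ^ 2 ^ n"
proof -
  let ?K = "mod2_frattini G" and ?Z = "cocycle_space (monomials n l) (monomial_rep a)"
  have K: "subgroup ?K G" unfolding mod2_frattini_def by (rule joint_kernel_subgroup) simp
  have fin_idx: "finite (rcosets ?K)"
    unfolding mod2_frattini_def
    by (rule card_rcosets_joint_kernel(1)[OF order_refl n(1) bit_homs_zero bit_homs_add])
  have idx: "card (rcosets ?K) = 2 ^ n"
    unfolding mod2_frattini_def n(2)[symmetric]
    by (rule card_rcosets_joint_kernel(2)[OF order_refl n(1) bit_homs_zero bit_homs_add])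
  have empty: "{} \<in> monomials n l" unfolding monomials_def by simp
  have aK: "a i k = 0" if "k \<in> ?K" "i < n" for i k
    using that d unfolding mod2_frattini_def joint_kernel_def dual_system_def by blast
  have K_mult: "\<phi> {} (k \<otimes> x) = \<phi> {} k + \<phi> {} x"
    if \<phi>: "\<phi> \<in> ?Z" and k: "k \<in> ?K" and x: "x \<in> carrier G" for \<phi> k x
  proof -
    have "(\<Sum>T\<in>monomials n l. monomial_rep a {} T k * \<phi> T x) =
        (\<Sum>T\<in>monomials n l. if T = {} then \<phi> T x else 0)"
    proof (rule sum.cong)
      fix T assume T: "T \<in> monomials n l"
      have Tn: "T \<subseteq> {..<n}" using T unfolding monomials_def by blast
      have "monomial_rep a {} T k = (if \<forall>i\<in>T. a i k = 1 then 1 else 0)"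
        unfolding monomial_rep_def using prod_bit_indicator[OF monomials_finite[OF T]] by simp
      also have "(\<forall>i\<in>T. a i k = 1) \<longleftrightarrow> (\<forall>i\<in>T. False)"
      proof (rule ball_cong)
        fix i assume "i \<in> T"
        then show "a i k = 1 \<longleftrightarrow> False" using aK[OF k, of i] Tn by auto
      qed simp
      finally show "monomial_rep a {} T k * \<phi> T x = (if T = {} then \<phi> T x else 0)" by simp
    qed simp
    then show ?thesis
      using cocycle_spaceD(2)[OF \<phi> empty subgroup.mem_carrier[OF K k] x] empty by simp
  qed
  define rep where "rep C = (SOME x. x \<in> carrier G \<and> ?K #> x = C)" for C
  have rep: "rep C \<in> carrier G \<and> ?K #> rep C = C" if "C \<in> rcosets ?K" for C
    unfolding rep_def by (rule someI_ex) (use that in \<open>auto simp: RCOSETS_def\<close>)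
  let ?f = "\<lambda>\<phi>. (\<lambda>x. if x \<in> ?K then \<phi> {} x else 0, restrict (\<lambda>C. \<phi> {} (rep C)) (rcosets ?K))"
  have "inj_on ?f ?Z"
  proof (rule inj_onI)
    fix \<phi> \<psi> assume \<phi>: "\<phi> \<in> ?Z" and \<psi>: "\<psi> \<in> ?Z" and eq: "?f \<phi> = ?f \<psi>"
    then have e1: "(\<lambda>x. if x \<in> ?K then \<phi> {} x else 0) = (\<lambda>x. if x \<in> ?K then \<psi> {} x else 0)"
      and e2: "restrict (\<lambda>C. \<phi> {} (rep C)) (rcosets ?K) = restrict (\<lambda>C. \<psi> {} (rep C)) (rcosets ?K)"
      unfolding prod.inject by blast+
    have on_K: "\<phi> {} k = \<psi> {} k" if "k \<in> ?K" for k using fun_cong[OF e1, of k] that by simp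
    have on_rep: "\<phi> {} (rep C) = \<psi> {} (rep C)" if "C \<in> rcosets ?K" for C
      using fun_cong[OF e2, of C] that by simp
    have eq0: "\<phi> {} x = \<psi> {} x" for x
    proof (cases "x \<in> carrier G")
      case True
      have C: "?K #> x \<in> rcosets ?K" using True subgroup.subset[OF K] by (intro rcosetsI)
      define r where "r = rep (?K #> x)"
      have r: "r \<in> carrier G" "?K #> r = ?K #> x" "\<phi> {} r = \<psi> {} r"
        unfolding r_def using rep[OF C] on_rep[OF C] by blast+
      have "x \<in> ?K #> r" unfolding r(2) by (rule rcos_self[OF True K])
      then obtain k where k: "k \<in> ?K" "x = k \<otimes> r" unfolding r_coset_def by blast
      show ?thesis unfolding k(2) K_mult[OF \<phi> k(1) r(1)] K_mult[OF \<psi> k(1) r(1)] on_K[OF k(1)] r(3) ..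
    next
      case False
      then show ?thesis using cocycle_spaceD(1)[OF \<phi>, of "{}" x] cocycle_spaceD(1)[OF \<psi>, of "{}" x] by simp
    qed
    have "\<phi> I x + \<psi> I x = 0" for I x
      by (rule monomial_cocycle_eq_0[OF d cocycle_space_add[OF \<phi> \<psi>]]) (simp add: eq0)
    then show "\<phi> = \<psi>" unfolding bit_add_eq_0_iff by (intro ext)
  qed
  moreover have "?f ` ?Z \<subseteq> bit_homs (G\<lparr>carrier := ?K\<rparr>) \<times> (rcosets ?K \<rightarrow>\<^sub>E UNIV)"
  proof (rule image_subsetI)
    fix \<phi> assume \<phi>: "\<phi> \<in> ?Z"
    have "(\<lambda>x. if x \<in> ?K then \<phi> {} x else 0) \<in> bit_homs (G\<lparr>carrier := ?K\<rparr>)"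
      unfolding bit_homs_def
      using K_mult[OF \<phi>] subgroup.m_closed[OF K] subgroup.mem_carrier[OF K] by simp
    then show "?f \<phi> \<in> bit_homs (G\<lparr>carrier := ?K\<rparr>) \<times> (rcosets ?K \<rightarrow>\<^sub>E UNIV)" by simp
  qed
  moreover have "finite (bit_homs (G\<lparr>carrier := ?K\<rparr>) \<times> (rcosets ?K \<rightarrow>\<^sub>E (UNIV :: bit set)))"
    using fin fin_idx by (intro finite_cartesian_product finite_PiE) simp_all
  ultimately have "card ?Z \<le> card (bit_homs (G\<lparr>carrier := ?K\<rparr>) \<times> (rcosets ?K \<rightarrow>\<^sub>E (UNIV :: bit set)))"
    by (rule card_inj_on_le)
  then show ?thesis using idx fin_idx by (simp add: card_cartesian_product card_PiE)
qed

text \<open>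
  Compare the two bounds for the number of cocycles with values in polynomials of degree at most \<open>l\<close>.
  With \<open>s\<close> monomials of degree less than \<open>l\<close> they give
  \<open>n ((n choose l) + s) \<le> b + 2 ^ n + m s\<close>, and \<open>m s \<le> n s + C 2 ^ n\<close>.
\<close>

theorem frattini_betti_lower_bound:
  assumes n: "finite (bit_homs G)" "card (bit_homs G) = 2 ^ n"
    and m: "betti TYPE(bit) 2 G = enat m" "m \<le> n + C"
    and b: "finite (bit_homs (G\<lparr>carrier := mod2_frattini G\<rparr>))"
      "card (bit_homs (G\<lparr>carrier := mod2_frattini G\<rparr>)) = 2 ^ b"
  shows "n * (n choose l) \<le> b + (C + 1) * 2 ^ n"
proof -
  obtain n' a g where d': "dual_system G (bit_homs G) n' a g" and n': "card (bit_homs G) = 2 ^ n'"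
    by (rule dual_basis[OF order_refl n(1) bit_homs_zero bit_homs_add])
  have "n' = n" using n(2) n' by simp
  then have d: "dual_system G (bit_homs G) n a g" using d' by simp
  let ?P = "monomials n l" and ?S = "{J :: nat set. card J < l}"
  have a: "a i \<in> bit_homs G" if "i < n" for i using d that unfolding dual_system_def by blast
  have top: "monomial_rep a J I x = 0"
    if "J \<in> ?P" "J \<notin> ?S" "I \<in> ?P" "I \<noteq> J" for J I x
  proof -
    have "\<not> J \<subseteq> I"
    proof
      assume "J \<subseteq> I"
      then have "card J < card I" using that monomials_finite[OF that(3)] by (intro psubset_card_mono) auto
      then show False using that unfolding monomials_def by simp
    qed
    then show ?thesis unfolding monomial_rep_def by simp
  qed
  have "2 ^ (n * card ?P) \<le>
      card (cocycle_space ?P (monomial_rep a)) * 2 ^ (m * card (?P \<inter> ?S))"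
    using card_cocycle_space_lower_bound[OF finite_monomials unitriangular_rep_monomial[OF a] n m(1) top]
    by blast
  also have "\<dots> \<le> 2 ^ b * 2 ^ 2 ^ n * 2 ^ (m * card (?P \<inter> ?S))"
    using card_monomial_cocycles_le[OF d n b(1)] unfolding b(2) by (rule mult_le_mono1)
  also have "\<dots> = 2 ^ (b + 2 ^ n + m * card (?P \<inter> ?S))" by (simp add: power_add)
  finally have le: "n * card ?P \<le> b + 2 ^ n + m * card (?P \<inter> ?S)" by simp
  let ?L = "{I. I \<subseteq> {..<n} \<and> card I = l}"
  have "?P = ?L \<union> (?P \<inter> ?S)" unfolding monomials_def by auto
  moreover have "card (?L \<union> (?P \<inter> ?S)) = card ?L + card (?P \<inter> ?S)"
    by (rule card_Un_disjoint) (auto intro: finite_subset[of _ "Pow {..<n}"])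
  ultimately have cP: "card ?P = (n choose l) + card (?P \<inter> ?S)" by (simp add: n_subsets)
  have "card (?P \<inter> ?S) \<le> card (Pow {..<n})" by (rule card_mono) (auto simp: monomials_def)
  then have s: "card (?P \<inter> ?S) \<le> 2 ^ n" by (simp add: card_Pow)
  have "n * (n choose l) + n * card (?P \<inter> ?S) \<le> b + 2 ^ n + (n + C) * card (?P \<inter> ?S)"
    using le mult_le_mono1[OF m(2), of "card (?P \<inter> ?S)"] unfolding cP distrib_left by linarith
  then have "n * (n choose l) \<le> b + 2 ^ n + C * card (?P \<inter> ?S)" by (simp add: distrib_right)
  also have "\<dots> \<le> b + 2 ^ n + C * 2 ^ n" using s by simp
  finally show ?thesis by simp
qed

end

section \<open>Subgroups of finite index\<close>

context group
begin

lemma coset_representatives: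
  assumes H: "subgroup H G"
  obtains rep where "\<forall>C\<in>rcosets H. rep C \<in> carrier G \<and> H #> rep C = C"
proof -
  have "\<forall>C\<in>rcosets H. \<exists>x. x \<in> carrier G \<and> H #> x = C" by (auto simp: RCOSETS_def)
  then show thesis using that by (metis (no_types) bchoice)
qed

lemma coset_factor:
  assumes "subgroup H G" "x \<in> carrier G" "H #> r = H #> x"
  obtains h where "h \<in> H" "x = h \<otimes> r"
proof -
  have "x \<in> H #> r" unfolding assms(3) by (rule rcos_self[OF assms(2,1)])
  then show thesis using that unfolding r_coset_def by blast
qed

lemma card_rcosets_antimono:
  assumes N: "subgroup N G" and K: "subgroup K G" and NK: "N \<subseteq> K" and fin: "finite (rcosets N)"
  shows "card (rcosets K) \<le> card (rcosets N)"
proof -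
  obtain rep where rep: "\<forall>C\<in>rcosets K. rep C \<in> carrier G \<and> K #> rep C = C"
    by (rule coset_representatives[OF K])
  show ?thesis
  proof (rule card_inj_on_le[of "\<lambda>C. N #> rep C"])
    show "inj_on (\<lambda>C. N #> rep C) (rcosets K)"
    proof (rule inj_onI)
      fix C D assume C: "C \<in> rcosets K" and D: "D \<in> rcosets K" and eq: "N #> rep C = N #> rep D"
      have "rep C \<otimes> inv rep D \<in> K" using eq coset_eq_iff[OF N] rep C D NK by blast
      then have "K #> rep C = K #> rep D" using coset_eq_iff[OF K] rep C D by blast
      then show "C = D" using rep C D by metis
    qed
    show "(\<lambda>C. N #> rep C) ` (rcosets K) \<subseteq> rcosets N"
      using rep subgroup.subset[OF N] by (auto intro!: rcosetsI)
  qed (rule fin)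
qed

lemma rcosets_carrier_update: "rcosets\<^bsub>G\<lparr>carrier := H\<rparr>\<^esub> K = (\<lambda>x. K #> x) ` H"
  unfolding RCOSETS_def r_coset_def by auto

lemma index_tower:
  assumes H: "subgroup H G" and K: "subgroup K G" and KH: "K \<subseteq> H"
    and fin: "finite (rcosets H)" "finite (rcosets\<^bsub>G\<lparr>carrier := H\<rparr>\<^esub> K)"
  shows "finite (rcosets K)"
    "card (rcosets K) = card (rcosets H) * card (rcosets\<^bsub>G\<lparr>carrier := H\<rparr>\<^esub> K)"
proof -
  obtain rep where rep: "\<forall>C\<in>rcosets H. rep C \<in> carrier G \<and> H #> rep C = C"
    by (rule coset_representatives[OF H])
  let ?R = "rcosets\<^bsub>G\<lparr>carrier := H\<rparr>\<^esub> K"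
  let ?f = "\<lambda>(C, E). E #> rep C"
  have Hc: "h \<in> carrier G" if "h \<in> H" for h using subgroup.mem_carrier[OF H that] .
  have Kc: "K \<subseteq> carrier G" by (rule subgroup.subset[OF K])
  have shift: "(K #> h) #> r = K #> (h \<otimes> r)" if "h \<in> H" "r \<in> carrier G" for h r
    by (rule coset_mult_assoc[OF Kc Hc[OF that(1)] that(2)])
  have "inj_on ?f ((rcosets H) \<times> ?R)"
  proof (rule inj_onI)
    fix p q assume p: "p \<in> (rcosets H) \<times> ?R" and q: "q \<in> (rcosets H) \<times> ?R" and eq: "?f p = ?f q"
    obtain C h where p': "p = (C, K #> h)" "C \<in> rcosets H" "h \<in> H"
      using p unfolding rcosets_carrier_update by blast
    obtain D k where q': "q = (D, K #> k)" "D \<in> rcosets H" "k \<in> H"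
      using q unfolding rcosets_carrier_update by blast
    have C: "rep C \<in> carrier G" "H #> rep C = C" and D: "rep D \<in> carrier G" "H #> rep D = D"
      using rep p' q' by blast+
    have "K #> (h \<otimes> rep C) = K #> (k \<otimes> rep D)"
      using eq unfolding p' q' by (simp add: shift p' q' C D)
    then have mem: "(h \<otimes> rep C) \<otimes> inv (k \<otimes> rep D) \<in> K"
      using coset_eq_iff[OF K] Hc p' q' C D by simp
    then have "(h \<otimes> rep C) \<otimes> inv (k \<otimes> rep D) \<in> H" using KH by blast
    then have "H #> (h \<otimes> rep C) = H #> (k \<otimes> rep D)" using coset_eq_iff[OF H] Hc p' q' C D by simp
    moreover have "H #> (x \<otimes> r) = H #> r" if "x \<in> H" "r \<in> carrier G" for x r
      using coset_mult_assoc[OF subgroup.subset[OF H] Hc[OF that(1)] that(2)]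
        coset_join2[OF Hc[OF that(1)] H that(1)] by simp
    ultimately have CD: "C = D" using p' q' C D by metis
    have "(h \<otimes> rep C) \<otimes> inv (k \<otimes> rep C) = h \<otimes> inv k"
      using Hc[OF p'(3)] Hc[OF q'(3)] C(1) by (simp add: inv_mult_group m_assoc[symmetric] inv_solve_right)
        (simp add: m_assoc)
    then have "h \<otimes> inv k \<in> K" using mem CD by simp
    then have "K #> h = K #> k" using coset_eq_iff[OF K] Hc p' q' by blast
    then show "p = q" using CD p' q' by simp
  qed
  moreover have "?f ` ((rcosets H) \<times> ?R) = rcosets K"
  proof (intro equalityI subsetI)
    fix X assume "X \<in> ?f ` ((rcosets H) \<times> ?R)"
    then obtain C h where "C \<in> rcosets H" "h \<in> H" "X = (K #> h) #> rep C"
      unfolding rcosets_carrier_update by auto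
    then show "X \<in> rcosets K" using rep shift Hc Kc by (auto intro!: rcosetsI)
  next
    fix X assume "X \<in> rcosets K"
    then obtain x where x: "x \<in> carrier G" "X = K #> x" by (auto simp: RCOSETS_def)
    have C: "H #> x \<in> rcosets H" using x(1) subgroup.subset[OF H] by (intro rcosetsI)
    define r where "r = rep (H #> x)"
    have r: "r \<in> carrier G" "H #> r = H #> x" unfolding r_def using rep C by blast+
    obtain h where h: "h \<in> H" "x = h \<otimes> r" by (rule coset_factor[OF H x(1) r(2)])
    have "X = (K #> h) #> r" unfolding shift[OF h(1) r(1)] x(2) h(2) ..
    then have "X = ?f (H #> x, K #> h)" by (simp add: r_def)
    then show "X \<in> ?f ` ((rcosets H) \<times> ?R)" using C h(1) unfolding rcosets_carrier_update by blast
  qed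
  ultimately have "rcosets K = ?f ` ((rcosets H) \<times> ?R)" "card (rcosets K) = card ((rcosets H) \<times> ?R)"
    using card_image by metis+
  then show "finite (rcosets K)" "card (rcosets K) = card (rcosets H) * card ?R"
    using fin by (simp_all add: card_cartesian_product)
qed

lemma mod2_frattini_subgroup: "subgroup (mod2_frattini G) G"
  unfolding mod2_frattini_def by (rule joint_kernel_subgroup) simp

lemma index_mod2_frattini:
  assumes "finite (bit_homs G)"
  shows "finite (rcosets (mod2_frattini G))" "card (rcosets (mod2_frattini G)) = card (bit_homs G)"
proof -
  show "finite (rcosets (mod2_frattini G))" unfolding mod2_frattini_def
    by (rule card_rcosets_joint_kernel(1)[OF order_refl assms bit_homs_zero bit_homs_add])
  show "card (rcosets (mod2_frattini G)) = card (bit_homs G)" unfolding mod2_frattini_def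
    by (rule card_rcosets_joint_kernel(2)[OF order_refl assms bit_homs_zero bit_homs_add])
qed

lemma conjugate_mult:
  assumes "g \<in> carrier G" "x \<in> carrier G" "y \<in> carrier G"
  shows "g \<otimes> (x \<otimes> y) \<otimes> inv g = (g \<otimes> x \<otimes> inv g) \<otimes> (g \<otimes> y \<otimes> inv g)"
  using assms by (simp add: m_assoc inv_solve_left)

text \<open>
  Conjugation permutes the homomorphisms on a normal subgroup.
\<close>

lemma mod2_frattini_normal:
  assumes H: "H \<lhd> G"
  shows "mod2_frattini (G\<lparr>carrier := H\<rparr>) \<lhd> G"
proof -
  let ?K = "mod2_frattini (G\<lparr>carrier := H\<rparr>)"
  have sH: "subgroup H G" using H by (rule normal_imp_subgroup)
  interpret H: group "G\<lparr>carrier := H\<rparr>" by (rule subgroup_imp_group[OF sH])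
  have sK: "subgroup ?K G" using incl_subgroup[OF sH H.mod2_frattini_subgroup] .
  have "g \<otimes> x \<otimes> inv g \<in> ?K" if g: "g \<in> carrier G" and x: "x \<in> ?K" for g x
  proof -
    have xH: "x \<in> H" and x0: "\<forall>\<chi>\<in>bit_homs (G\<lparr>carrier := H\<rparr>). \<chi> x = 0"
      using x unfolding mod2_frattini_def joint_kernel_def by simp_all
    have conj: "g \<otimes> y \<otimes> inv g \<in> H" if "y \<in> H" for y
      using normal.inv_op_closed2[OF H g that] .
    have "\<chi> (g \<otimes> x \<otimes> inv g) = 0" if \<chi>: "\<chi> \<in> bit_homs (G\<lparr>carrier := H\<rparr>)" for \<chi>
    proof -
      let ?\<psi> = "\<lambda>y. if y \<in> H then \<chi> (g \<otimes> y \<otimes> inv g) else 0"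
      have "?\<psi> \<in> bit_homs (G\<lparr>carrier := H\<rparr>)"
        unfolding bit_homs_def
      proof (intro CollectI conjI ballI allI impI)
        fix y z assume "y \<in> carrier (G\<lparr>carrier := H\<rparr>)" "z \<in> carrier (G\<lparr>carrier := H\<rparr>)"
        then have y: "y \<in> H" "y \<in> carrier G" and z: "z \<in> H" "z \<in> carrier G"
          using subgroup.mem_carrier[OF sH] by simp_all
        have "g \<otimes> (y \<otimes> z) \<otimes> inv g = (g \<otimes> y \<otimes> inv g) \<otimes> (g \<otimes> z \<otimes> inv g)"
          by (rule conjugate_mult[OF g y(2) z(2)])
        then show "?\<psi> (y \<otimes>\<^bsub>G\<lparr>carrier := H\<rparr>\<^esub> z) = ?\<psi> y + ?\<psi> z"
          using bit_homsD(1)[OF \<chi>, of "g \<otimes> y \<otimes> inv g" "g \<otimes> z \<otimes> inv g"] conj y z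
            subgroup.m_closed[OF sH] by simp
      qed simp
      from bspec[OF x0 this] have "?\<psi> x = 0" .
      then show ?thesis using xH by simp
    qed
    then show ?thesis using conj[OF xH] unfolding mod2_frattini_def joint_kernel_def by simp
  qed
  then show ?thesis unfolding normal_inv_iff using sK by blast
qed

text \<open>
  A homomorphism on a subgroup \<open>H\<close> extends to an \<open>H\<close>-equivariant function on the whole group. The
  increment of that function along a generator depends only on the coset, so that the homomorphism is
  determined by finitely many bits.
\<close>

lemma finite_bit_homs_finite_index:
  assumes S: "finite S" "S \<subseteq> carrier G" "generate G S = carrier G"
    and H: "subgroup H G" "finite (rcosets H)"
  shows "finite (bit_homs (G\<lparr>carrier := H\<rparr>))"
proof -
  obtain rep where rep: "\<forall>C\<in>rcosets H. rep C \<in> carrier G \<and> H #> rep C = C"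
    by (rule coset_representatives[OF H(1)])
  define r where "r x = rep (H #> x)" for x
  have r: "r x \<in> carrier G" "H #> r x = H #> x" if "x \<in> carrier G" for x
    using rep rcosetsI[OF subgroup.subset[OF H(1)] that] unfolding r_def by blast+
  have Hc: "h \<in> carrier G" if "h \<in> H" for h using subgroup.mem_carrier[OF H(1) that] .
  have r_shift: "r (h \<otimes> x) = r x" if "h \<in> H" "x \<in> carrier G" for h x
    unfolding r_def using coset_mult_assoc[OF subgroup.subset[OF H(1)] Hc[OF that(1)] that(2)]
      coset_join2[OF Hc[OF that(1)] H(1) that(1)] by simp
  have rH: "x \<otimes> inv r x \<in> H" if "x \<in> carrier G" for x
    using coset_eq_iff[OF H(1) that r(1)[OF that]] r(2)[OF that] by simp
  \<comment> \<open>The equivariant extension of \<open>\<chi>\<close>, with value 0 on the chosen coset representatives.\<close>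
  define u where "u \<chi> x = \<chi> (x \<otimes> inv r x)" for \<chi> :: "'a \<Rightarrow> bit" and x
  have u: "u \<chi> (h \<otimes> x) = \<chi> h + u \<chi> x"
    if "\<chi> \<in> bit_homs (G\<lparr>carrier := H\<rparr>)" "h \<in> H" "x \<in> carrier G" for \<chi> h x
    using bit_homsD(1)[OF that(1), of h "x \<otimes> inv r x"] that(2,3) rH Hc r(1)
    unfolding u_def by (simp add: r_shift m_assoc)
  let ?F = "((rcosets H) \<times> S) \<rightarrow>\<^sub>E (UNIV :: bit set)"
  define D where "D \<chi> = restrict (\<lambda>(C, s). u \<chi> (rep C \<otimes> s) + u \<chi> (rep C)) ((rcosets H) \<times> S)" for \<chi>
  have step: "u \<chi> (x \<otimes> s) = D \<chi> (H #> x, s) + u \<chi> x"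
    if \<chi>: "\<chi> \<in> bit_homs (G\<lparr>carrier := H\<rparr>)" and x: "x \<in> carrier G" and s: "s \<in> S" for \<chi> x s
  proof -
    have C: "H #> x \<in> rcosets H" using rcosetsI[OF subgroup.subset[OF H(1)] x] .
    obtain h where h: "h \<in> H" "x = h \<otimes> r x" by (rule coset_factor[OF H(1) x r(2)[OF x]])
    have sc: "s \<in> carrier G" using s S(2) by blast
    have "u \<chi> (x \<otimes> s) = u \<chi> (h \<otimes> (r x \<otimes> s))"
      using m_assoc[OF Hc[OF h(1)] r(1)[OF x] sc] h(2) by simp
    also have "\<dots> = \<chi> h + u \<chi> (r x \<otimes> s)" using u[OF \<chi> h(1)] r(1)[OF x] sc by simp
    finally have 1: "u \<chi> (x \<otimes> s) = \<chi> h + u \<chi> (r x \<otimes> s)" .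
    have 2: "u \<chi> x = \<chi> h + u \<chi> (r x)" using u[OF \<chi> h(1) r(1)[OF x]] h(2) by simp
    have 3: "D \<chi> (H #> x, s) = u \<chi> (r x \<otimes> s) + u \<chi> (r x)"
      unfolding D_def r_def using C s by simp
    show ?thesis unfolding 1 2 3
      by (cases "\<chi> h"; cases "u \<chi> (r x \<otimes> s)"; cases "u \<chi> (r x)") simp_all
  qed
  have "inj_on D (bit_homs (G\<lparr>carrier := H\<rparr>))"
  proof (rule inj_onI, rule ext)
    fix \<chi> \<psi> z assume \<chi>: "\<chi> \<in> bit_homs (G\<lparr>carrier := H\<rparr>)" and \<psi>: "\<psi> \<in> bit_homs (G\<lparr>carrier := H\<rparr>)"
      and eq: "D \<chi> = D \<psi>"
    define w where "w x = u \<chi> x + u \<psi> x" for x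
    have w: "w (x \<otimes> s) = w x" if "x \<in> carrier G" "s \<in> S" for x s
      unfolding w_def step[OF \<chi> that] step[OF \<psi> that] eq
      by (cases "D \<psi> (H #> x, s)"; cases "u \<chi> x"; cases "u \<psi> x") simp_all
    have "\<forall>x\<in>carrier G. w (x \<otimes> t) = w x" if "t \<in> generate G S" for t
      using that
    proof induction
      case (inv s)
      then have s: "s \<in> carrier G" using S(2) by blast
      show ?case
      proof
        fix x assume x: "x \<in> carrier G"
        show "w (x \<otimes> inv s) = w x"
          using w[of "x \<otimes> inv s" s] x s inv by (simp add: m_assoc)
      qed
    next
      case (eng s t)
      have "s \<in> carrier G" "t \<in> carrier G"
        using generate_in_carrier[OF S(2)] eng.hyps by blast+
      then show ?case using eng.IH by (simp add: m_assoc[symmetric])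
    qed (use w in auto)
    then have const: "w (\<one> \<otimes> t) = w \<one>" if "t \<in> carrier G" for t
      using that S(3) by blast
    show "\<chi> z = \<psi> z"
    proof (cases "z \<in> H")
      case True
      have "w z = w \<one>" using const[OF Hc[OF True]] Hc[OF True] by simp
      moreover have "u \<chi> z = \<chi> z + u \<chi> \<one>" "u \<psi> z = \<psi> z + u \<psi> \<one>"
        using u[OF \<chi> True one_closed] u[OF \<psi> True one_closed] Hc[OF True] by simp_all
      ultimately have "(\<chi> z + u \<chi> \<one>) + (\<psi> z + u \<psi> \<one>) = u \<chi> \<one> + u \<psi> \<one>" unfolding w_def by simp
      then show ?thesis
        by (cases "\<chi> z"; cases "\<psi> z"; cases "u \<chi> \<one>"; cases "u \<psi> \<one>") simp_all
    next
      case False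
      then show ?thesis using bit_homsD(2)[OF \<chi>, of z] bit_homsD(2)[OF \<psi>, of z] by simp
    qed
  qed
  moreover have "D ` bit_homs (G\<lparr>carrier := H\<rparr>) \<subseteq> ?F" unfolding D_def by (intro image_subsetI) simp
  moreover have "finite ?F" using H(2) S(1) by (intro finite_PiE) simp_all
  ultimately show ?thesis by (rule inj_on_finite)
qed

text \<open>
  The homomorphisms on \<open>G\<close> that vanish on \<open>N\<close> have a joint kernel of index equal to their number.
\<close>

lemma card_bit_homs_le_restriction:
  assumes N: "subgroup N G" "finite (rcosets N)"
    and fin: "finite (bit_homs G)" "finite (bit_homs (G\<lparr>carrier := N\<rparr>))"
  shows "card (bit_homs G) \<le> card (bit_homs (G\<lparr>carrier := N\<rparr>)) * card (rcosets N)"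
proof -
  define V where "V = {\<chi> \<in> bit_homs G. \<forall>x\<in>N. \<chi> x = 0}"
  have V: "V \<subseteq> bit_homs G" "finite V" "(\<lambda>_. 0) \<in> V" unfolding V_def
    using fin(1) bit_homs_zero by auto
  have V_add: "(\<lambda>x. \<chi> x + \<psi> x) \<in> V" if "\<chi> \<in> V" "\<psi> \<in> V" for \<chi> \<psi>
    using that bit_homs_add[of \<chi> G \<psi>] unfolding V_def by simp
  have "card V = card (rcosets (joint_kernel G V))"
    by (rule card_rcosets_joint_kernel(2)[OF V V_add, symmetric])
  also have "\<dots> \<le> card (rcosets N)"
  proof (rule card_rcosets_antimono[OF N(1) joint_kernel_subgroup[OF V(1)] _ N(2)])
    show "N \<subseteq> joint_kernel G V"
      using subgroup.mem_carrier[OF N(1)] by (auto simp: joint_kernel_def V_def)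
  qed
  finally have cV: "card V \<le> card (rcosets N)" .
  let ?res = "\<lambda>\<chi> x. if x \<in> N then \<chi> x else 0"
  have "card (bit_homs G) \<le> card (bit_homs (G\<lparr>carrier := N\<rparr>)) * card V"
  proof (rule card_le_classes_times_differences[where cl = ?res and f = "\<lambda>\<chi> \<psi> x. \<chi> x + \<psi> x", OF V(2) fin(2)])
    show "?res ` bit_homs G \<subseteq> bit_homs (G\<lparr>carrier := N\<rparr>)"
    proof (rule image_subsetI)
      fix \<chi> assume \<chi>: "\<chi> \<in> bit_homs G"
      show "?res \<chi> \<in> bit_homs (G\<lparr>carrier := N\<rparr>)" unfolding bit_homs_def
        using bit_homsD(1)[OF \<chi>] subgroup.m_closed[OF N(1)] subgroup.mem_carrier[OF N(1)] by simp
    qed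
    show "\<chi> = \<psi>" if "(\<lambda>x. \<chi> x + \<theta> x) = (\<lambda>x. \<psi> x + \<theta> x)" for \<chi> \<psi> \<theta> :: "'a \<Rightarrow> bit"
    proof
      show "\<chi> x = \<psi> x" for x using fun_cong[OF that, of x] by (simp only: add_right_cancel)
    qed
    fix \<chi> \<psi> assume \<chi>: "\<chi> \<in> bit_homs G" and \<psi>: "\<psi> \<in> bit_homs G" and eq: "?res \<chi> = ?res \<psi>"
    have "\<forall>x\<in>N. \<chi> x + \<psi> x = 0"
    proof
      show "\<chi> x + \<psi> x = 0" if "x \<in> N" for x using fun_cong[OF eq, of x] that by simp
    qed
    then show "(\<lambda>x. \<chi> x + \<psi> x) \<in> V" unfolding V_def using bit_homs_add[OF \<chi> \<psi>] by simp
  qed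
  also have "\<dots> \<le> card (bit_homs (G\<lparr>carrier := N\<rparr>)) * card (rcosets N)" using cV by simp
  finally show ?thesis .
qed

text \<open>
  A coset of the normal core of \<open>L\<close> is determined by cosets of \<open>L\<close>, one for each coset of a subgroup
  \<open>H\<close> that normalizes \<open>L\<close>.
\<close>

lemma normal_core_index:
  assumes H: "subgroup H G" "finite (rcosets H)" and L: "L \<lhd> (G\<lparr>carrier := H\<rparr>)" "finite (rcosets L)"
  obtains N where "N \<lhd> G" "N \<subseteq> L" "finite (rcosets N)"
    "card (rcosets N) \<le> card (rcosets L) ^ card (rcosets H)"
proof -
  interpret GH: group "G\<lparr>carrier := H\<rparr>" by (rule subgroup_imp_group[OF H(1)])
  have LH: "subgroup L (G\<lparr>carrier := H\<rparr>)" using L(1) by (rule normal_imp_subgroup)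
  have sL: "subgroup L G" by (rule incl_subgroup[OF H(1) LH])
  have Lc: "x \<in> carrier G" if "x \<in> L" for x using subgroup.mem_carrier[OF sL that] .
  define N where "N = {x \<in> carrier G. \<forall>g\<in>carrier G. g \<otimes> x \<otimes> inv g \<in> L}"
  have NL: "N \<subseteq> L"
  proof
    fix x assume "x \<in> N"
    then have "\<one> \<otimes> x \<otimes> inv \<one> \<in> L" "x \<in> carrier G" unfolding N_def by blast+
    then show "x \<in> L" by simp
  qed
  have sN: "subgroup N G"
  proof (rule subgroupI)
    have "\<one> \<in> N" unfolding N_def using subgroup.one_closed[OF sL] by simp
    then show "N \<noteq> {}" by blast
    show "N \<subseteq> carrier G" unfolding N_def by blast
    show "inv x \<in> N" if "x \<in> N" for x
    proof -
      have x: "x \<in> carrier G" "\<forall>g\<in>carrier G. g \<otimes> x \<otimes> inv g \<in> L" using that unfolding N_def by blast+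
      have "g \<otimes> inv x \<otimes> inv g \<in> L" if g: "g \<in> carrier G" for g
      proof -
        have "inv (g \<otimes> x \<otimes> inv g) \<in> L" using subgroup.m_inv_closed[OF sL] x(2) g by blast
        then show ?thesis using g x(1) by (simp add: inv_mult_group m_assoc)
      qed
      then show ?thesis unfolding N_def using x(1) by simp
    qed
    show "x \<otimes> y \<in> N" if "x \<in> N" "y \<in> N" for x y
    proof -
      have x: "x \<in> carrier G" "\<forall>g\<in>carrier G. g \<otimes> x \<otimes> inv g \<in> L"
        and y: "y \<in> carrier G" "\<forall>g\<in>carrier G. g \<otimes> y \<otimes> inv g \<in> L" using that unfolding N_def by blast+
      have "g \<otimes> (x \<otimes> y) \<otimes> inv g \<in> L" if g: "g \<in> carrier G" for g
      proof -
        have "(g \<otimes> x \<otimes> inv g) \<otimes> (g \<otimes> y \<otimes> inv g) \<in> L" using subgroup.m_closed[OF sL] x(2) y(2) g by blast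
        moreover have "(g \<otimes> x \<otimes> inv g) \<otimes> (g \<otimes> y \<otimes> inv g) = g \<otimes> (x \<otimes> y) \<otimes> inv g"
          by (rule conjugate_mult[OF g x(1) y(1), symmetric])
        ultimately show ?thesis by simp
      qed
      then show ?thesis unfolding N_def using x(1) y(1) by simp
    qed
  qed
  have normal: "N \<lhd> G" unfolding normal_inv_iff
  proof (intro conjI sN ballI)
    fix k x assume k: "k \<in> carrier G" and "x \<in> N"
    then have x: "x \<in> carrier G" "\<forall>g\<in>carrier G. g \<otimes> x \<otimes> inv g \<in> L" unfolding N_def by blast+
    have "g \<otimes> (k \<otimes> x \<otimes> inv k) \<otimes> inv g \<in> L" if g: "g \<in> carrier G" for g
    proof -
      have "(g \<otimes> k) \<otimes> x \<otimes> inv (g \<otimes> k) \<in> L" using x(2) g k by blast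
      then show ?thesis using g k x(1) by (simp add: inv_mult_group m_assoc)
    qed
    then show "k \<otimes> x \<otimes> inv k \<in> N" unfolding N_def using k x(1) by simp
  qed
  obtain rep where rep: "\<forall>C\<in>rcosets H. rep C \<in> carrier G \<and> H #> rep C = C"
    by (rule coset_representatives[OF H(1)])
  have N_rep: "x \<in> N" if x: "x \<in> carrier G" and xr: "\<forall>C\<in>rcosets H. rep C \<otimes> x \<otimes> inv (rep C) \<in> L" for x
  proof -
    have "g \<otimes> x \<otimes> inv g \<in> L" if g: "g \<in> carrier G" for g
    proof -
      have C: "H #> g \<in> rcosets H" using rcosetsI[OF subgroup.subset[OF H(1)] g] .
      define r where "r = rep (H #> g)"
      have r: "r \<in> carrier G" "H #> r = H #> g" "r \<otimes> x \<otimes> inv r \<in> L"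
        unfolding r_def using rep C xr by blast+
      obtain h where h: "h \<in> H" "g = h \<otimes> r" by (rule coset_factor[OF H(1) g r(2)])
      have hc: "h \<in> carrier G" using subgroup.mem_carrier[OF H(1) h(1)] .
      have "h \<otimes> (r \<otimes> x \<otimes> inv r) \<otimes> inv h \<in> L"
        using normal.inv_op_closed2[OF L(1), of h "r \<otimes> x \<otimes> inv r"] h(1) r(3)
          m_inv_consistent[OF H(1) h(1)] by simp
      then show ?thesis unfolding h(2) using hc r(1) x by (simp add: inv_mult_group m_assoc)
    qed
    then show ?thesis unfolding N_def using x by simp
  qed
  obtain s where s: "\<forall>D\<in>rcosets N. s D \<in> carrier G \<and> N #> s D = D"
    by (rule coset_representatives[OF sN])
  let ?f = "\<lambda>D. restrict (\<lambda>C. L #> (rep C \<otimes> s D)) (rcosets H)"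
  have inj: "inj_on ?f (rcosets N)"
  proof (rule inj_onI)
    fix D E assume D: "D \<in> rcosets N" and E: "E \<in> rcosets N" and eq: "?f D = ?f E"
    have sD: "s D \<in> carrier G" "N #> s D = D" and sE: "s E \<in> carrier G" "N #> s E = E"
      using s D E by blast+
    have "rep C \<otimes> (s D \<otimes> inv s E) \<otimes> inv (rep C) \<in> L" if C: "C \<in> rcosets H" for C
    proof -
      have rC: "rep C \<in> carrier G" using rep C by blast
      have "L #> (rep C \<otimes> s D) = L #> (rep C \<otimes> s E)" using fun_cong[OF eq, of C] C by simp
      then have "(rep C \<otimes> s D) \<otimes> inv (rep C \<otimes> s E) \<in> L"
        using coset_eq_iff[OF sL, of "rep C \<otimes> s D" "rep C \<otimes> s E"] rC sD(1) sE(1) by simp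
      then show ?thesis using rC sD(1) sE(1) by (simp add: inv_mult_group m_assoc)
    qed
    then have "s D \<otimes> inv s E \<in> N" using N_rep sD(1) sE(1) by simp
    then have "N #> s D = N #> s E" using coset_eq_iff[OF sN sD(1) sE(1)] by simp
    then show "D = E" using sD(2) sE(2) by simp
  qed
  have img: "?f ` (rcosets N) \<subseteq> rcosets H \<rightarrow>\<^sub>E rcosets L"
  proof (rule image_subsetI)
    fix D assume "D \<in> rcosets N"
    then have sD: "s D \<in> carrier G" using s by blast
    have "L #> (rep C \<otimes> s D) \<in> rcosets L" if "C \<in> rcosets H" for C
      using rep that sD subgroup.subset[OF sL] by (intro rcosetsI) auto
    then show "?f D \<in> rcosets H \<rightarrow>\<^sub>E rcosets L" by simp
  qed
  have fin: "finite (rcosets H \<rightarrow>\<^sub>E rcosets L)" using H(2) L(2) by (rule finite_PiE)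
  have "finite (rcosets N)" by (rule inj_on_finite[OF inj img fin])
  moreover have "card (rcosets N) \<le> card (rcosets L) ^ card (rcosets H)"
    using card_inj_on_le[OF inj img fin] card_PiE[OF H(2), of "\<lambda>_. rcosets L"] by simp
  ultimately show thesis using that normal NL by blast
qed

end

section \<open>Growth estimates\<close>

lemma central_binomial_step: "(m + 1) * (2 * (m + 1) choose (m + 1)) = 2 * (2 * m + 1) * (2 * m choose m)"
proof -
  have "2 * (m + 1) choose (m + 1) = (2 * m + 1 choose m) + (2 * m + 1 choose (m + 1))"
    by simp
  also have "(2 * m + 1 choose m) = (2 * m + 1 choose (m + 1))"
    using binomial_symmetric[of m "2 * m + 1"] by simp
  finally have "(m + 1) * (2 * (m + 1) choose (m + 1)) = 2 * ((m + 1) * (2 * m + 1 choose (m + 1)))"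
    by simp
  also have "(m + 1) * (2 * m + 1 choose (m + 1)) = (2 * m + 1) * (2 * m choose m)"
    using Suc_times_binomial[of m "2 * m"] by simp
  finally show ?thesis by simp
qed

lemma central_binomial_square:
  assumes "1 \<le> m" shows "(16 :: real) ^ m \<le> 4 * real m * real (2 * m choose m) ^ 2"
  using assms
proof (induction m rule: nat_induct_at_least)
  case base
  then show ?case by simp
next
  case (Suc m)
  define c where "c = real (2 * m choose m)"
  define d where "d = real (2 * Suc m choose Suc m)"
  have "real ((m + 1) * (2 * (m + 1) choose (m + 1))) = real (2 * (2 * m + 1) * (2 * m choose m))"
    unfolding central_binomial_step ..
  then have rec: "(real m + 1) * d = 2 * (2 * real m + 1) * c"
    unfolding c_def d_def of_nat_mult by (simp add: add.commute del: binomial_Suc_Suc mult_Suc_right)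
  have "(real m + 1) * 16 ^ Suc m \<le> (real m + 1) * (16 * (4 * real m * c ^ 2))"
    using Suc.IH unfolding c_def by (intro mult_left_mono) simp_all
  also have "\<dots> = 16 * c ^ 2 * (4 * real m * (real m + 1))" by (simp only: mult_ac)
  also have "\<dots> \<le> 16 * c ^ 2 * (2 * real m + 1) ^ 2"
    by (intro mult_left_mono) (simp_all add: power2_eq_square algebra_simps)
  also have "\<dots> = 4 * (2 * (2 * real m + 1) * c) ^ 2" unfolding power_mult_distrib by simp
  also have "\<dots> = (real m + 1) * (4 * (real m + 1) * d ^ 2)"
    unfolding rec[symmetric] by (simp add: power2_eq_square)
  finally have "16 ^ Suc m \<le> 4 * (real m + 1) * d ^ 2" by (simp add: mult_le_cancel_left_pos)
  then show ?case unfolding d_def by (simp add: add.commute)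
qed

text \<open>
  The square-root bound on central binomial coefficients. The weaker bound \<open>4 ^ m / (2 m)\<close> would leave
  nothing of the main term \<open>n (n choose l)\<close> after subtracting a multiple of \<open>2 ^ n\<close>.
\<close>

lemma middle_binomial_lower_bound:
  assumes "1 \<le> n" shows "2 ^ n * sqrt (real n) / 2 \<le> real n * real (n choose (n div 2))"
proof -
  have sq: "4 ^ n \<le> 4 * real n * real (n choose (n div 2)) ^ 2"
  proof (cases "even n")
    case True
    then obtain m where m: "n = 2 * m" by (rule evenE)
    have "(4 :: real) ^ n = 16 ^ m" unfolding m power_mult by simp
    also have "\<dots> \<le> 4 * real m * real (n choose m) ^ 2"
      using central_binomial_square[of m] assms m by simp
    also have "\<dots> \<le> 4 * real n * real (n choose m) ^ 2"
      using m by (intro mult_right_mono) simp_all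
    finally show ?thesis using m by simp
  next
    case False
    then obtain m where m: "n = 2 * m + 1" by (rule oddE)
    have half: "n div 2 = m" using m by simp
    have "2 * (m + 1) choose (m + 1) = (n choose m) + (n choose (m + 1))" using m by simp
    also have "(n choose (m + 1)) = (n choose m)" using binomial_symmetric[of m n] m by simp
    finally have c: "real (2 * (m + 1) choose (m + 1)) = 2 * real (n choose m)" by simp
    have "(16 :: real) ^ (m + 1) \<le> 4 * real (m + 1) * (2 * real (n choose m)) ^ 2"
      using central_binomial_square[of "m + 1"] unfolding c by simp
    also have "\<dots> \<le> 4 * real n * (2 * real (n choose m)) ^ 2"
      using m by (intro mult_right_mono) simp_all
    finally have "4 * 4 ^ n \<le> 4 * (4 * real n * real (n choose m) ^ 2)"
      using m by (simp add: power_mult power_mult_distrib)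
    then show ?thesis using half by simp
  qed
  have "2 ^ n * sqrt (real n) = sqrt (4 ^ n * real n)"
    by (simp add: real_sqrt_mult real_sqrt_power)
  also have "\<dots> \<le> sqrt (4 * real n * real (n choose (n div 2)) ^ 2 * real n)"
    using sq by (intro real_sqrt_le_mono mult_right_mono) simp_all
  also have "\<dots> = sqrt ((2 * real n * real (n choose (n div 2))) ^ 2)"
    by (simp add: power2_eq_square mult_ac)
  also have "\<dots> = 2 * real n * real (n choose (n div 2))" by simp
  finally show ?thesis by simp
qed

lemma sixteen_square_le_power: "11 \<le> n \<Longrightarrow> 16 * n ^ 2 \<le> (2 :: nat) ^ n"
proof (induction n rule: nat_induct_at_least)
  case (Suc n)
  have "(Suc n) ^ 2 = n ^ 2 + 2 * n + 1" by (simp add: power2_eq_square)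
  moreover have "2 * n + 1 \<le> n ^ 2"
  proof -
    have "3 * n \<le> n * n" using Suc by simp
    then show ?thesis using Suc unfolding power2_eq_square by linarith
  qed
  ultimately show ?case using Suc.IH by simp
qed simp

text \<open>
  The sum of the preceding terms of a sequence of exponential growth is at most the current term,
  and the next term exceeds its square.
\<close>

lemma tower_dominates_sum:
  fixes b s :: "nat \<Rightarrow> nat"
  assumes b: "\<And>j. 2 ^ b j \<le> b (Suc j)" and s: "s 0 = 0" "\<And>j. s (Suc j) = s j + b j"
  shows "\<exists>j. A + m * s j \<le> b j"
proof -
  have sb: "s j \<le> b j" and jb: "j \<le> b j" for j
  proof (induction j)
    case (Suc j)
    have two: "2 * x \<le> (2 :: nat) ^ x" for x
    proof (cases x)
      case (Suc y)
      have "Suc y \<le> 2 ^ y" by (rule Suc_leI[OF less_exp])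
      then show ?thesis unfolding Suc by simp
    qed simp
    { case 1 show ?case using Suc two[of "b j"] b[of j] s(2)[of j] by simp }
    { case 2 show ?case using Suc less_exp[of "b j"] b[of j] by linarith }
  qed (simp_all add: s)
  \<comment> \<open>From \<open>b j \<ge> A + 2 m\<close> it follows that \<open>A + m s (j + 1) \<le> (A + 2 m) b j \<le> (b j)\<^sup>2 \<le> 2 ^ b j\<close>;
    the summand 11 is what the last inequality needs.\<close>
  define j where "j = A + 2 * m + 11"
  have bj: "A + 2 * m + 11 \<le> b j" using jb[of j] unfolding j_def .
  have "A + m * s (Suc j) \<le> A + m * (2 * b j)" using sb[of j] s(2)[of j] by simp
  also have "\<dots> \<le> A * b j + 2 * m * b j" using bj by simp
  also have "\<dots> = (A + 2 * m) * b j" by (simp add: distrib_right)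
  also have "\<dots> \<le> b j * b j" using bj by (intro mult_right_mono) simp_all
  also have "\<dots> \<le> 2 ^ b j" using sixteen_square_le_power[of "b j"] bj by (simp add: power2_eq_square)
  also have "\<dots> \<le> b (Suc j)" by (rule b)
  finally show ?thesis by blast
qed

text \<open>
  Let \<open>w = n \<surd>n / D\<close>. One step multiplies \<open>D\<close> by \<open>2 ^ n\<close> and \<open>n \<surd>n\<close> by at least twice as
  much, so that \<open>w\<close> at least doubles. It remains to compare the quotient at \<open>j + 2\<close> with \<open>w j\<close>. Up to
  constants, \<open>n (j + 2) / D (j + 2)\<close> is at least \<open>\<surd>(n (j + 1)) / D (j + 1)\<close>, the factor \<open>\<surd>(ln D)\<close> is
  at least \<open>\<surd>(n (j + 1))\<close> and \<open>ln (ln D)\<close> is at least \<open>n j\<close>; the product is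
  \<open>n (j + 1) n j / D (j + 1)\<close>, and \<open>n (j + 1) / D (j + 1)\<close> is at least \<open>\<surd>(n j) / D j\<close>.
\<close>

lemma homology_growth_of_tower:
  fixes n D :: "nat \<Rightarrow> nat"
  assumes n0: "256 \<le> n 0" and D0: "0 < D 0" and D: "\<And>j. D (Suc j) = D j * 2 ^ n j"
    and n: "\<And>j. 2 ^ n j * sqrt (real (n j)) / 4 \<le> real (n (Suc j))"
  shows "filterlim (\<lambda>j. real (n j) / (real (D j) / (sqrt (ln (real (D j))) * ln (ln (real (D j))))))
    at_top sequentially"
proof -
  have grow: "4 * 2 ^ n j \<le> real (n (Suc j))" if "256 \<le> n j" for j
  proof -
    have "sqrt 256 \<le> sqrt (real (n j))" using that by (intro real_sqrt_le_mono) simp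
    moreover have "sqrt 256 = (16 :: real)" by (rule real_sqrt_unique) simp_all
    ultimately have "2 ^ n j * 16 \<le> 2 ^ n j * sqrt (real (n j))" by simp
    then have "4 * 2 ^ n j \<le> 2 ^ n j * sqrt (real (n j)) / 4" by linarith
    also have "\<dots> \<le> real (n (Suc j))" by (rule n)
    finally show ?thesis .
  qed
  have n256: "256 \<le> n j" for j
  proof (induction j)
    case (Suc j)
    have "n j < 2 ^ n j" by (rule less_exp)
    then have "real (n j) \<le> 2 ^ n j" by (metis less_imp_le of_nat_le_iff of_nat_numeral of_nat_power)
    then have "real (n j) \<le> real (n (Suc j))" using grow[OF Suc] by linarith
    then show ?case using Suc by simp
  qed (rule n0)
  have Dpos: "0 < D j" for j by (induction j) (simp_all add: D0 D)
  define w where "w j = real (n j) * sqrt (real (n j)) / real (D j)" for j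
  have w_double: "2 * w j \<le> w (Suc j)" for j
  proof -
    have "real (16 * n j ^ 2) \<le> real (2 ^ n j)"
      using sixteen_square_le_power[of "n j"] n256[of j] by (intro of_nat_mono) simp
    then have "(8 * real (n j)) ^ 2 \<le> real (n (Suc j))"
      using grow[OF n256[of j]] by (simp add: power2_eq_square)
    then have s8: "8 * real (n j) \<le> sqrt (real (n (Suc j)))" by (rule real_le_rsqrt)
    have "2 * w j = (2 ^ n j * sqrt (real (n j)) / 4) * (8 * real (n j)) / real (D (Suc j))"
      unfolding w_def D by simp
    also have "\<dots> \<le> w (Suc j)" unfolding w_def
      by (intro divide_right_mono mult_mono n s8) simp_all
    finally show ?thesis .
  qed
  have w0: "0 < w 0" unfolding w_def using n0 D0 by simp
  have w_lower: "2 ^ j * w 0 \<le> w j" for j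
  proof (induction j)
    case (Suc j)
    then show ?case using w_double[of j] by simp
  qed simp
  let ?q = "\<lambda>j. real (n j) / (real (D j) / (sqrt (ln (real (D j))) * ln (ln (real (D j)))))"
  have q: "w j / 64 \<le> ?q (j + 2)" for j
  proof -
    define n1 n2 D1 D2 where "n1 = real (n (Suc j))" and "n2 = real (n (Suc (Suc j)))"
      and "D1 = real (D (Suc j))" and "D2 = real (D (Suc (Suc j)))"
    have D1: "D1 = real (D j) * 2 ^ n j" "0 < D1" unfolding D1_def using Dpos[of "Suc j"] by (simp_all add: D)
    have D2: "D2 = D1 * 2 ^ n (Suc j)" "0 < D2" unfolding D2_def D1_def
      using Dpos[of "Suc (Suc j)"] by (simp_all add: D)
    have ln2: "1 / 2 \<le> ln (2 :: real)" using ln_le_minus_one[of "1 / 2 :: real"] by (simp add: ln_div)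
    have "1 \<le> D1" unfolding D1_def using Dpos[of "Suc j"] by simp
    then have "2 ^ n (Suc j) \<le> D2" unfolding D2(1) by simp
    then have "ln (2 ^ n (Suc j)) \<le> ln D2" using D2(2) by (subst ln_le_cancel_iff) simp_all
    then have "n1 * ln 2 \<le> ln D2" unfolding n1_def by (simp add: ln_realpow)
    moreover have "n1 * (1 / 2) \<le> n1 * ln 2" unfolding n1_def by (intro mult_left_mono ln2) simp
    moreover have n1: "4 * 2 ^ n j \<le> n1" unfolding n1_def by (rule grow[OF n256])
    moreover have "0 \<le> n1" unfolding n1_def by simp
    ultimately have lnD2: "n1 / 4 \<le> ln D2" by simp
    have n1_256: "256 \<le> n1" using n256[of "Suc j"] unfolding n1_def by simp
    have "sqrt (n1 / 4) \<le> sqrt (ln D2)" using lnD2 by simp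
    then have sq: "sqrt n1 / 2 \<le> sqrt (ln D2)" by (simp add: real_sqrt_divide)
    have "real (n j) * ln 2 = ln (2 ^ n j)" by (simp add: ln_realpow)
    also have "\<dots> \<le> ln (ln D2)"
    proof -
      have "2 ^ n j \<le> ln D2" using n1 lnD2 by simp
      moreover have "(0 :: real) < 2 ^ n j" by simp
      ultimately show ?thesis by (metis ln_le_cancel_iff less_le_trans)
    qed
    finally have lnln: "real (n j) / 2 \<le> ln (ln D2)"
      using mult_left_mono[OF ln2, of "real (n j)"] by simp
    have "w j / 64 = (2 ^ n j * sqrt (real (n j)) / 4) * real (n j) / (16 * D1)"
      unfolding w_def D1(1) by (simp add: mult.commute)
    also have "\<dots> \<le> n1 * real (n j) / (16 * D1)"
      unfolding n1_def using D1(2) by (intro divide_right_mono mult_right_mono n) simp_all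
    also have "\<dots> = (sqrt n1 * sqrt n1) * real (n j) / (16 * D1)" using n1_256 by simp
    also have "\<dots> = (2 ^ n (Suc j) * sqrt n1 / 4) * ((sqrt n1 / 2) * (real (n j) / 2)) / D2"
      unfolding D2(1) by simp
    also have "\<dots> \<le> n2 * (sqrt (ln D2) * ln (ln D2)) / D2"
    proof (intro divide_right_mono mult_mono)
      show "2 ^ n (Suc j) * sqrt n1 / 4 \<le> n2" unfolding n1_def n2_def by (rule n)
      show "0 \<le> sqrt (ln D2)" using sq n1_256 by (meson divide_nonneg_nonneg order_trans real_sqrt_ge_zero \<open>0 \<le> n1\<close> zero_le_numeral)
    qed (use sq lnln D2(2) n1_256 in \<open>simp_all add: n2_def\<close>)
    also have "\<dots> = ?q (j + 2)" unfolding n2_def D2_def by simp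
    finally show ?thesis .
  qed
  have lim: "filterlim (\<lambda>j. w 0 / 64 * real j) at_top sequentially"
    by (rule filterlim_tendsto_pos_mult_at_top[OF tendsto_const _ filterlim_real_sequentially])
      (use w0 in simp)
  have le: "w 0 / 64 * real j \<le> ?q (Suc (Suc j))" for j
  proof -
    have "real j \<le> 2 ^ j" using less_exp[of j] by (metis less_imp_le of_nat_le_iff of_nat_numeral of_nat_power)
    then have "w 0 * real j \<le> w 0 * 2 ^ j" using w0 by simp
    then show ?thesis using q[of j] w_lower[of j] by (simp add: mult.commute)
  qed
  have "filterlim (\<lambda>j. ?q (Suc (Suc j))) at_top sequentially"
    by (rule filterlim_at_top_mono[OF lim always_eventually]) (intro allI le)
  then show ?thesis
    using filterlim_sequentially_Suc[of "\<lambda>j. ?q (Suc j)"] filterlim_sequentially_Suc[of ?q] by blast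
qed

section \<open>Towers of mod 2 Frattini subgroups\<close>

text \<open>
  Used for subgroups of finite index of a finitely generated group, whose first Betti number is finite.
\<close>

definition b1 :: "('a, 'b) monoid_scheme \<Rightarrow> 'a set \<Rightarrow> nat" where
  "b1 G H = the_enat (betti TYPE(bit) 1 (G\<lparr>carrier := H\<rparr>))"

lemma b1_finite_index:
  assumes fg: "finitely_generated_group G" and H: "finite_index_subgroup H G"
  shows "finite (bit_homs (G\<lparr>carrier := H\<rparr>))" "betti TYPE(bit) 1 (G\<lparr>carrier := H\<rparr>) = enat (b1 G H)"
    "card (bit_homs (G\<lparr>carrier := H\<rparr>)) = 2 ^ b1 G H"
proof -
  interpret group G using fg unfolding finitely_generated_group_def by blast
  have sH: "subgroup H G" "finite (rcosets\<^bsub>G\<^esub> H)" using H unfolding finite_index_subgroup_def by auto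
  interpret H: group "G\<lparr>carrier := H\<rparr>" by (rule subgroup_imp_group[OF sH(1)])
  obtain S where S: "finite S" "S \<subseteq> carrier G" "generate G S = carrier G"
    using fg unfolding finitely_generated_group_def by blast
  show fin: "finite (bit_homs (G\<lparr>carrier := H\<rparr>))" by (rule finite_bit_homs_finite_index[OF S sH])
  obtain n where n: "betti TYPE(bit) 1 (G\<lparr>carrier := H\<rparr>) = enat n"
    "card (bit_homs (G\<lparr>carrier := H\<rparr>)) = 2 ^ n"
    by (rule H.betti_1_eq_log_card_bit_homs[OF fin])
  show "betti TYPE(bit) 1 (G\<lparr>carrier := H\<rparr>) = enat (b1 G H)"
    "card (bit_homs (G\<lparr>carrier := H\<rparr>)) = 2 ^ b1 G H"
    unfolding b1_def n by simp_all
qed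

text \<open>
  An infinite \<open>b\<^sub>2\<close> is excluded by the property since \<open>b\<^sub>1\<close> is finite.
\<close>

lemma betti_2_le_b1:
  assumes fg: "finitely_generated_group G" and b2b1: "b2_b1_property TYPE(bit) G"
  obtains C :: nat where
    "\<And>H. finite_index_subgroup H G \<Longrightarrow> \<exists>m. betti TYPE(bit) 2 (G\<lparr>carrier := H\<rparr>) = enat m \<and> m \<le> b1 G H + C"
proof -
  obtain c :: real where c: "\<forall>H. finite_index_subgroup H G \<longrightarrow>
        ereal_of_enat (betti TYPE(bit) 2 (G\<lparr>carrier := H\<rparr>))
          - ereal_of_enat (betti TYPE(bit) 1 (G\<lparr>carrier := H\<rparr>)) \<le> ereal c"
    using b2b1 unfolding b2_b1_property_def by blast
  show thesis
  proof (rule that[of "nat \<lceil>c\<rceil>"])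
    fix H assume H: "finite_index_subgroup H G"
    have le: "ereal_of_enat (betti TYPE(bit) 2 (G\<lparr>carrier := H\<rparr>)) - ereal_of_enat (enat (b1 G H)) \<le> ereal c"
      using c[rule_format, OF H] unfolding b1_finite_index(2)[OF fg H] .
    show "\<exists>m. betti TYPE(bit) 2 (G\<lparr>carrier := H\<rparr>) = enat m \<and> m \<le> b1 G H + nat \<lceil>c\<rceil>"
    proof (cases "betti TYPE(bit) 2 (G\<lparr>carrier := H\<rparr>)")
      case (enat m)
      then have "real m - real (b1 G H) \<le> c" using le by simp
      then have "real m \<le> real (b1 G H + nat \<lceil>c\<rceil>)" by linarith
      then show ?thesis using enat by simp
    next
      case infinity
      then show ?thesis using le by simp
    qed
  qed
qed

text \<open>
  The threshold \<open>T\<close> makes \<open>(C + 1) 2 ^ n\<close> at most half of the main term \<open>2 ^ n \<surd>n / 2\<close>. The value 256,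
  whose square root is 16, is for later use in growth estimates.
\<close>

lemma frattini_step:
  assumes fg: "finitely_generated_group G" and b2b1: "b2_b1_property TYPE(bit) G"
  obtains T where "256 \<le> T"
    "\<And>H. finite_index_subgroup H G \<Longrightarrow> finite_index_subgroup (mod2_frattini (G\<lparr>carrier := H\<rparr>)) G \<and>
       group_index G (mod2_frattini (G\<lparr>carrier := H\<rparr>)) = group_index G H * 2 ^ b1 G H"
    "\<And>H. finite_index_subgroup H G \<Longrightarrow> T \<le> b1 G H \<Longrightarrow>
       2 ^ b1 G H * sqrt (real (b1 G H)) / 4 \<le> real (b1 G (mod2_frattini (G\<lparr>carrier := H\<rparr>)))"
proof -
  interpret group G using fg unfolding finitely_generated_group_def by blast
  obtain C where C: "\<And>H. finite_index_subgroup H G \<Longrightarrow>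
      \<exists>m. betti TYPE(bit) 2 (G\<lparr>carrier := H\<rparr>) = enat m \<and> m \<le> b1 G H + C"
    using betti_2_le_b1[OF fg b2b1] by blast
  have index: "finite_index_subgroup (mod2_frattini (G\<lparr>carrier := H\<rparr>)) G \<and>
       group_index G (mod2_frattini (G\<lparr>carrier := H\<rparr>)) = group_index G H * 2 ^ b1 G H"
    if H: "finite_index_subgroup H G" for H
  proof -
    have sH: "subgroup H G" "finite (rcosets\<^bsub>G\<^esub> H)" using H unfolding finite_index_subgroup_def by auto
    interpret H: group "G\<lparr>carrier := H\<rparr>" by (rule subgroup_imp_group[OF sH(1)])
    let ?K = "mod2_frattini (G\<lparr>carrier := H\<rparr>)"
    note b = b1_finite_index[OF fg H]
    have KH: "?K \<subseteq> H" using subgroup.subset[OF H.mod2_frattini_subgroup] by simp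
    have sK: "subgroup ?K G" by (rule incl_subgroup[OF sH(1) H.mod2_frattini_subgroup])
    note tower = index_tower[OF sH(1) sK KH sH(2) H.index_mod2_frattini(1)[OF b(1)]]
    show ?thesis unfolding finite_index_subgroup_def group_index_def
      using sK tower H.index_mod2_frattini(2)[OF b(1)] b(3) by simp
  qed
  have growth: "2 ^ b1 G H * sqrt (real (b1 G H)) / 4 \<le> real (b1 G (mod2_frattini (G\<lparr>carrier := H\<rparr>)))"
    if H: "finite_index_subgroup H G" and T: "256 + (4 * (C + 1)) ^ 2 \<le> b1 G H" for H
  proof -
    have sH: "subgroup H G" using H unfolding finite_index_subgroup_def by auto
    interpret H: group "G\<lparr>carrier := H\<rparr>" by (rule subgroup_imp_group[OF sH(1)])
    let ?K = "mod2_frattini (G\<lparr>carrier := H\<rparr>)"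
    define n where "n = b1 G H"
    define b where "b = b1 G ?K"
    have K: "finite_index_subgroup ?K G" using index[OF H] by blast
    obtain m where m: "betti TYPE(bit) 2 (G\<lparr>carrier := H\<rparr>) = enat m" "m \<le> n + C"
      using C[OF H] unfolding n_def by blast
    note bH = b1_finite_index[OF fg H] and bK = b1_finite_index[OF fg K]
    have "n * (n choose (n div 2)) \<le> b + (C + 1) * 2 ^ n"
      by (rule H.frattini_betti_lower_bound[OF _ _ m])
        (use bH bK in \<open>simp_all add: n_def b_def\<close>)
    then have "real (n * (n choose (n div 2))) \<le> real (b + (C + 1) * 2 ^ n)" by (rule of_nat_mono)
    then have 1: "real n * real (n choose (n div 2)) \<le> real b + (real C + 1) * 2 ^ n" by (simp add: algebra_simps)
    have "real ((4 * (C + 1)) ^ 2) \<le> real n" using T unfolding n_def by (intro of_nat_mono) simp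
    then have "(4 * (real C + 1)) ^ 2 \<le> real n" by (simp add: add.commute)
    then have "4 * (real C + 1) \<le> sqrt (real n)" by (rule real_le_rsqrt)
    then have "2 ^ n * (4 * (real C + 1)) \<le> 2 ^ n * sqrt (real n)" by simp
    moreover have "2 ^ n * sqrt (real n) / 2 \<le> real n * real (n choose (n div 2))"
      by (rule middle_binomial_lower_bound) (use T in \<open>simp add: n_def\<close>)
    ultimately have "2 ^ n * sqrt (real n) / 4 \<le> real b" using 1 by (simp add: algebra_simps)
    then show ?thesis unfolding n_def b_def .
  qed
  show thesis by (rule that[of "256 + (4 * (C + 1)) ^ 2", OF _ index growth]) simp_all
qed

definition frattini_series :: "('a, 'b) monoid_scheme \<Rightarrow> 'a set \<Rightarrow> nat \<Rightarrow> 'a set" where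
  "frattini_series G H = rec_nat H (\<lambda>_ K. mod2_frattini (G\<lparr>carrier := K\<rparr>))"

lemma frattini_series_simps [simp]:
  "frattini_series G H 0 = H"
  "frattini_series G H (Suc j) = mod2_frattini (G\<lparr>carrier := frattini_series G H j\<rparr>)"
  unfolding frattini_series_def by simp_all

lemma frattini_series_normal:
  assumes "group G" "H \<lhd> G" shows "frattini_series G H j \<lhd> G"
proof (induction j)
  case (Suc j)
  then show ?case using group.mod2_frattini_normal[OF assms(1)] by simp
qed (use assms in simp)

lemma frattini_series_growth:
  assumes T: "256 \<le> T"
    and index: "\<And>H. finite_index_subgroup H G \<Longrightarrow> finite_index_subgroup (mod2_frattini (G\<lparr>carrier := H\<rparr>)) G"
    and growth: "\<And>H. finite_index_subgroup H G \<Longrightarrow> T \<le> b1 G H \<Longrightarrow>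
       2 ^ b1 G H * sqrt (real (b1 G H)) / 4 \<le> real (b1 G (mod2_frattini (G\<lparr>carrier := H\<rparr>)))"
    and H: "finite_index_subgroup H G" "T \<le> b1 G H"
  shows "finite_index_subgroup (frattini_series G H j) G" "T \<le> b1 G (frattini_series G H j)"
    "2 ^ b1 G (frattini_series G H j) \<le> b1 G (frattini_series G H (Suc j))"
proof -
  have pow: "2 ^ b1 G K \<le> b1 G (mod2_frattini (G\<lparr>carrier := K\<rparr>))"
    if K: "finite_index_subgroup K G" "T \<le> b1 G K" for K
  proof -
    have "sqrt 256 \<le> sqrt (real (b1 G K))" using K(2) T by (intro real_sqrt_le_mono) simp
    moreover have "sqrt 256 = (16 :: real)" by (rule real_sqrt_unique) simp_all
    ultimately have "(2 :: real) ^ b1 G K * 4 \<le> 2 ^ b1 G K * sqrt (real (b1 G K))"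
      by (intro mult_left_mono) simp_all
    then have "(2 :: real) ^ b1 G K \<le> real (b1 G (mod2_frattini (G\<lparr>carrier := K\<rparr>)))"
      using growth[OF K] by linarith
    then show ?thesis by (metis of_nat_le_iff of_nat_numeral of_nat_power)
  qed
  have inv: "finite_index_subgroup (frattini_series G H j) G \<and> T \<le> b1 G (frattini_series G H j)" for j
  proof (induction j)
    case (Suc j)
    let ?K = "frattini_series G H j"
    have "b1 G ?K < 2 ^ b1 G ?K" by (rule less_exp)
    also have "\<dots> \<le> b1 G (mod2_frattini (G\<lparr>carrier := ?K\<rparr>))" using pow[of ?K] Suc by blast
    finally show ?case using Suc index[of ?K] by simp
  qed (use H in simp)
  show "finite_index_subgroup (frattini_series G H j) G" "T \<le> b1 G (frattini_series G H j)"
    "2 ^ b1 G (frattini_series G H j) \<le> b1 G (frattini_series G H (Suc j))"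
    using inv[of j] pow[of "frattini_series G H j"] by simp_all
qed

text \<open>
  Let \<open>L j\<close> be the iterated Frattini subgroups of a subgroup \<open>H\<close> of index \<open>m\<close>, and \<open>s j\<close> the sum of the
  preceding \<open>b\<^sub>1\<close>. The index of \<open>L j\<close> is \<open>m 2 ^ s j\<close>. It is normal in \<open>H\<close>, so its core has index at most
  \<open>(m 2 ^ s j) ^ m\<close> and \<open>b\<^sub>1\<close> at least \<open>b\<^sub>1(L j) - m (m + s j)\<close>, which is large for some \<open>j\<close>.
\<close>

lemma large_b1_normal_subgroup:
  assumes fg: "finitely_generated_group G" and b2b1: "b2_b1_property TYPE(bit) G"
    and sup: "(SUP H \<in> {H. finite_index_subgroup H G}. betti TYPE(bit) 1 (G\<lparr>carrier := H\<rparr>)) = \<infinity>"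
  shows "\<exists>N. N \<lhd> G \<and> finite_index_subgroup N G \<and> M \<le> b1 G N"
proof -
  interpret group G using fg unfolding finitely_generated_group_def by blast
  obtain T where T: "256 \<le> T"
    and index: "\<And>H. finite_index_subgroup H G \<Longrightarrow> finite_index_subgroup (mod2_frattini (G\<lparr>carrier := H\<rparr>)) G \<and>
       group_index G (mod2_frattini (G\<lparr>carrier := H\<rparr>)) = group_index G H * 2 ^ b1 G H"
    and growth: "\<And>H. finite_index_subgroup H G \<Longrightarrow> T \<le> b1 G H \<Longrightarrow>
       2 ^ b1 G H * sqrt (real (b1 G H)) / 4 \<le> real (b1 G (mod2_frattini (G\<lparr>carrier := H\<rparr>)))"
    using frattini_step[OF fg b2b1] by blast
  have "\<exists>H. finite_index_subgroup H G \<and> T \<le> b1 G H"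
  proof (rule ccontr)
    assume no: "\<not> ?thesis"
    have "betti TYPE(bit) 1 (G\<lparr>carrier := H\<rparr>) \<le> enat T" if "H \<in> {H. finite_index_subgroup H G}" for H
      using no that b1_finite_index(2)[OF fg, of H] by (auto simp: not_le)
    then have "(SUP H \<in> {H. finite_index_subgroup H G}. betti TYPE(bit) 1 (G\<lparr>carrier := H\<rparr>)) \<le> enat T"
      by (rule SUP_least)
    then show False unfolding sup by simp
  qed
  then obtain H where H: "finite_index_subgroup H G" "T \<le> b1 G H" by blast
  have sH: "subgroup H G" "finite (rcosets\<^bsub>G\<^esub> H)" using H(1) unfolding finite_index_subgroup_def by auto
  interpret GH: group "G\<lparr>carrier := H\<rparr>" by (rule subgroup_imp_group[OF sH(1)])
  define L where "L = frattini_series G H"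
  note series = frattini_series_growth[OF T index[THEN conjunct1] growth H, folded L_def]
  have L_GH: "L j = frattini_series (G\<lparr>carrier := H\<rparr>) H j" for j
    unfolding L_def by (induction j) simp_all
  have "H \<lhd> (G\<lparr>carrier := H\<rparr>)"
    unfolding GH.normal_inv_iff using GH.subgroup_self GH.m_closed GH.inv_closed by simp
  then have L_normal: "L j \<lhd> (G\<lparr>carrier := H\<rparr>)" for j
    unfolding L_GH using frattini_series_normal[OF GH.is_group] by blast
  define m where "m = group_index G H"
  define s where "s j = (\<Sum>i<j. b1 G (L i))" for j
  have L_index: "group_index G (L j) = m * 2 ^ s j" for j
  proof (induction j)
    case 0
    then show ?case by (simp add: L_def m_def s_def)
  next
    case (Suc j)
    have "group_index G (L (Suc j)) = group_index G (L j) * 2 ^ b1 G (L j)"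
      using index[OF series(1)[of j]] unfolding L_def by simp
    then show ?case using Suc by (simp add: s_def power_add)
  qed
  have "\<exists>j. (M + m * m) + m * s j \<le> b1 G (L j)"
    by (rule tower_dominates_sum) (use series(3) in \<open>simp_all add: s_def\<close>)
  then obtain j where j: "M + m * m + m * s j \<le> b1 G (L j)" by blast
  have Lj: "finite (rcosets\<^bsub>G\<^esub> (L j))" "subgroup (L j) G"
    using series(1)[of j] unfolding finite_index_subgroup_def by auto
  obtain N where N: "N \<lhd> G" "N \<subseteq> L j" "finite (rcosets\<^bsub>G\<^esub> N)"
    "card (rcosets\<^bsub>G\<^esub> N) \<le> card (rcosets\<^bsub>G\<^esub> (L j)) ^ card (rcosets\<^bsub>G\<^esub> H)"
    by (rule normal_core_index[OF sH L_normal Lj(1)])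
  have sN: "subgroup N G" using N(1) by (rule normal_imp_subgroup)
  have fN: "finite_index_subgroup N G" using sN N(3) unfolding finite_index_subgroup_def by blast
  interpret GL: group "G\<lparr>carrier := L j\<rparr>" by (rule subgroup_imp_group[OF Lj(2)])
  have NL: "subgroup N (G\<lparr>carrier := L j\<rparr>)" by (rule subgroup_incl[OF sN Lj(2) N(2)])
  have sub: "rcosets\<^bsub>G\<lparr>carrier := L j\<rparr>\<^esub> N \<subseteq> rcosets\<^bsub>G\<^esub> N"
    unfolding rcosets_carrier_update using subgroup.subset[OF Lj(2)] by (auto simp: RCOSETS_def)
  note bL = b1_finite_index[OF fg series(1)[of j]] and bN = b1_finite_index[OF fg fN]
  have "m < 2 ^ m" by (rule less_exp)
  then have idx: "m * 2 ^ s j \<le> 2 ^ (m + s j)" by (simp add: power_add)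
  have "2 ^ b1 G (L j) \<le> 2 ^ b1 G N * card (rcosets\<^bsub>G\<lparr>carrier := L j\<rparr>\<^esub> N)"
    using GL.card_bit_homs_le_restriction[OF NL finite_subset[OF sub N(3)] bL(1)] bL(3) bN(1,3) by simp
  also have "\<dots> \<le> 2 ^ b1 G N * (m * 2 ^ s j) ^ m"
    using card_mono[OF N(3) sub] N(4) L_index[of j] unfolding m_def group_index_def by simp
  also have "\<dots> \<le> 2 ^ b1 G N * (2 ^ (m + s j)) ^ m"
    by (intro mult_left_mono power_mono idx) simp_all
  also have "\<dots> = 2 ^ (b1 G N + (m + s j) * m)" by (simp only: power_add power_mult)
  finally have "b1 G (L j) \<le> b1 G N + (m + s j) * m" by simp
  then have "M \<le> b1 G N" using j by (simp add: algebra_simps)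
  then show ?thesis using N(1) fN by blast
qed

theorem theorem1p7:
  fixes G :: "('a, 'b) monoid_scheme"
  assumes "finitely_generated_group G"
    and "b2_b1_property TYPE(bit) G"
    and "(SUP H \<in> {H. finite_index_subgroup H G}. betti TYPE(bit) 1 (G\<lparr>carrier := H\<rparr>)) = \<infinity>"
  shows "\<exists>N :: nat \<Rightarrow> 'a set.
     decseq N \<and>
     (\<forall>i. N i \<lhd> G \<and> finite_index_subgroup (N i) G) \<and>
     grows_faster
       (\<lambda>i. real (the_enat (betti TYPE(bit) 1 (G\<lparr>carrier := N i\<rparr>))))
       (\<lambda>i. let n = real (group_index G (N i)) in n / (sqrt (ln n) * ln (ln n)))"
proof -
  interpret group G using assms(1) unfolding finitely_generated_group_def by blast
  obtain T where T: "256 \<le> T"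
    and index: "\<And>H. finite_index_subgroup H G \<Longrightarrow> finite_index_subgroup (mod2_frattini (G\<lparr>carrier := H\<rparr>)) G \<and>
       group_index G (mod2_frattini (G\<lparr>carrier := H\<rparr>)) = group_index G H * 2 ^ b1 G H"
    and growth: "\<And>H. finite_index_subgroup H G \<Longrightarrow> T \<le> b1 G H \<Longrightarrow>
       2 ^ b1 G H * sqrt (real (b1 G H)) / 4 \<le> real (b1 G (mod2_frattini (G\<lparr>carrier := H\<rparr>)))"
    using frattini_step[OF assms(1,2)] by blast
  obtain N0 where N0: "N0 \<lhd> G" "finite_index_subgroup N0 G" "T \<le> b1 G N0"
    using large_b1_normal_subgroup[OF assms] by blast
  define N where "N = frattini_series G N0"
  note series = frattini_series_growth[OF T index[THEN conjunct1] growth N0(2,3), folded N_def]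
  have N_Suc: "N (Suc i) = mod2_frattini (G\<lparr>carrier := N i\<rparr>)" for i unfolding N_def by simp
  have "decseq N"
    by (rule decseq_SucI) (auto simp: N_Suc mod2_frattini_def joint_kernel_def)
  moreover have "N i \<lhd> G \<and> finite_index_subgroup (N i) G" for i
    using frattini_series_normal[OF is_group N0(1), of i] series(1)[of i] unfolding N_def by blast
  moreover have "filterlim (\<lambda>i. real (b1 G (N i)) / (real (group_index G (N i)) /
      (sqrt (ln (real (group_index G (N i)))) * ln (ln (real (group_index G (N i)))))))
    at_top sequentially"
  proof (rule homology_growth_of_tower)
    show "256 \<le> b1 G (N 0)" using series(2)[of 0] T by simp
    have "rcosets\<^bsub>G\<^esub> N0 \<noteq> {}" unfolding RCOSETS_def by auto
    then show "0 < group_index G (N 0)"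
      using N0(2) unfolding N_def group_index_def finite_index_subgroup_def by (simp add: card_gt_0_iff)
    show "group_index G (N (Suc i)) = group_index G (N i) * 2 ^ b1 G (N i)" for i
      unfolding N_Suc using index[OF series(1)] by blast
    show "2 ^ b1 G (N i) * sqrt (real (b1 G (N i))) / 4 \<le> real (b1 G (N (Suc i)))" for i
      unfolding N_Suc by (rule growth[OF series(1,2)])
  qed
  ultimately show ?thesis unfolding grows_faster_def Let_def b1_def by blast
qed

end
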